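(* Let $p_1>p_2$ be nonzero real numbers and let $Q>1$. With $\Omega$, $A^Q_{p_1,p_2}$, $\mathcal B$ and the explicit function $B:\Omega\to\mathbb R$ defined as in the context, for every $x\in\Omega$ one has $$\mathcal B(x)=B(x),$$ and the supremum defining $\mathcal B(x)$ is attained: for every $x=(x_1,x_2)\in\Omega$ there is $w\in A^Q_{p_1,p_2}$ with $\langle w^{p_1}\rangle=x_1$, $\langle w^{p_2}\rangle=x_2$ and $|\{t\in[0,1]: w(t)\ge 1\}|=B(x)$. Moreover, for every $\lambda>0$ and $x\in\Omega$, $$\sup\left\{|\{t\in[0,1]: w(t)\ge\lambda\}| : \langle w^{p_1}\rangle=x_1,\ \langle w^{p_2}\rangle=x_2,\ w\in A^Q_{p_1,p_2}\right\}=B(\lambda^{-p_1}x_1,\lambda^{-p_2}x_2).$$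
   Context: Let $I=[0,1]$; for an interval $J\subset I$ put $\langle\varphi\rangle_J=\frac1{|J|}\int_J\varphi$, and $\langle\varphi\rangle=\langle\varphi\rangle_I$. $A^Q_{p_1,p_2}$ is the set of measurable $w\ge0$ on $I$ with $w^{p_1},w^{p_2}$ integrable (so $w>0$ a.e. if a negative exponent occurs) such that $\langle w^{p_1}\rangle_J^{1/p_1}\le Q\,\langle w^{p_2}\rangle_J^{1/p_2}$ for every interval $J\subset I$. $\Omega=\{(x_1,x_2): x_1,x_2>0,\ x_2^{1/p_2}\le x_1^{1/p_1}\le Qx_2^{1/p_2}\}$, and for $x\in\Omega$ $$\mathcal B(x)=\sup\{|\{t\in I: w(t)\ge1\}|:\ \langle w^{p_1}\rangle=x_1,\ \langle w^{p_2}\rangle=x_2,\ w\in A^Q_{p_1,p_2}\}.$$ Constants: $0<\gamma_-<1<\gamma_+$ are the two positive solutions $\gamma$ of $Q^{-p_2}\left(1-\frac{p_2}{p_1}\right)\gamma^{p_2}=1-\frac{p_2}{p_1}Q^{-p_2}\gamma^{p_2-p_1}$; $v_-=\gamma_-/\gamma_+$; $A=Q^{-p_2}\gamma_+^{p_2-p_1}$ (one has $A<1$); $L_\pm(x_1)=Q^{-p_2}\frac{p_2}{p_1}\gamma_\pm^{p_2-p_1}(x_1-1)+1$. Subdomains of $\Omega$ (they cover $\Omega$; the formulas below agree on overlaps, except that at $(1,1)$ the value is $B(1,1)=1$): - $\Omega_{\rm I}$: $p_2(x_2-L_+(x_1))\ge0$ or $p_1x_1\ge p_1\gamma_+^{p_1}$;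 - $\Omega_{\rm II}$: $p_2(x_2-L_+(x_1))\le0$, $p_2(x_2-L_-(x_1))\le0$ and $p_1\gamma_-^{p_1}\le p_1x_1\le p_1\gamma_+^{p_1}$; - $\Omega_{\rm III}$: $p_2(x_2-L_-(x_1))\ge0$, $x\neq(1,1)$; - $\Omega_{\rm IV}$: $p_2(x_2-L_-(x_1))\le0$ and $p_1x_1\le p_1\gamma_-^{p_1}$. The function $v=v(x)>0$: for $x\in\Omega_{\rm III}$, $v\ne1$ is the solution of $v^{p_2}(1-x_1)-v^{p_1}(1-x_2)=x_2-x_1$ (i.e. $(v^{p_1},v^{p_2})$ is the second intersection with the curve $\{(u^{p_1},u^{p_2}):u>0\}$ of the line through $x$ and $(1,1)$); for $x\in\Omega_{\rm IV}$, $v$ is the solution of $x_2=\frac{p_2}{p_1}A\,v^{p_2-p_1}(x_1-v^{p_1})+v^{p_2}$ for which $x$ lies on the segment from $(v^{p_1},v^{p_2})$ to $((\gamma_+v)^{p_1},Q^{-p_2}(\gamma_+v)^{p_2})$, i.e. $p_1v^{p_1}\le p_1x_1\le p_1(\gamma_+v)^{p_1}$. The function $B$: - $B(x)=1$ for $x\in\Omega_{\rm I}$; - $B(x)=\frac{v_-^{p_1}}{(1-v_-^{p_1})(v_-^{p_1}-v_-^{p_2})}x_1+\frac{v_-^{p_2}}{(v_-^{p_2}-1)(v_-^{p_1}-v_-^{p_2})}x_2+1-\frac1{(v_-^{p_1}-1)(v_-^{p_2}-1)}$ for $x\in\Omega_{\rm II}$; - $B(x)=\frac{x_1-v^{p_1}}{1-v^{p_1}}$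 for $x\in\Omega_{\rm III}$; - $B(x)=\frac1{1-A}\cdot\frac{v_-^{-(p_1-p_2)A/(1-A)}}{1-v_-^{p_1}}\,v^{\frac{p_1-p_2}{1-A}}\left(\frac{p_1-p_2}{p_2}v^{p_2}+x_1v^{p_2-p_1}-\frac{p_1}{p_2}x_2\right)$ for $x\in\Omega_{\rm IV}$. *)

theory Defs
  imports "HOL-Analysis.Analysis"
begin

definition avg :: "real set \<Rightarrow> (real \<Rightarrow> real) \<Rightarrow> real" where
  "avg J \<phi> = (1 / measure lebesgue J) * (LINT t:J|lebesgue. \<phi> t)"

text \<open>
  Since \<open>0 powr p = 0\<close> also for negative \<open>p\<close>, positivity almost everywhere has to be demanded
  explicitly when an exponent is negative: a zero set of positive measure would make
  \<open>w\<close> to that exponent infinite there, hence not integrable. Averages do not depend on whether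
  an interval contains its endpoints, so closed nondegenerate intervals suffice.
\<close>

definition weight_class :: "real \<Rightarrow> real \<Rightarrow> real \<Rightarrow> (real \<Rightarrow> real) set" where
  "weight_class p1 p2 Q = {w.
     w \<in> borel_measurable (lebesgue_on {0..1}) \<and>
     (\<forall>t\<in>{0..1}. 0 \<le> w t) \<and>
     (p1 < 0 \<or> p2 < 0 \<longrightarrow> (AE t in lebesgue_on {0..1}. 0 < w t)) \<and>
     set_integrable lebesgue {0..1} (\<lambda>t. w t powr p1) \<and>
     set_integrable lebesgue {0..1} (\<lambda>t. w t powr p2) \<and>
     (\<forall>a b. 0 \<le> a \<and> a < b \<and> b \<le> 1 \<longrightarrow>
        avg {a..b} (\<lambda>t. w t powr p1) powr (1 / p1)
          \<le> Q * avg {a..b} (\<lambda>t. w t powr p2) powr (1 / p2))}"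

definition Omega :: "real \<Rightarrow> real \<Rightarrow> real \<Rightarrow> (real \<times> real) set" where
  "Omega p1 p2 Q = {(x1, x2). 0 < x1 \<and> 0 < x2 \<and>
     x2 powr (1 / p2) \<le> x1 powr (1 / p1) \<and> x1 powr (1 / p1) \<le> Q * x2 powr (1 / p2)}"

definition admissible :: "real \<Rightarrow> real \<Rightarrow> real \<Rightarrow> real \<times> real \<Rightarrow> (real \<Rightarrow> real) set" where
  "admissible p1 p2 Q x = {w \<in> weight_class p1 p2 Q.
     avg {0..1} (\<lambda>t. w t powr p1) = fst x \<and> avg {0..1} (\<lambda>t. w t powr p2) = snd x}"

definition bellman :: "real \<Rightarrow> real \<Rightarrow> real \<Rightarrow> real \<times> real \<Rightarrow> real" where
  "bellman p1 p2 Q x =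
     Sup {measure lebesgue {t \<in> {0..1}. 1 \<le> w t} | w. w \<in> admissible p1 p2 Q x}"

definition gamma_eq :: "real \<Rightarrow> real \<Rightarrow> real \<Rightarrow> real \<Rightarrow> bool" where
  "gamma_eq p1 p2 Q g \<longleftrightarrow>
     Q powr (- p2) * (1 - p2 / p1) * g powr p2
       = 1 - p2 / p1 * Q powr (- p2) * g powr (p2 - p1)"

definition gamma_minus :: "real \<Rightarrow> real \<Rightarrow> real \<Rightarrow> real" where
  "gamma_minus p1 p2 Q = (THE g. 0 < g \<and> g < 1 \<and> gamma_eq p1 p2 Q g)"

definition gamma_plus :: "real \<Rightarrow> real \<Rightarrow> real \<Rightarrow> real" where
  "gamma_plus p1 p2 Q = (THE g. 1 < g \<and> gamma_eq p1 p2 Q g)"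

definition v_minus :: "real \<Rightarrow> real \<Rightarrow> real \<Rightarrow> real" where
  "v_minus p1 p2 Q = gamma_minus p1 p2 Q / gamma_plus p1 p2 Q"

definition A_const :: "real \<Rightarrow> real \<Rightarrow> real \<Rightarrow> real" where
  "A_const p1 p2 Q = Q powr (- p2) * gamma_plus p1 p2 Q powr (p2 - p1)"

definition L_minus :: "real \<Rightarrow> real \<Rightarrow> real \<Rightarrow> real \<Rightarrow> real" where
  "L_minus p1 p2 Q x1 =
     Q powr (- p2) * (p2 / p1) * gamma_minus p1 p2 Q powr (p2 - p1) * (x1 - 1) + 1"

definition L_plus :: "real \<Rightarrow> real \<Rightarrow> real \<Rightarrow> real \<Rightarrow> real" where
  "L_plus p1 p2 Q x1 =
     Q powr (- p2) * (p2 / p1) * gamma_plus p1 p2 Q powr (p2 - p1) * (x1 - 1) + 1"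

definition Omega_I :: "real \<Rightarrow> real \<Rightarrow> real \<Rightarrow> (real \<times> real) set" where
  "Omega_I p1 p2 Q = {(x1, x2) \<in> Omega p1 p2 Q.
     0 \<le> p2 * (x2 - L_plus p1 p2 Q x1) \<or> p1 * gamma_plus p1 p2 Q powr p1 \<le> p1 * x1}"

definition Omega_II :: "real \<Rightarrow> real \<Rightarrow> real \<Rightarrow> (real \<times> real) set" where
  "Omega_II p1 p2 Q = {(x1, x2) \<in> Omega p1 p2 Q.
     p2 * (x2 - L_plus p1 p2 Q x1) \<le> 0 \<and> p2 * (x2 - L_minus p1 p2 Q x1) \<le> 0 \<and>
     p1 * gamma_minus p1 p2 Q powr p1 \<le> p1 * x1 \<and> p1 * x1 \<le> p1 * gamma_plus p1 p2 Q powr p1}"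

definition Omega_III :: "real \<Rightarrow> real \<Rightarrow> real \<Rightarrow> (real \<times> real) set" where
  "Omega_III p1 p2 Q = {(x1, x2) \<in> Omega p1 p2 Q.
     0 \<le> p2 * (x2 - L_minus p1 p2 Q x1) \<and> (x1, x2) \<noteq> (1, 1)}"

definition Omega_IV :: "real \<Rightarrow> real \<Rightarrow> real \<Rightarrow> (real \<times> real) set" where
  "Omega_IV p1 p2 Q = {(x1, x2) \<in> Omega p1 p2 Q.
     p2 * (x2 - L_minus p1 p2 Q x1) \<le> 0 \<and> p1 * x1 \<le> p1 * gamma_minus p1 p2 Q powr p1}"

definition v_III :: "real \<Rightarrow> real \<Rightarrow> real \<times> real \<Rightarrow> real" where
  "v_III p1 p2 = (\<lambda>(x1, x2). THE v. 0 < v \<and> v \<noteq> 1 \<and>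
     v powr p2 * (1 - x1) - v powr p1 * (1 - x2) = x2 - x1)"

definition v_IV :: "real \<Rightarrow> real \<Rightarrow> real \<Rightarrow> real \<times> real \<Rightarrow> real" where
  "v_IV p1 p2 Q = (\<lambda>(x1, x2). THE v. 0 < v \<and>
     x2 = p2 / p1 * A_const p1 p2 Q * v powr (p2 - p1) * (x1 - v powr p1) + v powr p2 \<and>
     p1 * v powr p1 \<le> p1 * x1 \<and> p1 * x1 \<le> p1 * (gamma_plus p1 p2 Q * v) powr p1)"

definition B_II :: "real \<Rightarrow> real \<Rightarrow> real \<Rightarrow> real \<times> real \<Rightarrow> real" where
  "B_II p1 p2 Q = (\<lambda>(x1, x2). let a = v_minus p1 p2 Q powr p1; b = v_minus p1 p2 Q powr p2 in
     a / ((1 - a) * (a - b)) * x1 + b / ((b - 1) * (a - b)) * x2 + 1 - 1 / ((a - 1) * (b - 1)))"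

definition B_III :: "real \<Rightarrow> real \<Rightarrow> real \<times> real \<Rightarrow> real" where
  "B_III p1 p2 = (\<lambda>(x1, x2). let v = v_III p1 p2 (x1, x2) in
     (x1 - v powr p1) / (1 - v powr p1))"

definition B_IV :: "real \<Rightarrow> real \<Rightarrow> real \<Rightarrow> real \<times> real \<Rightarrow> real" where
  "B_IV p1 p2 Q = (\<lambda>(x1, x2).
     let A = A_const p1 p2 Q; vm = v_minus p1 p2 Q; v = v_IV p1 p2 Q (x1, x2) in
     1 / (1 - A) * (vm powr (- ((p1 - p2) * A / (1 - A))) / (1 - vm powr p1))
       * v powr ((p1 - p2) / (1 - A))
       * ((p1 - p2) / p2 * v powr p2 + x1 * v powr (p2 - p1) - p1 / p2 * x2))"

text \<open>
  The subdomains cover \<open>Omega p1 p2 Q\<close> and overlap only in boundary points, where the formulas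
  agree; testing \<open>Omega_I\<close> first gives the value 1 at \<open>(1, 1)\<close>. Outside
  \<open>Omega p1 p2 Q\<close> the value is left unspecified.
\<close>

definition B_fun :: "real \<Rightarrow> real \<Rightarrow> real \<Rightarrow> real \<times> real \<Rightarrow> real" where
  "B_fun p1 p2 Q x =
     (if x \<in> Omega_I p1 p2 Q then 1
      else if x \<in> Omega_II p1 p2 Q then B_II p1 p2 Q x
      else if x \<in> Omega_III p1 p2 Q then B_III p1 p2 x
      else if x \<in> Omega_IV p1 p2 Q then B_IV p1 p2 Q x
      else undefined)"

end

theory Submission
  imports Defs "HOL-Real_Asymp.Real_Asymp"
begin

text \<open>
  Put \<open>e\<^sub>p(s) = (s\<^sup>p - 1) / p\<close> and replace the averages \<open>x\<^sub>i\<close> by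
  \<open>\<xi>\<^sub>i = (x\<^sub>i - 1) / p\<^sub>i\<close>, the averages of \<open>e\<^sub>p(w)\<close> for \<open>p = p\<^sub>1, p\<^sub>2\<close>. All
  \<open>e\<^sub>p\<close> are increasing, so the signs of the exponents disappear: \<open>\<Omega>\<close> lies between the upper curve
  \<open>(e\<^sub>1 u, e\<^sub>2 u)\<close>, which carries the constant weights, and the lower curve
  \<open>(e\<^sub>1 u, e\<^sub>2 (u / Q))\<close>, and \<open>x = (1, 1)\<close> is the origin. Everything is governed by the lines
  that start on the upper curve at parameter \<open>v\<close> and touch the lower curve at parameter
  \<open>\<gamma>\<^sub>+ v\<close>; they meet the upper curve again at parameter \<open>v / v\<^sub>-\<close>. For \<open>v = 1\<close> and
  \<open>v = v\<^sub>-\<close> they pass through the origin: these are the lines \<open>L\<^sub>+\<close> and \<open>L\<^sub>-\<close>.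

  Upper bound. The gap \<open>E s = e\<^sub>1 s - e\<^sub>2 s\<close> is nonnegative and increases for \<open>s \<ge> 1\<close>, so the
  indicator of \<open>w \<ge> 1\<close> is at most \<open>E (w / v) / E (1 / v)\<close> for every \<open>v < 1\<close>; averaging this
  settles region III without any condition on \<open>w\<close>. Regions II and IV use the condition on subintervals
  through \<open>rising_sun_principle\<close>: to prove that an integral over an interval of \<open>p\<^sub>1\<close>-mean at most \<open>r\<close>
  is nonnegative, it is enough to look at the subintervals on which this mean is exactly
  \<open>r\<close>, where the condition bounds the \<open>p\<^sub>2\<close>-mean, and at the points with \<open>w \<le> r\<close>
  (with all inequalities reversed, \<open>w \<ge> r\<close>). In region II this is applied at \<open>r = \<gamma>\<^sub>+\<close> to the part of \<open>w\<close> above 1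
  and at \<open>r = \<gamma>\<^sub>-\<close> to the part below 1 (\<open>region_II_upper\<close>, \<open>region_II_lower\<close>). In region IV it is
  applied along a fine geometric progression of levels leading from \<open>\<gamma>\<^sub>-\<close> to \<open>\<gamma>\<^sub>+ v\<close>
  (\<open>region_IV_step\<close>). The loss in one step is controlled by a function \<open>F\<close> with
  \<open>F' 1 = 0\<close>, because the lines are tangent to the lower curve; so the total loss over \<open>n\<close> steps
  tends to 0 (\<open>region_IV_bound\<close>).

  Attainment. A point above one of the tangents of the lower curve is above that curve. Hence \<open>w\<close>
  belongs to the class as soon as for every interval there is a \<open>v\<close> such that the integral of
  \<open>S (w / v)\<close> is nonnegative, where \<open>S (u / v)\<close> measures how far the point \<open>u\<close> of the upper
  curve is above the line belonging to \<open>v\<close>; it is nonnegative exactly for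
  \<open>v \<le> u \<le> v / v\<^sub>-\<close> (\<open>weight_classI\<close>). This makes the membership of the extremal weights
  easy to verify: they take two values in regions I and III, the three values
  \<open>1 / v\<^sub>-, 1, v\<^sub>-\<close> in region II, and in region IV they are 1, then \<open>v\<^sub>-\<close>, then a
  decreasing power of \<open>t\<close>, then constant. The statement for a level \<open>l\<close> follows by applying the
  one for level 1 to \<open>w / l\<close>.
\<close>

section \<open>A rising sun principle\<close>

lemma set_integral_countable_Union_nonneg:
  fixes g :: "'a \<Rightarrow> real"
  assumes "countable D" "disjoint D" "D \<subseteq> sets M"
    and int: "set_integrable M (\<Union>D) g"
    and nonneg: "\<And>X. X \<in> D \<Longrightarrow> 0 \<le> (LINT t:X|M. g t)"
  shows "0 \<le> (LINT t:\<Union>D|M. g t)"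
proof -
  define A where "A n = \<Union>{X\<in>D. to_nat_on D X = n}" for n
  have inj: "inj_on (to_nat_on D) D"
    using assms(1) by (rule inj_on_to_nat_on)
  have A_cases: "A n = {} \<or> (\<exists>X\<in>D. A n = X)" for n
  proof (cases "\<exists>X\<in>D. to_nat_on D X = n")
    case True
    then obtain X where X: "X \<in> D" "to_nat_on D X = n" by auto
    have "{X\<in>D. to_nat_on D X = n} = {X}"
      using X inj unfolding inj_on_def by blast
    then show ?thesis using X by (auto simp: A_def)
  qed (auto simp: A_def)
  have meas: "A n \<in> sets M" for n
    using A_cases[of n] assms(3) by auto
  have disj: "A i \<inter> A j = {}" if "i \<noteq> j" for i j
  proof -
    have False if x: "x \<in> A i" "x \<in> A j" for x
    proof -
      obtain X Y where "X \<in> D" "Y \<in> D" "x \<in> X" "x \<in> Y" "to_nat_on D X = i" "to_nat_on D Y = j"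
        using x unfolding A_def by auto
      moreover from this \<open>i \<noteq> j\<close> have "X \<noteq> Y" by auto
      ultimately show False using assms(2) unfolding pairwise_def disjnt_def by blast
    qed
    then show ?thesis by auto
  qed
  have un: "(\<Union>n. A n) = \<Union>D"
    unfolding A_def by auto
  have nn: "0 \<le> (LINT t:A n|M. g t)" for n
    using A_cases[of n] nonneg by (auto simp: set_lebesgue_integral_def)
  define B where "B n = (\<Union>i<n. A i)" for n
  have UB: "(\<Union>n. B n) = \<Union>D"
    unfolding un[symmetric] B_def by auto
  have intA: "set_integrable M (A i) g" for i
    using int meas un by (intro set_integrable_subset[OF int]) auto
  have "0 \<le> (LINT t:B n|M. g t)" for n
  proof -
    have "(LINT t:B n|M. g t) = (\<Sum>i<n. (LINT t:A i|M. g t))"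
      unfolding B_def using disj meas intA
      by (intro set_integral_finite_Union) (auto simp: disjoint_family_on_def)
    then show ?thesis using nn by (auto intro: sum_nonneg)
  qed
  moreover have "(\<lambda>n. LINT t:B n|M. g t) \<longlonglongrightarrow> (LINT t:(\<Union>n. B n)|M. g t)"
  proof (rule set_integral_cont_up)
    show "B n \<in> sets M" for n unfolding B_def using meas by auto
    show "incseq B" unfolding B_def by (intro incseq_SucI UN_mono) auto
    show "set_integrable M (\<Union>n. B n) g" using int UB by simp
  qed
  ultimately have "0 \<le> (LINT t:(\<Union>n. B n)|M. g t)"
    by (intro LIMSEQ_le_const) auto
  then show ?thesis by (simp add: UB)
qed

lemma integral_Icc_combine_lower:
  fixes f :: "real \<Rightarrow> real"
  assumes "f integrable_on {a..b}" "a \<le> c" "c \<le> d" "d \<le> b"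
  shows "integral {c..d} f = integral {a..d} f - integral {a..c} f"
proof -
  have "integral {a..c} f + integral {c..d} f = integral {a..d} f"
    using assms by (intro Henstock_Kurzweil_Integration.integral_combine)
      (auto intro: integrable_on_subinterval)
  then show ?thesis by simp
qed

lemma right_difference_quotient_AE:
  fixes f :: "real \<Rightarrow> real"
  assumes "f integrable_on {a..b}"
  obtains N where "negligible N"
    and "\<And>x e. x \<notin> N \<Longrightarrow> x \<in> {a..<b} \<Longrightarrow> 0 < e \<Longrightarrow>
      \<exists>h. 0 < h \<and> x + h \<le> b \<and> \<bar>integral {x..x + h} f / h - f x\<bar> < e"
proof -
  define f0 where "f0 t = (if t \<in> {a..b} then f t else 0)" for t
  have "f0 integrable_on UNIV"
    using assms integrable_restrict_UNIV[of "{a..b}" f] by (simp add: f0_def[abs_def] del: atLeastAtMost_iff)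
  then have "f0 integrable_on cbox c d" for c d
    by (rule integrable_on_subcbox) auto
  from integrable_ccontinuous_explicit[OF this] obtain N where N: "negligible N"
    "\<And>x e. \<lbrakk>x \<notin> N; 0 < e\<rbrakk> \<Longrightarrow>
               \<exists>d>0. \<forall>h. 0 < h \<and> h < d \<longrightarrow>
                         norm(integral (cbox x (x + h *\<^sub>R One)) f0 /\<^sub>R h ^ DIM(real) - f0 x) < e"
    by blast
  show ?thesis
  proof (rule that[OF N(1)])
    fix x e :: real assume x: "x \<notin> N" "x \<in> {a..<b}" "0 < e"
    from N(2)[OF x(1,3)] obtain d where d: "d > 0"
      "\<And>h. 0 < h \<Longrightarrow> h < d \<Longrightarrow> norm(integral (cbox x (x + h *\<^sub>R One)) f0 /\<^sub>R h ^ DIM(real) - f0 x) < e"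
      by blast
    define h where "h = min (d/2) (b - x)"
    have h: "0 < h" "h < d" "x + h \<le> b" using d(1) x by (auto simp: h_def min_def)
    have "integral {x..x+h} f0 = integral {x..x+h} f"
      by (rule integral_cong) (use x h in \<open>auto simp: f0_def\<close>)
    moreover have "f0 x = f x" using x by (auto simp: f0_def)
    ultimately show "\<exists>h. 0 < h \<and> x + h \<le> b \<and> \<bar>integral {x..x + h} f / h - f x\<bar> < e"
      using d(2)[OF h(1,2)] h by (intro exI[of _ h]) (auto simp: divide_inverse mult.commute)
  qed
qed

text \<open>
  Write \<open>F\<close> for the primitive of \<open>f\<close>. The points from which a larger value of \<open>F\<close> is visible to
  the right form an open set, and \<open>F\<close> agrees at the two ends of each of its components, so \<open>balanced\<close>
  applies there. At almost every other point the right derivative of \<open>F\<close> is \<open>f\<close>, and it cannot be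
  positive. The assumption \<open>dec\<close> excludes a component that starts at \<open>a\<close> with a rise.
\<close>

lemma rising_sun_principle_aux:
  fixes f g :: "real \<Rightarrow> real"
  assumes ab: "a < b"
    and f: "f absolutely_integrable_on {a..b}" and g: "g absolutely_integrable_on {a..b}"
    and dec: "\<And>t. t \<in> {a..b} \<Longrightarrow> integral {a..t} f \<le> 0"
    and balanced: "\<And>c d. a \<le> c \<Longrightarrow> c < d \<Longrightarrow> d \<le> b \<Longrightarrow> integral {c..d} f = 0
      \<Longrightarrow> 0 \<le> integral {c..d} g"
    and pointwise: "AE t in lebesgue. t \<in> {a..b} \<longrightarrow> f t \<le> 0 \<longrightarrow> 0 \<le> g t"
  shows "0 \<le> integral {a..b} g"
proof -
  define F where "F t = integral {a..t} f" for t
  have fi: "f integrable_on {a..b}" using f by (rule set_lebesgue_integral_eq_integral)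
  have contF: "continuous_on {a..b} F"
    unfolding F_def by (rule indefinite_integral_continuous_1[OF fi])
  have Fdiff: "integral {c..d} f = F d - F c" if "a \<le> c" "c \<le> d" "d \<le> b" for c d
    unfolding F_def using that fi by (intro integral_Icc_combine_lower[of f a b])
  have F0: "F a = 0" "\<And>t. t \<in> {a..b} \<Longrightarrow> F t \<le> 0" using dec by (auto simp: F_def)
  define V where "V = {x \<in> {a<..<b}. \<exists>y\<in>{x<..b}. F x < F y}"
  have Vsub: "V \<subseteq> {a..b}" by (auto simp: V_def)
  have "open V"
  proof (subst open_subopen, intro ballI)
    fix x assume "x \<in> V"
    then obtain y where xy: "a < x" "x < y" "y \<le> b" "F x < F y" by (auto simp: V_def)
    have "isCont F x"
      using continuous_on_interior[OF contF, of x] xy by auto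
    then have "(F \<longlongrightarrow> F x) (at x)" by (simp add: isCont_def)
    then have "\<forall>\<^sub>F z in at x. F z < F y" using xy by (intro order_tendstoD)
    moreover have "\<forall>\<^sub>F z in at x. z \<in> {a<..<y}"
      using xy by (intro eventually_at_in_open') auto
    ultimately have "\<forall>\<^sub>F z in at x. F z < F y \<and> z \<in> {a<..<y}" by (rule eventually_conj)
    then have "\<forall>\<^sub>F z in nhds x. F z < F y \<and> z \<in> {a<..<y}"
      using xy by (auto simp: eventually_at_filter elim!: eventually_mono)
    then obtain T where T: "open T" "x \<in> T" "\<And>z. z \<in> T \<Longrightarrow> F z < F y \<and> z \<in> {a<..<y}"
      unfolding eventually_nhds by blast
    have "T \<subseteq> V" using T(3) xy by (fastforce simp: V_def)
    then show "\<exists>T. open T \<and> x \<in> T \<and> T \<subseteq> V" using T by blast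
  qed
  define D where "D = components V"
  have UD: "\<Union>D = V" by (simp add: D_def)
  have opD: "open X" if "X \<in> D" for X using that \<open>open V\<close> by (auto simp: D_def intro: open_components)
  have disjD: "disjoint D"
    using pairwise_disjoint_components[of V] by (simp add: D_def disjoint_def pairwise_def disjnt_def)
  have cD: "countable D" by (rule countable_disjoint_open_subsets[OF opD disjD])
  have comp: "\<exists>c d. X = {c<..<d} \<and> a \<le> c \<and> c < d \<and> d \<le> b \<and> F c = F d" if X: "X \<in> D" for X
  proof -
    have Xne: "X \<noteq> {}" and Xcon: "connected X" and Xsub: "X \<subseteq> V"
      using X by (auto simp: D_def in_components_nonempty in_components_connected in_components_subset)
    have Xab: "X \<subseteq> {a..b}" using Xsub Vsub by auto
    then have bb: "bdd_below X" "bdd_above X" by (auto intro: bdd_below_mono bdd_above_mono)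
    define c d where "c = Inf X" and "d = Sup X"
    have cd: "X = {c<..<d}"
    proof (intro equalityI subsetI)
      fix x assume x: "x \<in> X"
      obtain e where e: "e > 0" "ball x e \<subseteq> X" using opD[OF X] x open_contains_ball by blast
      then have "x - e/2 \<in> X" "x + e/2 \<in> X" by (auto simp: subset_iff dist_real_def)
      then have "c \<le> x - e/2" "x + e/2 \<le> d"
        using bb by (auto simp: c_def d_def intro: cInf_lower cSup_upper)
      then show "x \<in> {c<..<d}" using e by auto
    next
      fix x assume x: "x \<in> {c<..<d}"
      have "\<exists>y\<in>X. y < x" using x Xne bb cInf_less_iff[of X x] by (auto simp: c_def)
      moreover have "\<exists>z\<in>X. x < z" using x Xne bb less_cSup_iff[of X x] by (auto simp: d_def)
      ultimately show "x \<in> X" using Xcon by (meson connected_contains_Icc atLeastAtMost_iff less_imp_le subsetD)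
    qed
    then have "c < d" using Xne by auto
    have "a \<le> c" "d \<le> b"
      unfolding c_def d_def using Xab Xne by (auto intro!: cInf_greatest cSup_least)
    have ends: "z \<notin> V" if z: "z = c \<or> z = d" for z
    proof
      assume "z \<in> V"
      then obtain e where e: "e > 0" "ball z e \<subseteq> V" using \<open>open V\<close> open_contains_ball by blast
      have "\<exists>y. y \<in> X \<inter> ball z e"
      proof (cases "z = c")
        case True
        then show ?thesis using e(1) \<open>c < d\<close>
          by (intro exI[of _ "min (c + e/2) ((c+d)/2)"]) (auto simp: cd dist_real_def min_def field_simps)
      next
        case False
        then show ?thesis using e(1) \<open>c < d\<close> z
          by (intro exI[of _ "max (d - e/2) ((c+d)/2)"]) (auto simp: cd dist_real_def max_def field_simps)
      qed
      then have "ball z e \<subseteq> X"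
        using X e(2) unfolding D_def by (intro components_maximal[of X V]) auto
      then have "z \<in> X" using e(1) by auto
      then show False using z by (auto simp: cd)
    qed
    then have notV: "c \<notin> V" "d \<notin> V" by auto
    have "F d \<le> F c"
    proof (cases "c = a")
      case True then show ?thesis using F0 \<open>c < d\<close> \<open>d \<le> b\<close> by auto
    next
      case False then show ?thesis using notV(1) \<open>a \<le> c\<close> \<open>c < d\<close> \<open>d \<le> b\<close> by (force simp: V_def)
    qed
    \<comment> \<open>The last maximum of \<open>F\<close> on \<open>{x..d}\<close> sees nothing larger to its right, so it is \<open>d\<close>.\<close>
    moreover have le: "F x \<le> F d" if x: "x \<in> {c<..<d}" for x
    proof -
      have "\<exists>z\<in>{x..d}. \<forall>y\<in>{x..d}. F y \<le> F z"
        using x \<open>a \<le> c\<close> \<open>d \<le> b\<close> by (intro continuous_attains_sup continuous_on_subset[OF contF]) auto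
      then obtain z0 where z0: "z0 \<in> {x..d}" "\<And>y. y \<in> {x..d} \<Longrightarrow> F y \<le> F z0" by blast
      define Z where "Z = {x..d} \<inter> F -` {F z0}"
      have "closed Z" unfolding Z_def
        using x \<open>a \<le> c\<close> \<open>d \<le> b\<close> by (intro continuous_closed_preimage continuous_on_subset[OF contF]) auto
      moreover have "Z \<subseteq> {x..d}" by (auto simp: Z_def)
      ultimately have "compact Z" using compact_Icc compact_Int_closed[of "{x..d}" Z] by (simp add: inf.absorb2)
      moreover have "Z \<noteq> {}" using z0 by (auto simp: Z_def)
      ultimately obtain z where z: "z \<in> Z" "\<And>y. y \<in> Z \<Longrightarrow> y \<le> z" using compact_attains_sup[of Z] by (metis empty_iff)
      have zx: "x \<le> z" "z \<le> d" "F z = F z0" using z by (auto simp: Z_def)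
      have "z = d"
      proof (rule ccontr)
        assume "z \<noteq> d"
        then have "z \<in> V" using zx x cd Xsub by auto
        then obtain y where y: "z < y" "y \<le> b" "F z < F y" by (auto simp: V_def)
        have "d < y" using y z0(2)[of y] zx by force
        moreover have "F d \<le> F z" using z0(2)[of d] zx by auto
        ultimately have "d \<in> V" using y \<open>a \<le> c\<close> \<open>c < d\<close> by (auto simp: V_def intro!: bexI[of _ y])
        then show False using notV by simp
      qed
      then show ?thesis using z0(2)[of x] zx x by auto
    qed
    have "F c \<le> F d"
    proof (rule tendsto_upperbound)
      have "continuous_on {c..d} F" using contF \<open>a \<le> c\<close> \<open>d \<le> b\<close> by (auto intro: continuous_on_subset)
      then show "(F \<longlongrightarrow> F c) (at_right c)"
        using \<open>c < d\<close> continuous_on_Icc_at_rightD by blast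
      show "\<forall>\<^sub>F x in at_right c. F x \<le> F d"
        using eventually_at_right_real[OF \<open>c < d\<close>] by eventually_elim (use le in auto)
    qed auto
    ultimately show ?thesis using cd \<open>a \<le> c\<close> \<open>c < d\<close> \<open>d \<le> b\<close> by (intro exI[of _ c] exI[of _ d]) auto
  qed
  have gV: "0 \<le> (LINT t:V|lebesgue. g t)"
  proof -
    have "0 \<le> (LINT t:\<Union>D|lebesgue. g t)"
    proof (rule set_integral_countable_Union_nonneg[OF cD])
      show "disjoint D" by (rule disjD)
      show "D \<subseteq> sets lebesgue" using opD by (auto intro: borel_open)
      show "set_integrable lebesgue (\<Union>D) g" using g Vsub UD \<open>open V\<close>
        by (intro set_integrable_subset[OF g]) auto
      fix X assume "X \<in> D"
      from comp[OF this] obtain c d where cd: "X = {c<..<d}" "a \<le> c" "c < d" "d \<le> b" "F c = F d" by blast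
      have "0 \<le> integral {c..d} g" using cd Fdiff[of c d] by (intro balanced) auto
      also have "\<dots> = integral {c<..<d} g"
        using integral_open_interval_real[of c d g] by simp
      also have "\<dots> = (LINT t:X|lebesgue. g t)" unfolding cd(1)
        by (rule set_lebesgue_integral_eq_integral(2)[symmetric], rule set_integrable_subset[OF g]) (use cd in auto)
      finally show "0 \<le> (LINT t:X|lebesgue. g t)" .
    qed
    then show ?thesis by (simp add: UD)
  qed
  have gZ: "0 \<le> (LINT t:{a..b} - V|lebesgue. g t)"
  proof -
    obtain N where N: "negligible N"
      "\<And>x e. x \<notin> N \<Longrightarrow> x \<in> {a..<b} \<Longrightarrow> 0 < e \<Longrightarrow>
        \<exists>h. 0 < h \<and> x + h \<le> b \<and> \<bar>integral {x..x + h} f / h - f x\<bar> < e"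
      using right_difference_quotient_AE[OF fi] by blast
    have "N \<union> {a,b} \<in> null_sets lebesgue"
      using N(1) by (simp add: negligible_iff_null_sets[symmetric])
    then have "AE t in lebesgue. t \<notin> N \<union> {a,b}" by (rule AE_not_in)
    with pointwise have "AE t in lebesgue. t \<in> {a..b} - V \<longrightarrow> 0 \<le> g t"
    proof eventually_elim
      case (elim t)
      show ?case
      proof
        assume t: "t \<in> {a..b} - V"
        then have tt: "a < t" "t < b" "t \<notin> N" using elim by auto
        have "f t \<le> 0"
        proof (rule ccontr)
          assume "\<not> f t \<le> 0"
          then obtain h where h: "0 < h" "t + h \<le> b" "\<bar>integral {t..t+h} f / h - f t\<bar> < f t"
            using N(2)[of t "f t"] tt by auto
          then have "0 < integral {t..t+h} f / h" by linarith
          then have "0 < integral {t..t+h} f" using h(1) by (simp add: zero_less_divide_iff)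
          then have "F t < F (t+h)" using Fdiff[of t "t+h"] tt h by auto
          then have "t \<in> V" using tt h by (auto simp: V_def intro!: bexI[of _ "t+h"])
          then show False using t by simp
        qed
        then show "0 \<le> g t" using elim(1) t by auto
      qed
    qed
    then show ?thesis unfolding set_lebesgue_integral_def
      by (intro integral_nonneg_AE) (auto elim!: eventually_mono simp: indicator_def)
  qed
  have "integral {a..b} g = (LINT t:{a..b}|lebesgue. g t)"
    using set_lebesgue_integral_eq_integral(2)[OF g] by simp
  moreover have "V \<union> ({a..b} - V) = {a..b}" using Vsub by auto
  moreover have "(LINT t:V \<union> ({a..b} - V)|lebesgue. g t)
      = (LINT t:V|lebesgue. g t) + (LINT t:{a..b} - V|lebesgue. g t)"
    using Vsub \<open>open V\<close> by (intro set_integral_Un set_integrable_subset[OF g]) auto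
  ultimately show ?thesis using gV gZ by simp
qed

text \<open>
  The general case reduces to the preceding one: if \<open>e\<close> is the last point at which the primitive of
  \<open>f\<close> is nonnegative, then \<open>{a..e}\<close> is itself a balanced interval, and on \<open>{e..b}\<close> the primitive stays
  below its initial value.
\<close>

lemma rising_sun_principle:
  fixes f g :: "real \<Rightarrow> real"
  assumes ab: "a < b"
    and f: "f absolutely_integrable_on {a..b}" and g: "g absolutely_integrable_on {a..b}"
    and le: "integral {a..b} f \<le> 0"
    and balanced: "\<And>c d. a \<le> c \<Longrightarrow> c < d \<Longrightarrow> d \<le> b \<Longrightarrow> integral {c..d} f = 0
      \<Longrightarrow> 0 \<le> integral {c..d} g"
    and pointwise: "AE t in lebesgue. t \<in> {a..b} \<longrightarrow> f t \<le> 0 \<longrightarrow> 0 \<le> g t"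
  shows "0 \<le> integral {a..b} g"
proof -
  define F where "F t = integral {a..t} f" for t
  have fi: "f integrable_on {a..b}" and gi: "g integrable_on {a..b}"
    using f g by (auto intro: set_lebesgue_integral_eq_integral)
  have contF: "continuous_on {a..b} F"
    unfolding F_def by (rule indefinite_integral_continuous_1[OF fi])
  define Z where "Z = {a..b} \<inter> F -` {0..}"
  have "closed Z" unfolding Z_def by (intro continuous_closed_preimage contF) auto
  moreover have "Z \<subseteq> {a..b}" by (auto simp: Z_def)
  ultimately have "compact Z" using compact_Icc compact_Int_closed[of "{a..b}" Z] by (simp add: inf.absorb2)
  moreover have "a \<in> Z" using ab by (auto simp: Z_def F_def)
  ultimately obtain e where e: "e \<in> Z" "\<And>y. y \<in> Z \<Longrightarrow> y \<le> e" using compact_attains_sup[of Z] by (metis empty_iff)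
  have eab: "a \<le> e" "e \<le> b" "0 \<le> F e" using e by (auto simp: Z_def)
  have after: "F t < 0" if "e < t" "t \<le> b" for t
    using that e(2)[of t] eab by (force simp: Z_def)
  have Fe: "F e = 0"
  proof (rule ccontr)
    assume "F e \<noteq> 0"
    then have "0 < F e" "e \<noteq> b" using eab le by (auto simp: F_def)
    moreover have "F b \<le> 0" using le by (simp add: F_def)
    moreover have "continuous_on {e..b} F" using contF eab by (auto intro: continuous_on_subset)
    ultimately have "\<exists>x\<ge>e. x \<le> b \<and> F x = 0" using eab by (intro IVT2') auto
    then obtain x where "e \<le> x" "x \<le> b" "F x = 0" by blast
    moreover then have "e < x" using \<open>0 < F e\<close> by (cases "x = e") auto
    ultimately show False using after[of x] by auto
  qed
  have 1: "0 \<le> integral {a..e} g"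
  proof (cases "a = e")
    case False then show ?thesis using eab Fe by (intro balanced) (auto simp: F_def)
  qed auto
  have 2: "0 \<le> integral {e..b} g"
  proof (cases "e = b")
    case False
    show ?thesis
    proof (rule rising_sun_principle_aux)
      show "e < b" using False eab by auto
      show "f absolutely_integrable_on {e..b}" "g absolutely_integrable_on {e..b}"
        using eab by (auto intro: set_integrable_subset[OF f] set_integrable_subset[OF g])
      show "integral {e..t} f \<le> 0" if "t \<in> {e..b}" for t
      proof -
        have "integral {e..t} f = F t - F e"
          unfolding F_def using that eab fi by (intro integral_Icc_combine_lower[of f a b]) auto
        then show ?thesis using after[of t] Fe that by (cases "t = e") auto
      qed
      show "AE t in lebesgue. t \<in> {e..b} \<longrightarrow> f t \<le> 0 \<longrightarrow> 0 \<le> g t"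
        using pointwise by eventually_elim (use eab in auto)
    qed (use balanced eab in auto)
  qed auto
  have "integral {a..e} g + integral {e..b} g = integral {a..b} g"
    using eab gi by (intro Henstock_Kurzweil_Integration.integral_combine)
  then show ?thesis using 1 2 by simp
qed

section \<open>Box--Cox functions\<close>

definition box_cox :: "real \<Rightarrow> real \<Rightarrow> real" where
  "box_cox p s = (s powr p - 1) / p"

lemma box_cox_1 [simp]: "box_cox p 1 = 0"
  by (simp add: box_cox_def)

lemma powr_eq_box_cox: "p \<noteq> 0 \<Longrightarrow> s powr p = 1 + p * box_cox p s"
  by (simp add: box_cox_def)

lemma box_cox_mult:
  assumes "p \<noteq> 0" "0 \<le> s" "0 < v"
  shows "box_cox p (s * v) = v powr p * box_cox p s + box_cox p v"
  using assms by (simp add: box_cox_def powr_mult field_simps)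

lemma box_cox_divide:
  assumes "p \<noteq> 0" "0 \<le> s" "0 < v"
  shows "box_cox p (s / v) = v powr (-p) * (box_cox p s - box_cox p v)"
  using assms by (simp add: box_cox_def powr_divide powr_minus field_simps)

lemma has_derivative_box_cox [derivative_intros]:
  assumes "p \<noteq> 0" "0 < s"
  shows "(box_cox p has_real_derivative s powr (p - 1)) (at s)"
  unfolding box_cox_def using assms
  by (auto intro!: derivative_eq_intros simp: field_simps)

lemma box_cox_strict_mono:
  assumes "p \<noteq> 0" "0 < s" "s < t"
  shows "box_cox p s < box_cox p t"
proof (rule DERIV_pos_imp_increasing[OF assms(3)])
  fix x assume "s \<le> x" "x \<le> t"
  then show "\<exists>y. (box_cox p has_real_derivative y) (at x) \<and> 0 < y"
    using assms by (intro exI[of _ "x powr (p-1)"]) (auto intro!: has_derivative_box_cox)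
qed

lemma box_cox_less_iff: "p \<noteq> 0 \<Longrightarrow> 0 < s \<Longrightarrow> 0 < t \<Longrightarrow> box_cox p s < box_cox p t \<longleftrightarrow> s < t"
  by (metis box_cox_strict_mono less_asym' linorder_neqE_linordered_idom)

lemma box_cox_le_iff: "p \<noteq> 0 \<Longrightarrow> 0 < s \<Longrightarrow> 0 < t \<Longrightarrow> box_cox p s \<le> box_cox p t \<longleftrightarrow> s \<le> t"
  by (meson box_cox_less_iff linorder_not_le)

lemma box_cox_pos: "p \<noteq> 0 \<Longrightarrow> 1 < s \<Longrightarrow> 0 < box_cox p s"
  using box_cox_strict_mono[of p 1 s] by simp

lemma box_cox_neg: "p \<noteq> 0 \<Longrightarrow> 0 < s \<Longrightarrow> s < 1 \<Longrightarrow> box_cox p s < 0"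
  using box_cox_strict_mono[of p s 1] by simp

lemma isCont_box_cox: "p \<noteq> 0 \<Longrightarrow> 0 < s \<Longrightarrow> isCont (box_cox p) s"
  using has_derivative_box_cox DERIV_isCont by blast

lemma box_cox_powr_inverse:
  assumes "p \<noteq> 0" "0 < x"
  shows "box_cox p (x powr (1/p)) = (x - 1) / p"
  using assms by (simp add: box_cox_def powr_powr)

text \<open>
  For \<open>k > 0\<close> the derivative of \<open>box_cox p2 u - k * box_cox p1 u\<close> is
  \<open>u powr (p2 - 1) * (1 - k * u powr (p1 - p2))\<close>, which changes sign once, from plus to minus. Geometrically,
  a line of slope \<open>k\<close> meets the curve of constant weights at most twice.
\<close>

lemma box_cox_combination_increasing:
  assumes "p1 \<noteq> 0" "p2 \<noteq> 0" "p2 < p1" "0 < s" "s < t" "0 < k" "k * t powr (p1 - p2) \<le> 1"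
  shows "box_cox p2 s - k * box_cox p1 s < box_cox p2 t - k * box_cox p1 t"
proof (rule DERIV_pos_imp_increasing_open[OF \<open>s < t\<close>])
  fix x assume x: "s < x" "x < t"
  have "x powr (p1 - 1) = x powr (p2 - 1) * x powr (p1 - p2)"
    by (simp add: powr_add[symmetric])
  moreover have "k * x powr (p1 - p2) < k * t powr (p1 - p2)"
    using assms x by (auto intro!: powr_less_mono2)
  ultimately have "0 < x powr (p2 - 1) - k * x powr (p1 - 1)"
    using assms x by (auto simp: algebra_simps)
      (metis mult.commute mult.left_commute mult_less_cancel_left_pos mult.right_neutral order_less_le_trans powr_gt_zero less_irrefl less_trans)
  then show "\<exists>y. ((\<lambda>u. box_cox p2 u - k * box_cox p1 u) has_real_derivative y) (at x) \<and> 0 < y"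
    using assms x by (intro exI[of _ "x powr (p2 - 1) - k * x powr (p1 - 1)"])
      (auto intro!: derivative_eq_intros)
next
  show "continuous_on {s..t} (\<lambda>u. box_cox p2 u - k * box_cox p1 u)"
    using assms by (auto intro!: continuous_at_imp_continuous_on continuous_intros isCont_box_cox)
qed

lemma box_cox_combination_decreasing:
  assumes "p1 \<noteq> 0" "p2 \<noteq> 0" "p2 < p1" "0 < s" "s < t" "0 < k" "1 \<le> k * s powr (p1 - p2)"
  shows "box_cox p2 t - k * box_cox p1 t < box_cox p2 s - k * box_cox p1 s"
proof (rule DERIV_neg_imp_decreasing_open[OF \<open>s < t\<close>])
  fix x assume x: "s < x" "x < t"
  have "x powr (p1 - 1) = x powr (p2 - 1) * x powr (p1 - p2)"
    by (simp add: powr_add[symmetric])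
  moreover have "1 < k * x powr (p1 - p2)"
  proof -
    have "k * s powr (p1 - p2) < k * x powr (p1 - p2)"
      using assms x by (auto intro!: powr_less_mono2)
    then show ?thesis using assms by linarith
  qed
  moreover have "0 < x powr (p2 - 1)" using assms x by auto
  ultimately have "x powr (p2 - 1) - k * x powr (p1 - 1) < 0"
    using mult_strict_left_mono[of 1 "k * x powr (p1 - p2)" "x powr (p2 - 1)"] by (simp add: algebra_simps)
  then show "\<exists>y. ((\<lambda>u. box_cox p2 u - k * box_cox p1 u) has_real_derivative y) (at x) \<and> y < 0"
    using assms x by (intro exI[of _ "x powr (p2 - 1) - k * x powr (p1 - 1)"])
      (auto intro!: derivative_eq_intros)
next
  show "continuous_on {s..t} (\<lambda>u. box_cox p2 u - k * box_cox p1 u)"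
    using assms by (auto intro!: continuous_at_imp_continuous_on continuous_intros isCont_box_cox)
qed

lemma box_cox_combination_two_points:
  assumes "p1 \<noteq> 0" "p2 \<noteq> 0" "p2 < p1" "0 < k" "0 < a" "a < b"
    and za: "box_cox p2 a - k * box_cox p1 a = c" and zb: "box_cox p2 b - k * box_cox p1 b = c"
    and u: "0 < u"
  shows "a < u \<Longrightarrow> u < b \<Longrightarrow> c < box_cox p2 u - k * box_cox p1 u"
    and "u < a \<Longrightarrow> box_cox p2 u - k * box_cox p1 u < c"
    and "b < u \<Longrightarrow> box_cox p2 u - k * box_cox p1 u < c"
    and "k * a powr (p1 - p2) < 1" and "1 < k * b powr (p1 - p2)"
proof -
  note inc = box_cox_combination_increasing[OF assms(1-3)]
  note dec = box_cox_combination_decreasing[OF assms(1-3)]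
  show 1: "k * a powr (p1 - p2) < 1"
    using dec[of a b k] assms by force
  show 2: "1 < k * b powr (p1 - p2)"
    using inc[of a b k] assms by force
  show "c < box_cox p2 u - k * box_cox p1 u" if "a < u" "u < b"
    using inc[of a u k] dec[of u b k] that assms by (cases "k * u powr (p1 - p2) \<le> 1") auto
  show "box_cox p2 u - k * box_cox p1 u < c" if "u < a"
    using inc[of u a k] 1 that assms by auto
  show "box_cox p2 u - k * box_cox p1 u < c" if "b < u"
    using dec[of b u k] 2 that assms by auto
qed

section \<open>The tangents of the lower curve\<close>

locale bellman_parameters =
  fixes p1 p2 Q :: real
  assumes p1: "p1 \<noteq> 0" and p2: "p2 \<noteq> 0" and p21: "p2 < p1" and Q1: "1 < Q"
begin

abbreviation e1 :: "real \<Rightarrow> real" where "e1 \<equiv> box_cox p1"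
abbreviation e2 :: "real \<Rightarrow> real" where "e2 \<equiv> box_cox p2"

text \<open>
  The vertical distance from the point with parameter \<open>s\<close> of the upper curve to the tangent of
  that curve at the origin; \<open>E (u / v)\<close> plays the same role for the tangent at \<open>v\<close>, up to a positive factor.
\<close>

definition E :: "real \<Rightarrow> real" where "E s = e1 s - e2 s"

lemma E_1 [simp]: "E 1 = 0" by (simp add: E_def)

lemma E_mono: "1 \<le> s \<Longrightarrow> s \<le> t \<Longrightarrow> E s \<le> E t"
  using box_cox_combination_decreasing[OF p1 p2 p21, of s t 1] p21
  by (cases "s = t") (auto simp: E_def ge_one_powr_ge_zero)

lemma E_pos: "0 < s \<Longrightarrow> s \<noteq> 1 \<Longrightarrow> 0 < E s"
  using box_cox_combination_decreasing[OF p1 p2 p21, of 1 s 1]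
    box_cox_combination_increasing[OF p1 p2 p21, of s 1 1] p21
  by (cases "s < 1") (auto simp: E_def)

text \<open>
  Almost all values of a weight are positive if some exponent is negative. Otherwise \<open>box_cox p 0 = - 1 / p\<close>
  is the correct limit at 0, so the value 0 needs no separate treatment in the estimates below.
\<close>

definition proper :: "real \<Rightarrow> bool" where "proper u \<longleftrightarrow> 0 < u \<or> u = 0 \<and> 0 < p2"

lemma proper_nonneg: "proper u \<Longrightarrow> 0 \<le> u" by (auto simp: proper_def)

lemma E_nonneg: "proper s \<Longrightarrow> 0 \<le> E s"
proof -
  assume "proper s"
  then consider "s = 1" | "0 < s" "s \<noteq> 1" | "s = 0" "0 < p2" by (auto simp: proper_def)
  then show ?thesis
  proof cases
    case 3 then show ?thesis using p21 by (simp add: E_def box_cox_def field_simps)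
  qed (auto dest: E_pos)
qed

lemma E_divide:
  assumes "0 \<le> u" "0 < v"
  shows "E (u / v) = v powr (-p1) * (e1 u - e1 v) - v powr (-p2) * (e2 u - e2 v)"
  using assms p1 p2 by (simp add: E_def box_cox_divide)

abbreviation gp :: real where "gp \<equiv> gamma_plus p1 p2 Q"
abbreviation gm :: real where "gm \<equiv> gamma_minus p1 p2 Q"
abbreviation vm :: real where "vm \<equiv> v_minus p1 p2 Q"
abbreviation A :: real where "A \<equiv> A_const p1 p2 Q"

text \<open>
  In terms of \<open>s = 1/g\<close> the equation defining \<open>gamma_plus\<close> and \<open>gamma_minus\<close> says that \<open>e1 s\<close> equals \<open>e2 (Q * s)\<close>. By \<open>G_eq\<close> this is a
  level set of a unimodal function, which is positive near both ends of the half-line and negative at 1.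
\<close>

definition G :: "real \<Rightarrow> real" where "G s = e1 (1/s) - e2 (Q/s)"

lemma gamma_eq_iff:
  assumes "0 < g"
  shows "gamma_eq p1 p2 Q g \<longleftrightarrow> e2 (g / Q) = Q powr (-p2) * g powr (p2 - p1) * e1 g"
proof -
  have "g powr (p2 - p1) * g powr p1 = g powr p2" by (simp add: powr_add[symmetric])
  then have "Q powr (-p2) * g powr (p2 - p1) * e1 g = (Q powr (-p2) * g powr p2 - Q powr (-p2) * g powr (p2 - p1)) / p1"
    by (simp add: box_cox_def algebra_simps diff_divide_distrib)
  moreover have "e2 (g / Q) = (Q powr (-p2) * g powr p2 - 1) / p2"
    using assms Q1 by (simp add: box_cox_def powr_divide powr_minus field_simps)
  moreover have "X * (1 - p2/p1) = 1 - p2/p1 * Y \<longleftrightarrow> (X - 1) / p2 = (X - Y) / p1" for X Y :: real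
  proof -
    have "X * (1 - p2/p1) - (1 - p2/p1 * Y) = p2 * ((X - 1) / p2 - (X - Y) / p1)"
      using p1 p2 by (simp add: field_simps)
    then show ?thesis using p2 by (metis eq_iff_diff_eq_0 mult_eq_0_iff)
  qed
  from this[of "Q powr (-p2) * g powr p2" "Q powr (-p2) * g powr (p2 - p1)"]
  have "gamma_eq p1 p2 Q g \<longleftrightarrow> (Q powr (-p2) * g powr p2 - 1) / p2
      = (Q powr (-p2) * g powr p2 - Q powr (-p2) * g powr (p2 - p1)) / p1"
    unfolding gamma_eq_def by (simp add: ac_simps)
  ultimately show ?thesis by simp
qed

lemma gamma_eq_iff_G:
  assumes "0 < g"
  shows "gamma_eq p1 p2 Q g \<longleftrightarrow> G g = 0"
proof -
  have "e2 (Q/g) = - ((Q/g) powr p2 * e2 (g/Q))"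
    using assms Q1 p2 by (simp add: box_cox_def powr_divide field_simps)
  moreover have "e1 (1/g) = - (g powr (-p1) * e1 g)"
    using assms p1 by (simp add: box_cox_def powr_divide powr_minus field_simps)
  moreover have "(Q/g) powr p2 * (Q powr (-p2) * g powr (p2 - p1)) = g powr (-p1)"
    using assms Q1 by (simp add: powr_divide powr_minus powr_diff field_simps)
  moreover have "0 < (Q/g) powr p2" using assms Q1 by simp
  ultimately have "G g = (Q/g) powr p2 * (e2 (g/Q) - Q powr (-p2) * g powr (p2 - p1) * e1 g)"
    and "(Q/g) powr p2 \<noteq> 0"
    unfolding G_def right_diff_distrib mult.assoc[symmetric] by auto
  then show ?thesis unfolding gamma_eq_iff[OF assms] by simp
qed

lemma G_eq: "0 < g \<Longrightarrow> G g = e1 (1/g) - Q powr p2 * e2 (1/g) - e2 Q"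
  using box_cox_mult[OF p2, of "1/g" Q] Q1 by (simp add: G_def)

lemma G_continuous: "0 < a \<Longrightarrow> continuous_on {a..b} (\<lambda>s. e1 s - Q powr p2 * e2 s - e2 Q)"
  using p1 p2 by (auto intro!: continuous_at_imp_continuous_on continuous_intros isCont_box_cox)

lemma balance_pos_near_0: "\<forall>\<^sub>F s in at_right 0. 0 < e1 s - Q powr p2 * e2 s - e2 Q"
proof (cases "0 < p2")
  case True
  have "((\<lambda>s::real. (s powr p1 - 1)/p1 - Q powr p2 * ((s powr p2 - 1)/p2) - e2 Q)
      \<longlongrightarrow> Q powr p2 * inverse p2 - inverse p1 - e2 Q) (at_right 0)"
    using True p21 by real_asymp
  moreover have "0 < Q powr p2 * inverse p2 - inverse p1 - e2 Q"
    using True p21 by (simp add: box_cox_def field_simps)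
  ultimately have "\<forall>\<^sub>F s in at_right 0. 0 < (s powr p1 - 1)/p1 - Q powr p2 * ((s powr p2 - 1)/p2) - e2 Q"
    by (intro order_tendstoD)
  then show ?thesis by (simp add: box_cox_def)
next
  case False
  define p where "p = - p2"
  have p: "0 < p" "p2 = - p" using False p2 by (auto simp: p_def)
  define c where "c = Q powr p2"
  have c: "0 < c" using Q1 by (simp add: c_def)
  have "filterlim (\<lambda>s::real. (s powr p1 - 1)/p1 + c * ((s powr (-p) - 1)/p) - d) at_top (at_right 0)" for d
  proof (cases "0 < p1")
    case True then show ?thesis using p c by real_asymp
  next
    case False
    define q where "q = - p1"
    have q: "0 < q" "p1 = - q" "q < p" using False p1 p21 p by (auto simp: q_def)
    then have "filterlim (\<lambda>s::real. c * ((s powr (-p) - 1)/p) - (s powr (-q) - 1)/q - d) at_top (at_right 0)"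
      using p c by real_asymp
    then show ?thesis using q(2) by (simp add: algebra_simps)
  qed
  then have "\<forall>\<^sub>F s::real in at_right 0. 0 < (s powr p1 - 1)/p1 + c * ((s powr (-p) - 1)/p) - e2 Q"
    unfolding filterlim_at_top_dense by blast
  then show ?thesis using p(2) by (simp add: box_cox_def c_def)
qed

lemma balance_pos_near_top: "\<forall>\<^sub>F s in at_top. 0 < e1 s - Q powr p2 * e2 s - e2 Q"
proof (cases "p1 < 0")
  case True
  have "((\<lambda>s::real. (s powr p1 - 1)/p1 - Q powr p2 * ((s powr p2 - 1)/p2) - e2 Q)
      \<longlongrightarrow> Q powr p2 * inverse p2 - inverse p1 - e2 Q) at_top"
    using True p21 by real_asymp
  moreover have "0 < Q powr p2 * inverse p2 - inverse p1 - e2 Q"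
  proof -
    have "Q powr p2 * inverse p2 - inverse p1 - e2 Q = inverse p2 - inverse p1"
      using p2 by (simp add: box_cox_def field_simps)
    then show ?thesis using True p21 less_imp_inverse_less_neg[of p2 p1] by linarith
  qed
  ultimately have "\<forall>\<^sub>F s in at_top. 0 < (s powr p1 - 1)/p1 - Q powr p2 * ((s powr p2 - 1)/p2) - e2 Q"
    by (intro order_tendstoD)
  then show ?thesis by (simp add: box_cox_def)
next
  case False
  define c where "c = Q powr p2"
  have c: "0 < c" using Q1 by (simp add: c_def)
  have q: "0 < p1" using False p1 by simp
  have "filterlim (\<lambda>s::real. (s powr p1 - 1)/p1 - c * ((s powr p2 - 1)/p2) - d) at_top at_top" for d
  proof (cases "0 < p2")
    case True then show ?thesis using p21 c by real_asymp
  next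
    case False
    define p where "p = - p2"
    have p: "0 < p" "p2 = - p" using False p2 by (auto simp: p_def)
    have "filterlim (\<lambda>s::real. (s powr p1 - 1)/p1 + c * ((s powr (-p) - 1)/p) - d) at_top at_top"
      using p c q by real_asymp
    then show ?thesis using p(2) by (simp add: algebra_simps)
  qed
  then have "\<forall>\<^sub>F s::real in at_top. 0 < (s powr p1 - 1)/p1 - c * ((s powr p2 - 1)/p2) - e2 Q"
    unfolding filterlim_at_top_dense by blast
  then show ?thesis by (simp add: box_cox_def c_def)
qed

lemma G_eq_0_iff:
  assumes "0 < g"
  shows "G g = 0 \<longleftrightarrow> e2 (1/g) - Q powr (-p2) * e1 (1/g) = - (Q powr (-p2) * e2 Q)"
proof -
  have "e2 (1/g) - Q powr (-p2) * e1 (1/g) = - (Q powr (-p2) * (G g + e2 Q))"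
    using Q1 by (simp add: G_eq[OF assms] powr_minus field_simps)
  then show ?thesis using Q1 by (simp only: neg_equal_iff_equal mult_cancel_left) auto
qed

lemma ex1_gamma_minus: "\<exists>!g. 0 < g \<and> g < 1 \<and> gamma_eq p1 p2 Q g"
proof (rule ex_ex1I)
  from balance_pos_near_top obtain N where N: "\<And>s. N \<le> s \<Longrightarrow> 0 < e1 s - Q powr p2 * e2 s - e2 Q"
    unfolding eventually_at_top_linorder by blast
  define M where "M = max N 2"
  have "\<exists>s\<ge>1. s \<le> M \<and> e1 s - Q powr p2 * e2 s - e2 Q = 0"
    by (rule IVT') (use N[of M] G_continuous[of 1] box_cox_pos[OF p2 Q1] in \<open>auto simp: M_def\<close>)
  then obtain s where s: "1 \<le> s" "e1 s - Q powr p2 * e2 s - e2 Q = 0" by blast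
  then have "s \<noteq> 1" using box_cox_pos[OF p2 Q1] by auto
  then have "gamma_eq p1 p2 Q (1/s)" using s by (simp add: gamma_eq_iff_G G_eq)
  then show "\<exists>g. 0 < g \<and> g < 1 \<and> gamma_eq p1 p2 Q g"
    using s \<open>s \<noteq> 1\<close> by (intro exI[of _ "1/s"]) auto
next
  have neq: False if "0 < a" "a < b" "b < 1" "gamma_eq p1 p2 Q a" "gamma_eq p1 p2 Q b" for a b
  proof -
    have pos: "0 < a" "0 < b" using that by auto
    have "e2 1 - Q powr (-p2) * e1 1 < - (Q powr (-p2) * e2 Q)"
    proof (rule box_cox_combination_two_points(2)[OF p1 p2 p21, where a = "1/b" and b = "1/a"])
      show "e2 (1/b) - Q powr (-p2) * e1 (1/b) = - (Q powr (-p2) * e2 Q)"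
        using G_eq_0_iff[OF pos(2)] gamma_eq_iff_G[OF pos(2)] that by blast
      show "e2 (1/a) - Q powr (-p2) * e1 (1/a) = - (Q powr (-p2) * e2 Q)"
        using G_eq_0_iff[OF pos(1)] gamma_eq_iff_G[OF pos(1)] that by blast
    qed (use that pos Q1 in \<open>auto simp: divide_strict_left_mono\<close>)
    moreover have "0 < Q powr (-p2) * e2 Q" using box_cox_pos[OF p2 Q1] Q1 by simp
    ultimately show False by simp
  qed
  then show "g = h" if "0 < g \<and> g < 1 \<and> gamma_eq p1 p2 Q g" "0 < h \<and> h < 1 \<and> gamma_eq p1 p2 Q h" for g h
  proof (cases g h rule: linorder_cases)
    case less then show ?thesis using neq[of g h] that by blast
  next
    case greater then show ?thesis using neq[of h g] that by blast
  qed
qed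

lemma ex1_gamma_plus: "\<exists>!g. 1 < g \<and> gamma_eq p1 p2 Q g"
proof (rule ex_ex1I)
  have "\<forall>\<^sub>F s in at_right 0. 0 < e1 s - Q powr p2 * e2 s - e2 Q \<and> s \<in> {0<..<1}"
    by (rule eventually_conj[OF balance_pos_near_0 eventually_at_right_real]) simp
  from eventually_happens'[OF trivial_limit_at_right_real this] obtain m where m: "0 < m" "m < 1" "0 < e1 m - Q powr p2 * e2 m - e2 Q"
    by (auto simp del: box_cox_1)
  have "\<exists>s\<ge>m. s \<le> 1 \<and> e1 s - Q powr p2 * e2 s - e2 Q = 0"
  proof (rule IVT2')
    show "continuous_on {m..1} (\<lambda>s. e1 s - Q powr p2 * e2 s - e2 Q)" by (rule G_continuous[OF m(1)])
    show "e1 1 - Q powr p2 * e2 1 - e2 Q \<le> 0" using box_cox_pos[OF p2 Q1] by simp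
    show "0 \<le> e1 m - Q powr p2 * e2 m - e2 Q" "m \<le> 1" using m by linarith+
  qed
  then obtain s where s: "m \<le> s" "s \<le> 1" "e1 s - Q powr p2 * e2 s - e2 Q = 0" by blast
  then have "s \<noteq> 1" using box_cox_pos[OF p2 Q1] by auto
  then have "gamma_eq p1 p2 Q (1/s)" using s m by (simp add: gamma_eq_iff_G G_eq)
  then show "\<exists>g. 1 < g \<and> gamma_eq p1 p2 Q g"
    using s m \<open>s \<noteq> 1\<close> by (intro exI[of _ "1/s"]) auto
next
  have neq: False if "1 < a" "a < b" "gamma_eq p1 p2 Q a" "gamma_eq p1 p2 Q b" for a b
  proof -
    have pos: "0 < a" "0 < b" using that by auto
    have "e2 1 - Q powr (-p2) * e1 1 < - (Q powr (-p2) * e2 Q)"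
    proof (rule box_cox_combination_two_points(3)[OF p1 p2 p21, where a = "1/b" and b = "1/a"])
      show "e2 (1/b) - Q powr (-p2) * e1 (1/b) = - (Q powr (-p2) * e2 Q)"
        using G_eq_0_iff[OF pos(2)] gamma_eq_iff_G[OF pos(2)] that by blast
      show "e2 (1/a) - Q powr (-p2) * e1 (1/a) = - (Q powr (-p2) * e2 Q)"
        using G_eq_0_iff[OF pos(1)] gamma_eq_iff_G[OF pos(1)] that by blast
    qed (use that pos Q1 in \<open>auto simp: divide_strict_left_mono\<close>)
    moreover have "0 < Q powr (-p2) * e2 Q" using box_cox_pos[OF p2 Q1] Q1 by simp
    ultimately show False by simp
  qed
  then show "g = h" if "1 < g \<and> gamma_eq p1 p2 Q g" "1 < h \<and> gamma_eq p1 p2 Q h" for g h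
  proof (cases g h rule: linorder_cases)
    case less then show ?thesis using neq[of g h] that by blast
  next
    case greater then show ?thesis using neq[of h g] that by blast
  qed
qed

lemma gm: "0 < gm" "gm < 1" "gamma_eq p1 p2 Q gm"
  using theI'[OF ex1_gamma_minus] by (auto simp: gamma_minus_def)

lemma gp: "1 < gp" "gamma_eq p1 p2 Q gp"
  using theI'[OF ex1_gamma_plus] by (auto simp: gamma_plus_def)

lemma gp_pos: "0 < gp" using gp by simp

lemma vm: "0 < vm" "vm < 1" and gm_eq: "gm = gp * vm"
  using gm gp by (auto simp: v_minus_def)

lemma A_pos: "0 < A"
  using gp Q1 by (simp add: A_const_def)

text \<open>
  The slopes of \<open>L_plus\<close> and \<open>L_minus\<close> in the new coordinates are \<open>A\<close> and \<open>Am\<close>.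
\<close>

definition Am :: real where "Am = A * vm powr (p2 - p1)"

lemma gp_tangent: "e2 (gp / Q) = A * e1 gp"
  using gp gamma_eq_iff[of gp] by (simp add: A_const_def)

lemma Am_eq: "Am = Q powr (-p2) * gm powr (p2 - p1)"
  using gp_pos gm(1) by (simp add: Am_def A_const_def v_minus_def powr_divide)

lemma gm_tangent: "e2 (gm / Q) = Am * e1 gm"
  using gm gamma_eq_iff[of gm] by (simp add: Am_eq)

text \<open>
  The first identity rewrites \<open>Q powr (-p2)\<close> through the slope, and the second follows by inserting it
  in the equation of tangency. It shows \<open>A < 1 < Am\<close>, because \<open>e1 gp\<close> and \<open>e1 gm\<close> have opposite signs.
\<close>

lemma slope_identity:
  assumes "0 < g" "a = Q powr (-p2) * g powr (p2 - p1)" "e2 (g / Q) = a * e1 g"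
  shows "(g / Q) powr p2 = a * g powr p1" "a * (1 + (p1 - p2) * e1 g) = 1"
proof -
  have "g powr (p2 - p1) * g powr p1 = g powr p2" by (simp add: powr_add[symmetric])
  then have "a * g powr p1 = Q powr (-p2) * g powr p2"
    unfolding assms(2) mult.assoc by simp
  moreover have "(g / Q) powr p2 = Q powr (-p2) * g powr p2"
    using assms(1) Q1 by (simp add: powr_divide powr_minus field_simps)
  ultimately show 1: "(g / Q) powr p2 = a * g powr p1" by simp
  show "a * (1 + (p1 - p2) * e1 g) = 1"
  proof -
    have "1 + p2 * (a * e1 g) = a * (1 + p1 * e1 g)"
      using 1 unfolding powr_eq_box_cox[OF p2] powr_eq_box_cox[OF p1] assms(3) .
    moreover have "a * (1 + (p1 - p2) * e1 g) = a * (1 + p1 * e1 g) - p2 * (a * e1 g)"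
      by (simp add: algebra_simps)
    ultimately show ?thesis by linarith
  qed
qed

lemma A_gp: "(gp / Q) powr p2 = A * gp powr p1" "A * (1 + (p1 - p2) * e1 gp) = 1"
  using slope_identity[OF gp_pos _ gp_tangent] by (auto simp: A_const_def)

lemma A_less_1: "A < 1"
proof -
  have "0 < (p1 - p2) * e1 gp" using gp p21 box_cox_pos[OF p1] by simp
  then have "A * 1 < A * (1 + (p1 - p2) * e1 gp)" using A_pos by (intro mult_strict_left_mono) auto
  then show ?thesis using A_gp by simp
qed

lemma Am_pos: "0 < Am" using A_pos vm by (simp add: Am_def)

lemma Am_gt_1: "1 < Am"
proof -
  have eq: "Am * (1 + (p1 - p2) * e1 gm) = 1"
    using slope_identity(2)[OF gm(1) Am_eq gm_tangent] .
  have "(p1 - p2) * e1 gm < 0" using gm p21 box_cox_neg[OF p1] by (simp add: mult_pos_neg)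
  then have "Am * (1 + (p1 - p2) * e1 gm) < Am * 1" using Am_pos by (intro mult_strict_left_mono) auto
  then show ?thesis using eq by simp
qed

text \<open>
  Scaling by \<open>vm\<close> carries the point of tangency at \<open>gp\<close> to the one at \<open>gm\<close>, and the origin to the point with
  parameter \<open>vm\<close> of the upper curve; so \<open>L_minus\<close> is the scaled copy of \<open>L_plus\<close>.
\<close>

lemma vm_on_line: "e2 vm = Am * e1 vm"
proof -
  have "e2 (gm / Q) = vm powr p2 * e2 (gp / Q) + e2 vm"
    using box_cox_mult[OF p2, of "gp/Q" vm] gp_pos Q1 vm by (simp add: gm_eq)
  moreover have "e1 gm = vm powr p1 * e1 gp + e1 vm"
    using box_cox_mult[OF p1, of "gp" vm] gp_pos vm by (simp add: gm_eq)
  moreover have "Am * vm powr p1 = A * vm powr p2"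
    by (simp add: Am_def powr_add[symmetric])
  ultimately have "vm powr p2 * (A * e1 gp) + e2 vm = A * vm powr p2 * e1 gp + Am * e1 vm"
    using gm_tangent gp_tangent by (simp add: distrib_left mult.assoc[symmetric])
  then show ?thesis by simp
qed

text \<open>
  The height of the upper curve over \<open>L_plus\<close>. By \<open>S_divide_tangent\<close> below, \<open>S (u / v)\<close> is, up to a positive
  factor, its height over the tangent that starts at parameter \<open>v\<close>.
\<close>

definition S :: "real \<Rightarrow> real" where "S u = e2 u - A * e1 u"

lemma S_1 [simp]: "S 1 = 0" by (simp add: S_def)

lemma S_divide:
  assumes "0 \<le> u" "0 < v"
  shows "S (u / v) = v powr (-p2) * ((e2 u - e2 v) - A * v powr (p2 - p1) * (e1 u - e1 v))"
  using assms p1 p2 by (simp add: S_def box_cox_divide algebra_simps powr_add[symmetric])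

lemma S_divide_vm: "0 \<le> u \<Longrightarrow> S (u / vm) = vm powr (-p2) * (e2 u - Am * e1 u)"
  using S_divide[of u vm] vm vm_on_line by (simp add: Am_def algebra_simps)

lemma S_inverse_vm: "S (1 / vm) = 0"
  using S_divide_vm[of 1] by simp

lemma S_pos: "1 < u \<Longrightarrow> u < 1 / vm \<Longrightarrow> 0 < S u"
  and S_neg: "0 < u \<Longrightarrow> u < 1 \<or> 1 / vm < u \<Longrightarrow> S u < 0"
  using box_cox_combination_two_points[OF p1 p2 p21 A_pos, of 1 "1/vm" 0 u] vm S_inverse_vm
  by (auto simp: S_def)

lemma S_nonneg: "1 \<le> u \<Longrightarrow> u \<le> 1 / vm \<Longrightarrow> 0 \<le> S u"
  using S_pos[of u] S_inverse_vm by (cases "u = 1"; cases "u = 1 / vm") auto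

lemma S_nonpos: "proper u \<Longrightarrow> u \<le> 1 \<or> 1 / vm \<le> u \<Longrightarrow> S u \<le> 0"
proof -
  assume u: "proper u" "u \<le> 1 \<or> 1 / vm \<le> u"
  consider "u = 0" "0 < p2" | "0 < u" using u by (auto simp: proper_def)
  then show ?thesis
  proof cases
    case 1
    have "A / p1 \<le> 1 / p1" using 1 p21 A_less_1 by (simp add: divide_right_mono)
    also have "\<dots> < 1 / p2" using 1 p21 by (simp add: field_simps)
    finally show ?thesis using 1 by (simp add: S_def box_cox_def)
  next
    case 2
    then show ?thesis using u(2) S_neg[of u] S_inverse_vm by (cases "u = 1"; cases "u = 1 / vm") auto
  qed
qed

lemma S_mono: "0 < u \<Longrightarrow> u \<le> u' \<Longrightarrow> u' \<le> 1 \<Longrightarrow> S u \<le> S u'"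
proof (cases "u = u'")
  case False
  assume "0 < u" "u \<le> u'" "u' \<le> 1"
  moreover have "A * u' powr (p1 - p2) \<le> 1 * 1"
    using calculation A_pos A_less_1 p21 by (intro mult_mono powr_le1) auto
  ultimately show ?thesis
    using box_cox_combination_increasing[OF p1 p2 p21, of u u' A] A_pos False by (auto simp: S_def)
qed auto

text \<open>
  The difference of the two sides is again a unimodal function, whose extremum is at \<open>gp\<close>; there it
  vanishes by \<open>gp_tangent\<close>.
\<close>

lemma extremal_curve_below_tangent:
  assumes "0 < s" shows "e2 (s / Q) \<le> A * e1 s"
proof -
  define k where "k = A * Q powr p2"
  have k: "k = gp powr (p2 - p1)" using Q1 by (simp add: k_def A_const_def powr_minus field_simps)
  have k0: "0 < k" using gp_pos k by simp
  have kg: "k * gp powr (p1 - p2) = 1" using gp_pos by (simp add: k powr_add[symmetric])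
  have "e2 s - k * e1 s \<le> e2 gp - k * e1 gp"
    using box_cox_combination_increasing[OF p1 p2 p21, of s gp k]
      box_cox_combination_decreasing[OF p1 p2 p21, of gp s k] kg k0 gp_pos assms
    by (cases "s = gp"; cases "s < gp") auto
  then have "Q powr (-p2) * (e2 s - k * e1 s) \<le> Q powr (-p2) * (e2 gp - k * e1 gp)"
    by (intro mult_left_mono) auto
  moreover have "Q powr (-p2) * k = A" using Q1 by (simp add: k_def powr_minus)
  moreover have "e2 (u / Q) = Q powr (-p2) * e2 u - Q powr (-p2) * e2 Q" if "0 \<le> u" for u
    using box_cox_divide[OF p2 that, of Q] Q1 by (simp add: algebra_simps)
  ultimately have "e2 (s / Q) - A * e1 s \<le> e2 (gp / Q) - A * e1 gp"
    using assms gp_pos by (simp add: right_diff_distrib mult.assoc[symmetric])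
  then show ?thesis using gp_tangent by simp
qed

text \<open>
  The ordinate at abscissa \<open>y\<close> of the line that starts at parameter \<open>v\<close> of the upper curve and touches the lower one.
\<close>

definition tangent :: "real \<Rightarrow> real \<Rightarrow> real" where
  "tangent v y = e2 v + A * v powr (p2 - p1) * (y - e1 v)"

lemma tangent_1: "tangent 1 y = A * y" by (simp add: tangent_def)

lemma tangent_vm: "tangent vm y = Am * y"
  using vm_on_line by (simp add: tangent_def Am_def algebra_simps)

lemma extremal_curve_below:
  assumes "0 < v" "0 < r" shows "e2 (r / Q) \<le> tangent v (e1 r)"
proof -
  have "e2 (r / v / Q) \<le> A * e1 (r / v)" using assms by (intro extremal_curve_below_tangent) auto
  then have "v powr p2 * e2 (r / v / Q) \<le> v powr p2 * (A * e1 (r / v))" by (intro mult_left_mono) auto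
  moreover have "e2 (r / Q) = v powr p2 * e2 (r / v / Q) + e2 v"
    using box_cox_mult[OF p2, of "r / v / Q" v] assms Q1 by simp
  moreover have "v powr p2 * (A * e1 (r / v)) = A * v powr (p2 - p1) * (e1 r - e1 v)"
    using assms p1 by (simp add: box_cox_divide powr_diff powr_minus field_simps)
  ultimately show ?thesis by (simp add: tangent_def)
qed

lemma tangent_touches:
  assumes "0 < v" shows "tangent v (e1 (gp * v)) = e2 (gp * v / Q)"
proof -
  have "e2 (gp * v / Q) = v powr p2 * e2 (gp / Q) + e2 v"
    using box_cox_mult[OF p2, of "gp / Q" v] assms Q1 gp_pos by simp
  moreover have "e1 (gp * v) = v powr p1 * e1 gp + e1 v"
    using box_cox_mult[OF p1, of "gp" v] assms gp_pos by simp
  moreover have "v powr (p2 - p1) * v powr p1 = v powr p2" by (simp add: powr_add[symmetric])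
  ultimately show ?thesis using gp_tangent by (simp add: tangent_def)
qed

lemma S_divide_tangent:
  "0 \<le> u \<Longrightarrow> 0 < v \<Longrightarrow> S (u / v) = v powr (-p2) * (e2 u - tangent v (e1 u))"
  by (simp add: S_divide tangent_def algebra_simps)

text \<open>
  To the left of the points of tangency the tangents do not cross, so they foliate the domain. The derivative in
  \<open>v\<close> vanishes exactly when the abscissa is that of the point of tangency, by the second part of \<open>A_gp\<close>.
\<close>

lemma tangent_strict_mono:
  assumes "0 < v" "v < v'" "0 < r" "r \<le> gp * v"
  shows "tangent v (e1 r) < tangent v' (e1 r)"
proof (rule DERIV_pos_imp_increasing_open[OF assms(2)])
  fix x assume x: "v < x" "x < v'"
  then have x0: "0 < x" using assms by simp
  have "r < gp * x" using assms x gp_pos by (meson mult_strict_left_mono order_le_less_trans)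
  then have "e1 (r / x) < e1 gp" using assms x0 gp_pos by (intro box_cox_strict_mono p1) (auto simp: field_simps)
  then have "A * (1 + (p1 - p2) * e1 (r/x)) < A * (1 + (p1 - p2) * e1 gp)"
    using A_pos p21 by (intro mult_strict_left_mono add_strict_left_mono) auto
  then have pos: "0 < 1 - A * (1 + (p1 - p2) * e1 (r/x))" using A_gp by simp
  have e1x: "e1 r - e1 x = x powr p1 * e1 (r / x)"
    using box_cox_mult[OF p1, of "r/x" x] assms x0 by simp
  define D where "D = x powr (p2 - 1) + A * ((p2 - p1) * x powr (p2 - p1 - 1)) * (e1 r - e1 x)
     - A * x powr (p2 - p1) * x powr (p1 - 1)"
  have "((\<lambda>v. tangent v (e1 r)) has_real_derivative D) (at x)"
    unfolding tangent_def D_def using x0 p1 p2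
    by (auto intro!: derivative_eq_intros simp: algebra_simps)
  moreover have "D = x powr (p2 - 1) * (1 - A * (1 + (p1 - p2) * e1 (r/x)))"
  proof -
    have "x powr (p2 - p1 - 1) * x powr p1 = x powr (p2 - 1)"
      and "x powr (p2 - p1) * x powr (p1 - 1) = x powr (p2 - 1)"
      by (simp_all add: powr_add[symmetric])
    moreover have "D = x powr (p2 - 1) + A * (p2 - p1) * e1 (r/x) * (x powr (p2 - p1 - 1) * x powr p1)
        - A * (x powr (p2 - p1) * x powr (p1 - 1))"
      unfolding D_def e1x by (simp add: mult_ac)
    ultimately show ?thesis by (simp add: algebra_simps)
  qed
  ultimately show "\<exists>y. ((\<lambda>v. tangent v (e1 r)) has_real_derivative y) (at x) \<and> 0 < y"
    using pos x0 by (intro exI[of _ D]) auto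
next
  show "continuous_on {v..v'} (\<lambda>v. tangent v (e1 r))"
    unfolding tangent_def using assms p1 p2
    by (auto intro!: continuous_at_imp_continuous_on continuous_intros isCont_box_cox)
qed

text \<open>
  The exponent of the extremal power function: the averages of \<open>t powr (- kap)\<close> over \<open>{0..b}\<close> stay on the lower curve,
  which amounts to \<open>kap_p1\<close> and \<open>kap_p2\<close>.
\<close>

definition kap :: real where "kap = (1 - gp powr (-p1)) / p1"

lemma kap_pos: "0 < kap"
proof -
  have "kap = - e1 (1/gp)" using gp_pos p1 by (simp add: kap_def box_cox_def powr_divide powr_minus field_simps)
  then show ?thesis using box_cox_neg[OF p1, of "1/gp"] gp by simp
qed

lemma kap_p1: "1 - kap * p1 = 1 / gp powr p1"
  using p1 by (simp add: kap_def powr_minus field_simps)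

lemma kap_p2: "1 - kap * p2 = 1 / (gp / Q) powr p2"
proof -
  define g where "g = gp powr p1"
  have g: "0 < g" using gp_pos by (simp add: g_def)
  have "A * (1 + (p1 - p2) * ((g - 1)/p1)) = 1" using A_gp(2) by (simp add: box_cox_def g_def)
  then have 1: "1 / A = 1 + (p1 - p2) * ((g - 1)/p1)" using A_pos by (simp add: field_simps)
  have "1 / (gp / Q) powr p2 = (1/A) / g" using A_gp(1) by (simp add: g_def)
  also have "\<dots> = 1 - kap * p2" unfolding 1 kap_def powr_minus g_def[symmetric]
    using g p1 by (simp add: field_simps)
  finally show ?thesis by simp
qed

lemma inverse_kap: "1 / kap = (p1 - p2) / (1 - A) + p2"
proof -
  define h where "h = e1 gp"
  have h: "0 < h" using box_cox_pos[OF p1] gp by (simp add: h_def)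
  have Ah: "A * (1 + (p1 - p2) * h) = 1" using A_gp by (simp add: h_def)
  then have "1 - A = A * (p1 - p2) * h" by (simp add: algebra_simps)
  then have "(p1 - p2) / (1 - A) = 1 / (A * h)" using p21 by simp
  also have "\<dots> = (1 + (p1 - p2) * h) / h" using Ah A_pos h by (simp add: field_simps)
  also have "\<dots> = 1/h + p1 - p2" using h by (simp add: field_simps)
  finally have "(p1 - p2) / (1 - A) + p2 = (1 + p1 * h) / h" using h by (simp add: field_simps)
  moreover have "1 + p1 * h = gp powr p1" using powr_eq_box_cox[OF p1, of gp] by (simp add: h_def)
  moreover have "kap = h / gp powr p1"
    using gp_pos by (simp add: kap_def h_def box_cox_def powr_minus field_simps)
  ultimately show ?thesis by simp
qed

lemma E_inverse_vm: "E (1 / vm) = (1 - A) * e1 (1 / vm)"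
  using S_inverse_vm by (simp add: E_def S_def algebra_simps)

lemma E_inverse_vm_pos: "0 < E (1 / vm)"
  using E_pos[of "1 / vm"] vm by simp

end

section \<open>Upper bounds for the level set\<close>

lemma integral_nonneg_AE_Icc:
  fixes f :: "real \<Rightarrow> real"
  assumes f: "f absolutely_integrable_on {c..d}"
    and nn: "AE t in lebesgue. t \<in> {c..d} \<longrightarrow> 0 \<le> f t"
  shows "0 \<le> integral {c..d} f"
proof -
  have "0 \<le> (LINT t:{c..d}|lebesgue. f t)"
    unfolding set_lebesgue_integral_def
    using nn by (intro integral_nonneg_AE) (auto elim!: eventually_mono simp: indicator_def)
  then show ?thesis using set_lebesgue_integral_eq_integral(2)[OF f] by simp
qed

context bellman_parameters
begin

lemma proper_e1_le_iff: "proper u \<Longrightarrow> 0 < r \<Longrightarrow> e1 u \<le> e1 r \<longleftrightarrow> u \<le> r"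
proof -
  assume "proper u" "0 < r"
  then consider "0 < u" | "u = 0" "0 < p2" by (auto simp: proper_def)
  then show ?thesis
  proof cases
    case 2 then show ?thesis using p21 \<open>0 < r\<close> by (simp add: box_cox_def field_simps)
  qed (use p1 \<open>0 < r\<close> in \<open>simp add: box_cox_le_iff\<close>)
qed

lemma proper_e1_ge_iff: "proper u \<Longrightarrow> 0 < r \<Longrightarrow> e1 r \<le> e1 u \<longleftrightarrow> r \<le> u"
proof -
  assume "proper u" "0 < r"
  then consider "0 < u" | "u = 0" "0 < p2" by (auto simp: proper_def)
  then show ?thesis
  proof cases
    case 2
    then have "e1 0 < e1 r" using p21 \<open>0 < r\<close> by (simp add: box_cox_def field_simps)
    then show ?thesis using 2 \<open>0 < r\<close> by simp
  qed (use p1 \<open>0 < r\<close> in \<open>simp add: box_cox_le_iff\<close>)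
qed

lemma E_divide_affine:
  "0 \<le> u \<Longrightarrow> 0 < v \<Longrightarrow> E (u / v) = (v powr (-p2) * e2 v - v powr (-p1) * e1 v)
     + v powr (-p1) * e1 u + (- (v powr (-p2))) * e2 u"
  by (simp add: E_divide algebra_simps)

text \<open>
  The function \<open>1 + c2 * S u\<close> is the affine function of region II along the upper curve: it is 0 at \<open>vm\<close> and 1 at 1, and
  it is constant along \<open>L_plus\<close>.
\<close>

definition c2 :: real where "c2 = - 1 / S vm"

lemma S_vm: "S vm < 0" using S_neg[of vm] vm by simp

lemma c2_pos: "0 < c2" using S_vm by (simp add: c2_def)

lemma c2_vm: "1 + c2 * S vm = 0" using S_vm by (simp add: c2_def)

definition b2 :: real where "b2 = c2 + vm powr (-p2) / E (1 / vm)"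

lemma b2_pos: "0 < b2" using c2_pos E_inverse_vm_pos by (simp add: b2_def add_pos_nonneg)

text \<open>
  Both \<open>1 + c2 * S u\<close> and \<open>E (u / vm) / E (1 / vm)\<close> are affine in \<open>(e1 u, e2 u)\<close> and agree at the
  two points \<open>vm\<close> and 1 of \<open>L_minus\<close>, so they differ by a multiple of the height over \<open>L_minus\<close>. That the factor
  \<open>b2\<close> is positive is what makes region II work.
\<close>

lemma chord_identity:
  assumes "0 \<le> u"
  shows "1 + c2 * S u = E (u / vm) / E (1 / vm) + b2 * (e2 u - Am * e1 u)"
proof -
  define k where "k = - c2 * A - vm powr (-p1) / E (1/vm) + b2 * Am"
  have aff: "1 + c2 * S u - (E (u / vm) / E (1 / vm) + b2 * (e2 u - Am * e1 u)) = k * e1 u"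
    if "0 \<le> u" for u
  proof -
    have "E (1/vm) = vm powr (-p2) * e2 vm - vm powr (-p1) * e1 vm"
      using E_divide_affine[of 1 vm] vm by simp
    then have "E (u / vm) = E (1/vm) + vm powr (-p1) * e1 u - vm powr (-p2) * e2 u"
      using E_divide_affine[OF that vm(1)] by simp
    then have "E (u / vm) / E (1/vm) = 1 + vm powr (-p1) / E (1/vm) * e1 u - vm powr (-p2) / E (1/vm) * e2 u"
      using E_inverse_vm_pos by (simp add: add_divide_distrib diff_divide_distrib)
    then show ?thesis unfolding k_def b2_def S_def by (simp only:) (simp add: algebra_simps add_divide_distrib diff_divide_distrib)
  qed
  have "k * e1 vm = 0" using aff[of vm] vm c2_vm vm_on_line by simp
  then have "k = 0" using box_cox_neg[OF p1, of vm] vm by simp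
  then show ?thesis using aff[OF assms] by simp
qed

text \<open>
  \<open>F s\<close> is, up to a constant factor, the value that the formula belonging to the parameter \<open>s\<close> assigns to the
  point of the lower curve with parameter \<open>gp\<close>, whose own parameter is 1.
\<close>

definition F :: "real \<Rightarrow> real" where "F s = s powr (1/kap) * (e1 (gp / s) - e2 (gp / Q / s))"

text \<open>
  Tangency makes this point critical: the derivative is a multiple of \<open>e1 gp / kap - gp powr p1\<close>, which is 0 by the choice
  of \<open>kap\<close>.
\<close>

lemma F_derivative: "(F has_real_derivative 0) (at 1)"
proof -
  have "kap = e1 gp / gp powr p1"
    using gp_pos by (simp add: kap_def box_cox_def powr_minus field_simps)
  then have k: "1/kap * e1 gp = gp powr p1" using box_cox_pos[OF p1 gp(1)] by simp
  have 1: "((\<lambda>s. e1 (gp / s)) has_real_derivative - (gp powr p1)) (at 1)"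
  proof -
    have "((\<lambda>s. gp / s) has_real_derivative - gp) (at 1)" by (auto intro!: derivative_eq_intros)
    from DERIV_chain2[OF _ this, of e1 "gp powr (p1 - 1)"] have
      "((\<lambda>s. e1 (gp / s)) has_real_derivative gp powr (p1 - 1) * - gp) (at 1)"
      using has_derivative_box_cox[OF p1 gp_pos] by simp
    moreover have "gp powr (p1 - 1) * gp = gp powr p1"
      using gp_pos by (simp add: powr_diff)
    ultimately show ?thesis by simp
  qed
  have 2: "((\<lambda>s. e2 (gp / Q / s)) has_real_derivative - ((gp / Q) powr p2)) (at 1)"
  proof -
    have gq: "0 < gp / Q" using gp_pos Q1 by simp
    have "((\<lambda>s. gp / Q / s) has_real_derivative - (gp / Q)) (at 1)"
      using Q1 by (auto intro!: derivative_eq_intros)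
    from DERIV_chain2[OF _ this, of e2 "(gp / Q) powr (p2 - 1)"] have
      "((\<lambda>s. e2 (gp / Q / s)) has_real_derivative (gp / Q) powr (p2 - 1) * - (gp / Q)) (at 1)"
      using has_derivative_box_cox[OF p2 gq] by simp
    moreover have "(gp / Q) powr (p2 - 1) * (gp / Q) = (gp / Q) powr p2"
      using gp_pos Q1 powr_add[of "gp / Q" "p2 - 1" 1] by simp
    ultimately show ?thesis by simp
  qed
  have "(F has_real_derivative (1/kap) * 1 powr (1/kap - 1) * (e1 (gp / 1) - e2 (gp / Q / 1))
      + (- (gp powr p1) - - ((gp / Q) powr p2)) * 1 powr (1/kap)) (at 1)"
    unfolding F_def
    by (intro DERIV_mult DERIV_diff 1 2 has_real_derivative_powr) simp
  moreover have "(1/kap) * 1 powr (1/kap - 1) * (e1 (gp / 1) - e2 (gp / Q / 1))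
      + (- (gp powr p1) - - ((gp / Q) powr p2)) * 1 powr (1/kap) = (1 - A) * (1/kap * e1 gp) - (1 - A) * gp powr p1"
    using gp_tangent A_gp(1) by (simp add: algebra_simps diff_divide_distrib)
  ultimately show ?thesis unfolding k by simp
qed

end

locale bellman_weight = bellman_parameters +
  fixes w :: "real \<Rightarrow> real"
  assumes int1: "(\<lambda>t. e1 (w t)) absolutely_integrable_on {0..1}"
    and int2: "(\<lambda>t. e2 (w t)) absolutely_integrable_on {0..1}"
    and proper_AE: "AE t in lebesgue. t \<in> {0..1} \<longrightarrow> proper (w t)"
    and level_set: "{t \<in> {0..1}. 1 \<le> w t} \<in> sets lebesgue"
    and ratio: "\<And>c d r. 0 \<le> c \<Longrightarrow> c < d \<Longrightarrow> d \<le> 1 \<Longrightarrow> 0 < r \<Longrightarrow>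
      integral {c..d} (\<lambda>t. e1 (w t)) = (d - c) * e1 r \<Longrightarrow>
      (d - c) * e2 (r / Q) \<le> integral {c..d} (\<lambda>t. e2 (w t))"
begin

definition ind :: "real \<Rightarrow> real" where "ind t = (if 1 \<le> w t then 1 else 0)"

lemma ind_cases: "ind t = 0 \<or> ind t = 1" by (simp add: ind_def)

lemma abs_int_ind_mult:
  assumes f: "f absolutely_integrable_on {0..1}"
  shows "(\<lambda>t. ind t * f t) absolutely_integrable_on {0..1}"
proof -
  have "set_integrable lebesgue {t \<in> {0..1}. 1 \<le> w t} f"
    by (rule set_integrable_subset[OF f level_set]) auto
  moreover have "(\<lambda>t. indicat_real {t \<in> {0..1}. 1 \<le> w t} t *\<^sub>R f t) = (\<lambda>t. indicat_real {0..1} t *\<^sub>R (ind t * f t))"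
    by (auto simp: fun_eq_iff ind_def indicator_def)
  ultimately show ?thesis unfolding set_integrable_def by (simp only:)
qed

lemma abs_int_const: "(\<lambda>t. k::real) absolutely_integrable_on {c..d::real}"
  by (simp add: absolutely_integrable_on_const)

lemma abs_int_sub:
  assumes "f absolutely_integrable_on {0..1}" "0 \<le> c" "d \<le> 1"
  shows "(f :: real \<Rightarrow> real) absolutely_integrable_on {c..d}"
  using assms by (intro set_integrable_subset[OF assms(1)]) auto

lemma abs_int_ind: "ind absolutely_integrable_on {0..1}"
  using abs_int_ind_mult[OF abs_int_const[where k = 1]] by simp

lemmas abs_ints = int1 int2 abs_int_ind abs_int_ind_mult abs_int_const
  set_integral_add(1) set_integral_diff(1) set_integrable_mult_right

definition Y1 :: "real \<Rightarrow> real \<Rightarrow> real" where "Y1 c d = integral {c..d} (\<lambda>t. e1 (w t))"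
definition Y2 :: "real \<Rightarrow> real \<Rightarrow> real" where "Y2 c d = integral {c..d} (\<lambda>t. e2 (w t))"
definition M :: "real \<Rightarrow> real \<Rightarrow> real" where "M c d = integral {c..d} ind"

lemma has_int:
  assumes "0 \<le> c" "d \<le> 1"
  shows "((\<lambda>t. e1 (w t)) has_integral Y1 c d) {c..d}" "((\<lambda>t. e2 (w t)) has_integral Y2 c d) {c..d}"
    "(ind has_integral M c d) {c..d}"
  unfolding Y1_def Y2_def M_def
  using set_lebesgue_integral_eq_integral(1)[OF abs_int_sub[OF int1 assms]]
    set_lebesgue_integral_eq_integral(1)[OF abs_int_sub[OF int2 assms]]
    set_lebesgue_integral_eq_integral(1)[OF abs_int_sub[OF abs_int_ind assms]]
  by (simp_all add: integrable_integral)

lemma integral_affine: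
  assumes "0 \<le> c" "c \<le> d" "d \<le> 1"
  shows "integral {c..d} (\<lambda>t. k + k1 * e1 (w t) + k2 * e2 (w t) + k3 * ind t)
    = (d - c) * k + k1 * Y1 c d + k2 * Y2 c d + k3 * M c d"
proof (rule integral_unique)
  have "((\<lambda>t. k) has_integral (d - c) * k) {c..d}"
    using has_integral_const_real[of k c d] assms by simp
  then show "((\<lambda>t. k + k1 * e1 (w t) + k2 * e2 (w t) + k3 * ind t) has_integral
      (d - c) * k + k1 * Y1 c d + k2 * Y2 c d + k3 * M c d) {c..d}"
    using has_int[OF assms(1,3)] by (intro has_integral_add has_integral_mult_right)
qed

lemma abs_int_affine:
  "(\<lambda>t. k + k1 * e1 (w t) + k2 * e2 (w t) + k3 * ind t) absolutely_integrable_on {0..1}"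
  by (intro abs_ints)

lemma affine_nonneg:
  assumes "0 \<le> c" "c \<le> d" "d \<le> 1"
    and nn: "\<And>t. proper (w t) \<Longrightarrow> 0 \<le> k + k1 * e1 (w t) + k2 * e2 (w t) + k3 * ind t"
  shows "0 \<le> (d - c) * k + k1 * Y1 c d + k2 * Y2 c d + k3 * M c d"
  unfolding integral_affine[OF assms(1-3), symmetric]
proof (rule integral_nonneg_AE_Icc)
  show "AE t in lebesgue. t \<in> {c..d} \<longrightarrow> 0 \<le> k + k1 * e1 (w t) + k2 * e2 (w t) + k3 * ind t"
    using proper_AE by eventually_elim (use nn assms in auto)
qed (rule abs_int_sub[OF abs_int_affine assms(1,3)])

text \<open>
  The rising sun principle for \<open>e1 w - e1 r\<close>. On a balanced interval the \<open>p1\<close>-mean of \<open>w\<close> is exactly \<open>r\<close>; here and in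
  the mirror image \<open>stopping_down\<close> the condition defining the weight class enters the upper bound.
\<close>

lemma stopping_up:
  fixes g :: "real \<Rightarrow> real"
  assumes cd: "0 \<le> c" "c < d" "d \<le> 1" and r: "0 < r" and le: "Y1 c d \<le> (d - c) * e1 r"
    and g: "g absolutely_integrable_on {0..1}"
    and stopped: "\<And>a b. c \<le> a \<Longrightarrow> a < b \<Longrightarrow> b \<le> d \<Longrightarrow> Y1 a b = (b - a) * e1 r \<Longrightarrow>
      (b - a) * e2 (r / Q) \<le> Y2 a b \<Longrightarrow> 0 \<le> integral {a..b} g"
    and rest: "\<And>t. proper (w t) \<Longrightarrow> w t \<le> r \<Longrightarrow> 0 \<le> g t"
  shows "0 \<le> integral {c..d} g"
proof (rule rising_sun_principle[OF cd(2), where f = "\<lambda>t. (- e1 r) + 1 * e1 (w t) + 0 * e2 (w t) + 0 * ind t"])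
  let ?f = "\<lambda>t. (- e1 r) + 1 * e1 (w t) + 0 * e2 (w t) + 0 * ind t"
  show "?f absolutely_integrable_on {c..d}" by (rule abs_int_sub[OF abs_int_affine cd(1,3)])
  show "g absolutely_integrable_on {c..d}" by (rule abs_int_sub[OF g cd(1,3)])
  show "integral {c..d} ?f \<le> 0" using cd le by (subst integral_affine) auto
  show "0 \<le> integral {a..b} g" if "c \<le> a" "a < b" "b \<le> d" "integral {a..b} ?f = 0" for a b
  proof -
    have "Y1 a b = (b - a) * e1 r" using that cd by (subst (asm) integral_affine) auto
    moreover then have "(b - a) * e2 (r / Q) \<le> Y2 a b"
      unfolding Y2_def using that cd r by (intro ratio) (auto simp: Y1_def)
    ultimately show ?thesis using that by (intro stopped)
  qed
  show "AE t in lebesgue. t \<in> {c..d} \<longrightarrow> ?f t \<le> 0 \<longrightarrow> 0 \<le> g t"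
    using proper_AE by eventually_elim (use rest proper_e1_le_iff[OF _ r] cd in auto)
qed

lemma stopping_down:
  fixes g :: "real \<Rightarrow> real"
  assumes cd: "0 \<le> c" "c < d" "d \<le> 1" and r: "0 < r" and le: "(d - c) * e1 r \<le> Y1 c d"
    and g: "g absolutely_integrable_on {0..1}"
    and stopped: "\<And>a b. c \<le> a \<Longrightarrow> a < b \<Longrightarrow> b \<le> d \<Longrightarrow> Y1 a b = (b - a) * e1 r \<Longrightarrow>
      (b - a) * e2 (r / Q) \<le> Y2 a b \<Longrightarrow> 0 \<le> integral {a..b} g"
    and rest: "\<And>t. proper (w t) \<Longrightarrow> r \<le> w t \<Longrightarrow> 0 \<le> g t"
  shows "0 \<le> integral {c..d} g"
proof (rule rising_sun_principle[OF cd(2), where f = "\<lambda>t. e1 r + (- 1) * e1 (w t) + 0 * e2 (w t) + 0 * ind t"])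
  let ?f = "\<lambda>t. e1 r + (- 1) * e1 (w t) + 0 * e2 (w t) + 0 * ind t"
  show "?f absolutely_integrable_on {c..d}" by (rule abs_int_sub[OF abs_int_affine cd(1,3)])
  show "g absolutely_integrable_on {c..d}" by (rule abs_int_sub[OF g cd(1,3)])
  show "integral {c..d} ?f \<le> 0" using cd le by (subst integral_affine) auto
  show "0 \<le> integral {a..b} g" if "c \<le> a" "a < b" "b \<le> d" "integral {a..b} ?f = 0" for a b
  proof -
    have "Y1 a b = (b - a) * e1 r" using that cd by (subst (asm) integral_affine) auto
    moreover then have "(b - a) * e2 (r / Q) \<le> Y2 a b"
      unfolding Y2_def using that cd r by (intro ratio) (auto simp: Y1_def)
    ultimately show ?thesis using that by (intro stopped)
  qed
  show "AE t in lebesgue. t \<in> {c..d} \<longrightarrow> ?f t \<le> 0 \<longrightarrow> 0 \<le> g t"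
    using proper_AE by eventually_elim (use rest proper_e1_ge_iff[OF _ r] cd in auto)
qed

lemma M_le_1: "M 0 1 \<le> 1"
  using affine_nonneg[of 0 1 1 0 0 "-1"] by (simp add: ind_def)

text \<open>
  By \<open>E_divide_affine\<close> this is the integral of \<open>E (w t / v)\<close> over \<open>{c..d}\<close>.
\<close>

definition energy :: "real \<Rightarrow> real \<Rightarrow> real \<Rightarrow> real" where
  "energy v c d = (d - c) * (v powr (-p2) * e2 v - v powr (-p1) * e1 v)
     + v powr (-p1) * Y1 c d + (- (v powr (-p2))) * Y2 c d"

text \<open>
  Pointwise: the right-hand integrand is nonnegative, and on the level set it is at least \<open>E (1 / v)\<close> by monotonicity of \<open>E\<close>.
\<close>

lemma energy_bound:
  assumes cd: "0 \<le> c" "c \<le> d" "d \<le> 1" and v: "0 < v" "v \<le> 1"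
  shows "M c d * E (1 / v) \<le> energy v c d"
proof -
  have "0 \<le> (v powr (-p2) * e2 v - v powr (-p1) * e1 v) + v powr (-p1) * e1 (w t)
      + (- (v powr (-p2))) * e2 (w t) + (- E (1/v)) * ind t" if p: "proper (w t)" for t
  proof -
    have "ind t * E (1/v) \<le> E (w t / v)"
    proof (cases "1 \<le> w t")
      case True
      then show ?thesis using v by (auto simp: ind_def divide_right_mono intro!: E_mono)
    next
      case False
      have "proper (w t / v)" using p v by (auto simp: proper_def)
      then show ?thesis using False E_nonneg by (simp add: ind_def)
    qed
    then show ?thesis using E_divide_affine[of "w t" v] proper_nonneg[OF p] v by (simp add: mult.commute)
  qed
  from affine_nonneg[OF cd this] show ?thesis by (simp add: energy_def mult.commute)
qed

text \<open>
  The integrand is \<open>S (max (w t) 1)\<close>. Stopping at the level \<open>gp\<close> is the right choice because the lower curve touches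
  \<open>L_plus\<close> there, so that the integral of \<open>S (w t)\<close> over a stopping interval is nonnegative; and
  \<open>S (max u 1)\<close> exceeds \<open>S u\<close> for \<open>u < 1\<close>.
\<close>

lemma region_II_upper: "Y1 0 1 \<le> e1 gp \<Longrightarrow> 0 \<le> integral {0..1} (\<lambda>t. ind t * (e2 (w t) - A * e1 (w t)))"
proof (rule stopping_up[of 0 1 gp])
  show "(\<lambda>t. ind t * (e2 (w t) - A * e1 (w t))) absolutely_integrable_on {0..1}"
    by (intro abs_ints)
  fix a b :: real assume ab: "0 \<le> a" "a < b" "b \<le> 1" "Y1 a b = (b - a) * e1 gp" "(b - a) * e2 (gp / Q) \<le> Y2 a b"
  have sub: "0 \<le> a" "b \<le> 1" using ab by auto
  have "0 \<le> integral {a..b} (\<lambda>t. ind t * (e2 (w t) - A * e1 (w t)) - (0 + (-A) * e1 (w t) + 1 * e2 (w t) + 0 * ind t))"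
  proof (rule integral_nonneg_AE_Icc)
    show "(\<lambda>t. ind t * (e2 (w t) - A * e1 (w t)) - (0 + (-A) * e1 (w t) + 1 * e2 (w t) + 0 * ind t))
        absolutely_integrable_on {a..b}"
      by (rule abs_int_sub[OF _ sub]) (intro abs_ints)
    show "AE t in lebesgue. t \<in> {a..b} \<longrightarrow> 0 \<le> ind t * (e2 (w t) - A * e1 (w t)) - (0 + (-A) * e1 (w t) + 1 * e2 (w t) + 0 * ind t)"
      using proper_AE
    proof eventually_elim
      case (elim t)
      show ?case using elim ab S_nonpos[of "w t"] by (auto simp: ind_def S_def)
    qed
  qed
  also have "\<dots> = integral {a..b} (\<lambda>t. ind t * (e2 (w t) - A * e1 (w t)))
      - integral {a..b} (\<lambda>t. 0 + (-A) * e1 (w t) + 1 * e2 (w t) + 0 * ind t)"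
    by (intro integral_diff set_lebesgue_integral_eq_integral(1) abs_int_sub[OF _ sub] abs_ints)
  also have "integral {a..b} (\<lambda>t. 0 + (-A) * e1 (w t) + 1 * e2 (w t) + 0 * ind t) = Y2 a b - A * Y1 a b"
    using ab by (subst integral_affine) auto
  finally have "Y2 a b - A * Y1 a b \<le> integral {a..b} (\<lambda>t. ind t * (e2 (w t) - A * e1 (w t)))" by simp
  moreover have "A * Y1 a b \<le> Y2 a b" using ab(4,5) gp_tangent by (simp add: mult.left_commute)
  ultimately show "0 \<le> integral {a..b} (\<lambda>t. ind t * (e2 (w t) - A * e1 (w t)))" by simp
next
  fix t assume t: "proper (w t)" "w t \<le> gp"
  have "gp \<le> 1 / vm" using gm(2) vm by (simp add: gm_eq field_simps)
  then have "1 \<le> w t \<Longrightarrow> 0 \<le> S (w t)" using t by (intro S_nonneg) auto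
  then show "0 \<le> ind t * (e2 (w t) - A * e1 (w t))" by (auto simp: ind_def S_def)
qed (use gp_pos in auto)

text \<open>
  The integrand is \<open>1 + c2 * S (min (w t) 1)\<close> minus the indicator of the level set. On a stopping interval at level \<open>gm\<close>, where
  the lower curve touches \<open>L_minus\<close>, it dominates \<open>b2\<close> times the height over \<open>L_minus\<close> by \<open>chord_identity\<close>. At the other
  points \<open>w\<close> is at least \<open>gm > vm\<close>.
\<close>

lemma region_II_lower: "e1 gm \<le> Y1 0 1 \<Longrightarrow> 0 \<le> integral {0..1} (\<lambda>t. (1 - ind t) * (1 + c2 * (e2 (w t) - A * e1 (w t))))"
proof (rule stopping_down[of 0 1 gm])
  show abs: "(\<lambda>t. (1 - ind t) * (1 + c2 * (e2 (w t) - A * e1 (w t)))) absolutely_integrable_on {0..1}"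
    unfolding left_diff_distrib by (simp only: mult_1) (intro abs_ints)
  fix a b :: real assume ab: "0 \<le> a" "a < b" "b \<le> 1" "Y1 a b = (b - a) * e1 gm" "(b - a) * e2 (gm / Q) \<le> Y2 a b"
  have sub: "0 \<le> a" "b \<le> 1" using ab by auto
  let ?h = "\<lambda>t. 0 + (- b2 * Am) * e1 (w t) + b2 * e2 (w t) + 0 * ind t"
  have "0 \<le> integral {a..b} (\<lambda>t. (1 - ind t) * (1 + c2 * (e2 (w t) - A * e1 (w t))) - ?h t)"
  proof (rule integral_nonneg_AE_Icc)
    show "(\<lambda>t. (1 - ind t) * (1 + c2 * (e2 (w t) - A * e1 (w t))) - ?h t) absolutely_integrable_on {a..b}"
      by (intro abs_int_sub[OF _ sub] set_integral_diff(1) abs abs_int_affine)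
    show "AE t in lebesgue. t \<in> {a..b} \<longrightarrow> 0 \<le> (1 - ind t) * (1 + c2 * (e2 (w t) - A * e1 (w t))) - ?h t"
      using proper_AE
    proof eventually_elim
      case (elim t)
      have "?h t \<le> (1 - ind t) * (1 + c2 * (e2 (w t) - A * e1 (w t)))" if p: "proper (w t)"
      proof (cases "1 \<le> w t")
        case True
        have "S (w t / vm) \<le> 0"
          using True vm p by (intro S_nonpos) (auto simp: proper_def divide_right_mono)
        then have "e2 (w t) - Am * e1 (w t) \<le> 0"
          using S_divide_vm[of "w t"] True vm by (simp add: mult_le_0_iff)
        then have "b2 * (e2 (w t) - Am * e1 (w t)) \<le> 0" using b2_pos by (simp add: mult_le_0_iff)
        then show ?thesis using True by (simp add: ind_def algebra_simps)
      next
        case False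
        have "0 \<le> E (w t / vm) / E (1 / vm)"
          using E_inverse_vm_pos p vm by (intro divide_nonneg_pos E_nonneg) (auto simp: proper_def)
        then show ?thesis using chord_identity[OF proper_nonneg[OF p]] False
          by (simp add: ind_def S_def algebra_simps)
      qed
      then show ?case using elim ab by auto
    qed
  qed
  also have "\<dots> = integral {a..b} (\<lambda>t. (1 - ind t) * (1 + c2 * (e2 (w t) - A * e1 (w t)))) - integral {a..b} ?h"
    by (intro integral_diff set_lebesgue_integral_eq_integral(1) abs_int_sub[OF _ sub] abs abs_int_affine)
  also have "integral {a..b} ?h = b2 * (Y2 a b - Am * Y1 a b)"
    using ab by (subst integral_affine) (auto simp: algebra_simps)
  finally have "b2 * (Y2 a b - Am * Y1 a b) \<le> integral {a..b} (\<lambda>t. (1 - ind t) * (1 + c2 * (e2 (w t) - A * e1 (w t))))"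
    by simp
  moreover have "Am * Y1 a b \<le> Y2 a b" using ab(4,5) gm_tangent by (simp add: mult.left_commute)
  then have "0 \<le> b2 * (Y2 a b - Am * Y1 a b)" using b2_pos by simp
  ultimately show "0 \<le> integral {a..b} (\<lambda>t. (1 - ind t) * (1 + c2 * (e2 (w t) - A * e1 (w t))))" by simp
next
  fix t assume t: "proper (w t)" "gm \<le> w t"
  have "vm \<le> gm" using gp vm by (simp add: gm_eq)
  then have "0 \<le> 1 + c2 * S (w t)" if "w t < 1"
  proof -
    have "S vm \<le> S (w t)" using t that vm \<open>vm \<le> gm\<close> by (intro S_mono) auto
    then have "c2 * S vm \<le> c2 * S (w t)" using c2_pos by (intro mult_left_mono) auto
    then show ?thesis using c2_vm by linarith
  qed
  then show "0 \<le> (1 - ind t) * (1 + c2 * (e2 (w t) - A * e1 (w t)))" by (auto simp: ind_def S_def)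
qed (use gm in auto)

text \<open>
  Because \<open>S 1 = 0\<close>, the two integrands of \<open>region_II_lower\<close> and \<open>region_II_upper\<close> add up, with weights 1 and
  \<open>c2\<close>, to \<open>1 + c2 * S (w t)\<close> minus the indicator.
\<close>

lemma region_II_bound:
  assumes "e1 gm \<le> Y1 0 1" "Y1 0 1 \<le> e1 gp"
  shows "M 0 1 \<le> 1 + c2 * (Y2 0 1 - A * Y1 0 1)"
proof -
  let ?u = "\<lambda>t. ind t * (e2 (w t) - A * e1 (w t))"
  let ?l = "\<lambda>t. (1 - ind t) * (1 + c2 * (e2 (w t) - A * e1 (w t)))"
  have abs: "?u absolutely_integrable_on {0..1}" "?l absolutely_integrable_on {0..1}"
    unfolding left_diff_distrib by (simp_all only: mult_1) (intro abs_ints)+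
  have "0 \<le> integral {0..1} ?l + c2 * integral {0..1} ?u"
    using region_II_upper[OF assms(2)] region_II_lower[OF assms(1)] c2_pos by simp
  also have "\<dots> = integral {0..1} (\<lambda>t. ?l t + c2 * ?u t)"
    using abs by (subst integral_add) (auto intro!: set_lebesgue_integral_eq_integral(1) integrable_on_mult_right simp del: mult_minus_left)
  also have "(\<lambda>t. ?l t + c2 * ?u t) = (\<lambda>t. 1 + (- c2 * A) * e1 (w t) + c2 * e2 (w t) + (-1) * ind t)"
    using ind_cases by (auto simp: fun_eq_iff algebra_simps ind_def)
  also have "integral {0..1} \<dots> = 1 + (- c2 * A) * Y1 0 1 + c2 * Y2 0 1 - M 0 1"
    by (subst integral_affine) auto
  finally show ?thesis by (simp add: algebra_simps)
qed

text \<open>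
  On an interval that is balanced at the level \<open>gp * v\<close>, passing to the smaller parameter \<open>v * l\<close> lowers the normalised
  energy per unit length by at most \<open>\<bar>F l - F 1\<bar>\<close>: this is clear when the average lies on the lower curve, and if it lies
  above, the change is even more favourable, since \<open>1 / kap > p2\<close>.
\<close>

lemma energy_change:
  assumes cd: "0 \<le> c" "c < d" "d \<le> 1" and lam: "0 < l" "l \<le> 1" and v: "0 < v" "v \<le> vm"
    and bal: "Y1 c d = (d - c) * e1 (gp * v)" "(d - c) * e2 (gp * v / Q) \<le> Y2 c d"
  shows "(v / vm) powr (1/kap) * energy v c d - (d - c) * \<bar>F l - F 1\<bar>
    \<le> (v * l / vm) powr (1/kap) * energy (v * l) c d"
proof -
  define h where "h = Y2 c d - (d - c) * e2 (gp * v / Q)"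
  have h: "0 \<le> h" using bal by (simp add: h_def)
  have en: "energy (v * s) c d = (d - c) * (e1 (gp / s) - e2 (gp / Q / s)) - (v * s) powr (-p2) * h"
    if s: "0 < s" for s
  proof -
    have a: "e1 (gp / s) = (v * s) powr (-p1) * (e1 (gp * v) - e1 (v * s))"
      using box_cox_divide[OF p1, of "gp * v" "v * s"] s v gp_pos by simp
    have b: "e2 (gp / Q / s) = (v * s) powr (-p2) * (e2 (gp * v / Q) - e2 (v * s))"
      using box_cox_divide[OF p2, of "gp * v / Q" "v * s"] s v gp_pos Q1 by (simp add: divide_divide_eq_left mult_ac)
    show ?thesis unfolding energy_def a b bal(1) h_def by (simp add: algebra_simps)
  qed
  define q where "q = (v / vm) powr (1/kap)"
  have q: "0 \<le> q" "q \<le> 1" using v vm kap_pos by (auto simp: q_def intro!: powr_le1)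
  have ql: "(v * l / vm) powr (1/kap) = q * l powr (1/kap)"
    using v vm lam powr_mult[of "v/vm" l] by (simp add: q_def mult.commute)
  have "(v * l / vm) powr (1/kap) * energy (v * l) c d
      = q * ((d - c) * F l - l powr (1/kap) * (v * l) powr (-p2) * h)"
    unfolding ql en[OF lam(1)] F_def by (simp add: algebra_simps)
  moreover have "l powr (1/kap) * (v * l) powr (-p2) \<le> v powr (-p2)"
  proof -
    have "0 \<le> 1/kap - p2" using inverse_kap p21 A_less_1 by simp
    then have "l powr (1/kap - p2) \<le> 1" using lam by (intro powr_le1) auto
    moreover have "l powr (1/kap) * (v * l) powr (-p2) = v powr (-p2) * l powr (1/kap - p2)"
      using lam v by (simp add: powr_mult powr_diff powr_minus divide_inverse)
    ultimately show ?thesis by (simp add: mult_left_le)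
  qed
  then have "l powr (1/kap) * (v * l) powr (-p2) * h \<le> v powr (-p2) * h"
    using h by (rule mult_right_mono)
  moreover have "(d - c) * (F 1 - F l) \<le> (d - c) * \<bar>F l - F 1\<bar>"
    using cd by (intro mult_left_mono) auto
  then have "(d - c) * F 1 - (d - c) * \<bar>F l - F 1\<bar> \<le> (d - c) * F l" by (simp add: algebra_simps)
  ultimately have "q * ((d - c) * F 1 - (d - c) * \<bar>F l - F 1\<bar> - v powr (-p2) * h)
      \<le> (v * l / vm) powr (1/kap) * energy (v * l) c d"
    using q by (simp add: mult_left_mono)
  moreover have "q * energy v c d = q * ((d - c) * F 1 - v powr (-p2) * h)"
    using en[of 1] by (simp add: F_def)
  moreover have "q * ((d - c) * \<bar>F l - F 1\<bar>) \<le> 1 * ((d - c) * \<bar>F l - F 1\<bar>)"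
    using q cd by (intro mult_right_mono) auto
  ultimately show ?thesis unfolding q_def[symmetric] by (simp add: algebra_simps)
qed

text \<open>
  The levels \<open>gp * (vm * l ^ k)\<close> decrease from \<open>gm\<close>. For \<open>k = 0\<close> the pointwise bound suffices. In the inductive step the interval is
  stopped at the previous, higher level: the induction hypothesis holds on each stopping interval, and \<open>w < 1\<close> at the
  remaining points, where the energy is nonnegative.
\<close>

lemma region_IV_step:
  assumes lam: "0 < l" "l < 1" and cd: "0 \<le> c" "c < d" "d \<le> 1"
    and le: "Y1 c d \<le> (d - c) * e1 (gp * (vm * l ^ k))"
  shows "M c d * E (1 / vm) \<le> (l ^ k) powr (1/kap) * energy (vm * l ^ k) c d + k * \<bar>F l - F 1\<bar> * (d - c)"
  using cd le
proof (induction k arbitrary: c d)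
  case 0
  then show ?case using energy_bound[of c d vm] vm by simp
next
  case (Suc k)
  define v where "v = vm * l ^ k"
  have v: "0 < v" "v \<le> vm" using vm lam by (auto simp: v_def mult_left_le power_le_one)
  have vl: "vm * l ^ Suc k = v * l" by (simp add: v_def)
  define dl where "dl = \<bar>F l - F 1\<bar>"
  define q where "q = (l ^ Suc k) powr (1/kap)"
  have q0: "0 \<le> q" by (simp add: q_def)
  have q_alt: "q = (v * l / vm) powr (1/kap)" using vm by (simp add: q_def v_def mult.commute)
  define u where "u = v * l"
  have u: "0 < u" using v lam by (simp add: u_def)
  define k0 where "k0 = q * (u powr (-p2) * e2 u - u powr (-p1) * e1 u) + Suc k * dl"
  define g where "g t = k0 + (q * u powr (-p1)) * e1 (w t) + (- (q * u powr (-p2))) * e2 (w t) + (- E (1/vm)) * ind t" for t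
  have int_g: "integral {a..b} g = q * energy u a b + Suc k * dl * (b - a) - M a b * E (1/vm)"
    if "0 \<le> a" "a \<le> b" "b \<le> 1" for a b
    unfolding g_def integral_affine[OF that] by (simp add: energy_def k0_def algebra_simps)
  have "0 \<le> integral {c..d} g"
  proof (rule stopping_up[OF Suc.prems(1-3), of "gp * v"])
    show "0 < gp * v" using gp_pos v by simp
    have "e1 (gp * (v * l)) \<le> e1 (gp * v)"
      using gp_pos v lam by (subst box_cox_le_iff[OF p1]) (auto simp: mult_left_le)
    then have "(d - c) * e1 (gp * (v * l)) \<le> (d - c) * e1 (gp * v)"
      using Suc.prems by (intro mult_left_mono) auto
    then show "Y1 c d \<le> (d - c) * e1 (gp * v)" using Suc.prems(4) unfolding vl by linarith
    show "g absolutely_integrable_on {0..1}" unfolding g_def by (rule abs_int_affine)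
    fix a b assume ab: "c \<le> a" "a < b" "b \<le> d" "Y1 a b = (b - a) * e1 (gp * v)"
      "(b - a) * e2 (gp * v / Q) \<le> Y2 a b"
    have ab': "0 \<le> a" "b \<le> 1" using ab Suc.prems by auto
    have "M a b * E (1/vm) \<le> (v / vm) powr (1/kap) * energy v a b + k * dl * (b - a)"
      using Suc.IH[of a b] ab ab' vm by (simp add: v_def dl_def)
    moreover have "(v / vm) powr (1/kap) * energy v a b - (b - a) * dl \<le> q * energy u a b"
      unfolding q_alt u_def dl_def using energy_change[of a b l v] ab ab' lam v by simp
    ultimately show "0 \<le> integral {a..b} g" using ab ab' by (subst int_g) (auto simp: algebra_simps)
  next
    fix t assume t: "proper (w t)" "w t \<le> gp * v"
    have "gp * v \<le> gm" using v gp_pos by (simp add: gm_eq)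
    then have "ind t = 0" using t gm by (simp add: ind_def)
    moreover have "0 \<le> E (w t / u)" using t u by (intro E_nonneg) (auto simp: proper_def)
    then have "0 \<le> q * E (w t / u)" using q0 by simp
    moreover have "0 \<le> Suc k * dl" by (simp add: dl_def)
    ultimately show "0 \<le> g t"
      using E_divide_affine[of "w t" u] proper_nonneg[OF t(1)] u by (simp add: g_def k0_def algebra_simps)
  qed
  then show ?case using Suc.prems unfolding vl
    by (subst (asm) int_g) (auto simp: q_def dl_def u_def)
qed

text \<open>
  With \<open>n + 1\<close> steps of ratio \<open>rho powr (1 / (n + 1))\<close> the total loss is \<open>n + 1\<close> times \<open>\<bar>F (rho powr (1 / (n + 1))) - F 1\<bar>\<close>,
  which tends to 0 because \<open>F\<close> is critical at 1.
\<close>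

lemma region_IV_bound:
  assumes v: "0 < v" "v \<le> vm" and le: "Y1 0 1 \<le> e1 (gp * v)"
  shows "M 0 1 * E (1 / vm) \<le> (v / vm) powr (1/kap) * energy v 0 1"
proof (cases "v = vm")
  case True
  then show ?thesis using energy_bound[of 0 1 vm] vm by simp
next
  case False
  define rho where "rho = v / vm"
  have rho: "0 < rho" "rho < 1" using v vm False by (auto simp: rho_def)
  define L where "L n = rho powr (1 / real (Suc n))" for n
  have L: "0 < L n" "L n < 1" "L n ^ Suc n = rho" for n
    using rho by (auto simp: L_def powr01_less_one powr_power simp del: power_Suc)
  have bound: "M 0 1 * E (1 / vm) \<le> rho powr (1/kap) * energy v 0 1 + Suc n * \<bar>F (L n) - F 1\<bar>" for n
    using region_IV_step[OF L(1,2), of 0 1 n "Suc n"] le L(3)[of n] v vm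
    by (simp add: rho_def del: power_Suc)
  have "((\<lambda>s. F (rho powr s)) has_real_derivative 0 * ln rho) (at 0)"
  proof (rule DERIV_chain2[where f = F and g = "\<lambda>s. rho powr s"])
    show "(F has_real_derivative 0) (at (rho powr 0))" using F_derivative rho by simp
    show "((\<lambda>s. rho powr s) has_real_derivative ln rho) (at 0)"
      using rho by (auto intro!: derivative_eq_intros)
  qed
  then have "((\<lambda>h. (F (rho powr h) - F 1) / h) \<longlongrightarrow> 0) (at 0)"
    using rho by (simp add: DERIV_def)
  moreover have "filterlim (\<lambda>n. 1 / real (Suc n)) (at 0) sequentially"
    unfolding filterlim_at using LIMSEQ_inverse_real_of_nat by (auto simp: inverse_eq_divide)
  ultimately have "(\<lambda>n. (F (L n) - F 1) / (1 / real (Suc n))) \<longlonglongrightarrow> 0"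
    unfolding L_def by (rule filterlim_compose)
  then have "(\<lambda>n. \<bar>(F (L n) - F 1) / (1 / real (Suc n))\<bar>) \<longlonglongrightarrow> 0"
    by (rule tendsto_rabs_zero)
  then have "(\<lambda>n. rho powr (1/kap) * energy v 0 1 + Suc n * \<bar>F (L n) - F 1\<bar>) \<longlonglongrightarrow> rho powr (1/kap) * energy v 0 1 + 0"
    by (intro tendsto_add tendsto_const) (simp add: abs_mult mult.commute)
  from LIMSEQ_le_const[OF this, of "M 0 1 * E (1 / vm)"] bound show ?thesis
    by (auto simp: rho_def)
qed

end

section \<open>The explicit function in Box--Cox coordinates\<close>

lemma avg_Icc:
  assumes "a < b" "f absolutely_integrable_on {a..b}"
  shows "avg {a..b} f = integral {a..b} f / (b - a)"
  using assms set_lebesgue_integral_eq_integral(2)[OF assms(2)] by (simp add: avg_def)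

context bellman_parameters
begin

lemma measurable_level_set:
  assumes "w \<in> borel_measurable (lebesgue_on {0..1})"
  shows "{t \<in> {0..1::real}. (l::real) \<le> w t} \<in> sets lebesgue"
proof -
  have "{t \<in> space (lebesgue_on {0..1}). l \<le> w t} \<in> sets (lebesgue_on {0..1})"
    using assms by measurable
  then show ?thesis by (simp add: sets_restrict_space_iff space_restrict_space)
qed

lemma integral_box_cox:
  assumes "p \<noteq> 0" "a \<le> b" "(\<lambda>t. w t powr p) absolutely_integrable_on {a..b}"
  shows "integral {a..b} (\<lambda>t. box_cox p (w t)) = (integral {a..b} (\<lambda>t. w t powr p) - (b - a)) / p"
    and "(\<lambda>t. box_cox p (w t)) absolutely_integrable_on {a..b}"
proof -
  have "((\<lambda>t. w t powr p) has_integral integral {a..b} (\<lambda>t. w t powr p)) {a..b}"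
    using set_lebesgue_integral_eq_integral(1)[OF assms(3)] by (rule integrable_integral)
  moreover have "((\<lambda>t. 1::real) has_integral (b - a)) {a..b}"
    using has_integral_const_real[of "1::real" a b] assms by simp
  ultimately show "integral {a..b} (\<lambda>t. box_cox p (w t)) = (integral {a..b} (\<lambda>t. w t powr p) - (b - a)) / p"
    unfolding box_cox_def by (intro integral_unique has_integral_divide has_integral_diff)
  show "(\<lambda>t. box_cox p (w t)) absolutely_integrable_on {a..b}"
    unfolding box_cox_def
    by (intro set_integrable_divide set_integral_diff(1) assms) (simp add: absolutely_integrable_on_const)
qed

lemma avg_powr:
  assumes "p \<noteq> 0" "a < b" "(\<lambda>t. w t powr p) absolutely_integrable_on {a..b}"
  shows "avg {a..b} (\<lambda>t. w t powr p) = 1 + p * (integral {a..b} (\<lambda>t. box_cox p (w t)) / (b - a))"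
  using assms by (simp add: avg_Icc integral_box_cox(1) field_simps)

lemma weight_class_imp_bellman_weight:
  assumes "w \<in> weight_class p1 p2 Q"
  shows "bellman_weight p1 p2 Q w"
proof -
  from assms have meas: "w \<in> borel_measurable (lebesgue_on {0..1})"
    and nn: "\<And>t. t \<in> {0..1} \<Longrightarrow> 0 \<le> w t"
    and pos: "p1 < 0 \<or> p2 < 0 \<Longrightarrow> AE t in lebesgue_on {0..1}. 0 < w t"
    and i1: "set_integrable lebesgue {0..1} (\<lambda>t. w t powr p1)"
    and i2: "set_integrable lebesgue {0..1} (\<lambda>t. w t powr p2)"
    and rat: "\<And>a b. 0 \<le> a \<Longrightarrow> a < b \<Longrightarrow> b \<le> 1 \<Longrightarrow>
        avg {a..b} (\<lambda>t. w t powr p1) powr (1 / p1) \<le> Q * avg {a..b} (\<lambda>t. w t powr p2) powr (1 / p2)"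
    unfolding weight_class_def by auto
  show ?thesis
  proof
    show "(\<lambda>t. e1 (w t)) absolutely_integrable_on {0..1}" "(\<lambda>t. e2 (w t)) absolutely_integrable_on {0..1}"
      using integral_box_cox(2)[OF p1 _ i1] integral_box_cox(2)[OF p2 _ i2] by simp_all
    show "{t \<in> {0..1}. 1 \<le> w t} \<in> sets lebesgue" using meas by (rule measurable_level_set)
    show "AE t in lebesgue. t \<in> {0..1} \<longrightarrow> proper (w t)"
    proof (cases "p2 < 0")
      case True
      then have "AE t in lebesgue_on {0..1}. 0 < w t" using pos by simp
      then have "AE t in lebesgue. t \<in> {0..1} \<longrightarrow> 0 < w t"
        by (subst (asm) AE_restrict_space_iff) auto
      then show ?thesis by eventually_elim (auto simp: proper_def)
    next
      case False
      then have "0 < p2" using p2 by simp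
      then show ?thesis using nn by (intro AE_I2) (fastforce simp: proper_def)
    qed
    fix c d r :: real
    assume cd: "0 \<le> c" "c < d" "d \<le> 1" and r: "0 < r"
      and Y: "integral {c..d} (\<lambda>t. e1 (w t)) = (d - c) * e1 r"
    have j1: "(\<lambda>t. w t powr p1) absolutely_integrable_on {c..d}" 
      and j2: "(\<lambda>t. w t powr p2) absolutely_integrable_on {c..d}"
      using cd by (auto intro: set_integrable_subset[OF i1] set_integrable_subset[OF i2])
    define a2 where "a2 = avg {c..d} (\<lambda>t. w t powr p2)"
    have "avg {c..d} (\<lambda>t. w t powr p1) = r powr p1"
      using avg_powr[OF p1 cd(2) j1] Y cd powr_eq_box_cox[OF p1, of r] by simp
    then have "r \<le> Q * a2 powr (1 / p2)" using rat[OF cd] p1 r by (simp add: powr_powr a2_def)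
    then have rQ: "r / Q \<le> a2 powr (1 / p2)" using Q1 by (simp add: field_simps)
    then have "0 < a2 powr (1 / p2)" using r Q1 by (meson divide_pos_pos less_le_trans less_trans zero_less_one)
    then have "a2 \<noteq> 0" by auto
    moreover have "0 \<le> a2" unfolding a2_def avg_Icc[OF cd(2) j2] using cd
      by (intro divide_nonneg_nonneg integral_nonneg set_lebesgue_integral_eq_integral(1)[OF j2]) auto
    ultimately have a2: "0 < a2" by simp
    have "e2 (r / Q) \<le> e2 (a2 powr (1 / p2))" using rQ r Q1 a2 p2 by (subst box_cox_le_iff) auto
    also have "\<dots> = (a2 - 1) / p2" using a2 p2 by (rule box_cox_powr_inverse[rotated])
    also have "\<dots> = integral {c..d} (\<lambda>t. e2 (w t)) / (d - c)"
      unfolding a2_def avg_powr[OF p2 cd(2) j2] using p2 by simp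
    finally show "(d - c) * e2 (r / Q) \<le> integral {c..d} (\<lambda>t. e2 (w t))"
      using cd by (simp add: field_simps)
  qed
qed

definition xi1 :: "real \<Rightarrow> real" where "xi1 x = (x - 1) / p1"
definition xi2 :: "real \<Rightarrow> real" where "xi2 x = (x - 1) / p2"

lemma x_eq_xi: "x = 1 + p1 * xi1 x" "x = 1 + p2 * xi2 x"
  using p1 p2 by (simp_all add: xi1_def xi2_def)

text \<open>
  The \<open>p1\<close>-mean: the common parameter of the points of the two curves that have the abscissa of \<open>x\<close>.
\<close>

definition rad :: "real \<Rightarrow> real" where "rad x1 = x1 powr (1 / p1)"

lemma xi1_rad: "0 < x1 \<Longrightarrow> xi1 x1 = e1 (rad x1)"
  using p1 by (simp add: xi1_def rad_def box_cox_powr_inverse)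

lemma rad_pos: "0 < x1 \<Longrightarrow> 0 < rad x1" by (simp add: rad_def)

lemma Omega_iff: "(x1, x2) \<in> Omega p1 p2 Q \<longleftrightarrow>
  0 < x1 \<and> 0 < x2 \<and> xi2 x2 \<le> e2 (rad x1) \<and> e2 (rad x1 / Q) \<le> xi2 x2"
proof -
  have "xi2 x2 = e2 (x2 powr (1 / p2))" if "0 < x2"
    using that p2 by (simp add: xi2_def box_cox_powr_inverse)
  moreover have "rad x1 \<le> Q * x2 powr (1 / p2) \<longleftrightarrow> rad x1 / Q \<le> x2 powr (1 / p2)"
    using Q1 by (simp add: field_simps)
  ultimately show ?thesis
    unfolding Omega_def using p2 Q1 by (auto simp: box_cox_le_iff rad_def)
qed

lemma scaled_le_iff: "p \<noteq> 0 \<Longrightarrow> p * a \<le> p * b \<longleftrightarrow> (a - 1) / p \<le> (b - 1) / p" for a b p :: real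
  by (cases "0 < p") (auto simp: divide_le_cancel)

lemma abscissa_le_iff: "p1 * g powr p1 \<le> p1 * x1 \<longleftrightarrow> e1 g \<le> xi1 x1"
    "p1 * x1 \<le> p1 * g powr p1 \<longleftrightarrow> xi1 x1 \<le> e1 g"
  unfolding scaled_le_iff[OF p1] by (simp_all add: xi1_def box_cox_def)

text \<open>
  The factor \<open>p2\<close> in the definitions of the subdomains serves to produce this square, so that in the new coordinates
  each subdomain is described by the same inequalities for all signs.
\<close>

lemma line_sign: "p2 * (x2 - (a * (p2 / p1) * (x1 - 1) + 1)) = p2\<^sup>2 * (xi2 x2 - a * xi1 x1)"
  using p1 p2 by (simp add: xi1_def xi2_def field_simps power2_eq_square)

lemma L_plus_sign: "p2 * (x2 - L_plus p1 p2 Q x1) = p2\<^sup>2 * (xi2 x2 - A * xi1 x1)"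
proof -
  have "L_plus p1 p2 Q x1 = A * (p2 / p1) * (x1 - 1) + 1"
    by (simp add: L_plus_def A_const_def)
  then show ?thesis by (simp only: line_sign)
qed

lemma L_minus_sign: "p2 * (x2 - L_minus p1 p2 Q x1) = p2\<^sup>2 * (xi2 x2 - Am * xi1 x1)"
proof -
  have "L_minus p1 p2 Q x1 = Am * (p2 / p1) * (x1 - 1) + 1"
    by (simp add: L_minus_def Am_eq)
  then show ?thesis by (simp only: line_sign)
qed

lemma Omega_I_iff: "(x1, x2) \<in> Omega_I p1 p2 Q \<longleftrightarrow>
    (x1, x2) \<in> Omega p1 p2 Q \<and> (A * xi1 x1 \<le> xi2 x2 \<or> e1 gp \<le> xi1 x1)"
  using p2 by (auto simp: Omega_I_def L_plus_sign abscissa_le_iff zero_le_mult_iff)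

lemma Omega_II_iff: "(x1, x2) \<in> Omega_II p1 p2 Q \<longleftrightarrow>
    (x1, x2) \<in> Omega p1 p2 Q \<and> xi2 x2 \<le> A * xi1 x1 \<and> xi2 x2 \<le> Am * xi1 x1 \<and>
    e1 gm \<le> xi1 x1 \<and> xi1 x1 \<le> e1 gp"
  using p2 by (auto simp: Omega_II_def L_plus_sign L_minus_sign abscissa_le_iff mult_le_0_iff)

lemma Omega_III_iff: "(x1, x2) \<in> Omega_III p1 p2 Q \<longleftrightarrow>
    (x1, x2) \<in> Omega p1 p2 Q \<and> Am * xi1 x1 \<le> xi2 x2 \<and> (x1, x2) \<noteq> (1, 1)"
  using p2 by (auto simp: Omega_III_def L_minus_sign zero_le_mult_iff)

lemma Omega_IV_iff: "(x1, x2) \<in> Omega_IV p1 p2 Q \<longleftrightarrow>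
    (x1, x2) \<in> Omega p1 p2 Q \<and> xi2 x2 \<le> Am * xi1 x1 \<and> xi1 x1 \<le> e1 gm"
  using p2 by (auto simp: Omega_IV_def L_minus_sign abscissa_le_iff mult_le_0_iff)

lemma B_II_eq: "B_II p1 p2 Q (x1, x2) = 1 + c2 * (xi2 x2 - A * xi1 x1)"
proof -
  define a b where "a = vm powr p1" and "b = vm powr p2"
  have a: "a \<noteq> 1" "0 < a" and b: "b \<noteq> 1" "0 < b"
    using box_cox_neg[OF p1 vm] box_cox_neg[OF p2 vm] vm by (auto simp: a_def b_def box_cox_def)
  have ab: "A * b = Am * a"
    by (simp add: Am_def a_def b_def powr_add[symmetric])
  have "(b - 1) / p2 = Am * ((a - 1) / p1)" using vm_on_line by (simp add: box_cox_def a_def b_def)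
  then have Am: "Am = (b - 1) / p2 * p1 / (a - 1)" using a p1 by simp
  have AA: "A = Am * a / b" using ab b by (simp add: field_simps)
  have "S vm = (b - 1) / p2 - A * ((a - 1) / p1)" by (simp add: S_def box_cox_def a_def b_def)
  also have "\<dots> = (b - 1) / p2 * ((b - a) / b)"
    unfolding AA Am using a b p1 p2 by (simp add: field_simps)
  finally have Svm: "S vm = (b - 1) / p2 * ((b - a) / b)" .
  then have ab': "a \<noteq> b" using S_vm by auto
  define a1 b1 d where "a1 = a - 1" and "b1 = b - 1" and "d = a - b"
  have nz: "a1 \<noteq> 0" "b1 \<noteq> 0" "d \<noteq> 0" using a b ab' by (auto simp: a1_def b1_def d_def)
  have S': "S vm = - (b1 * d / (p2 * b))" unfolding Svm b1_def d_def using b p2 by (simp add: field_simps)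
  have c: "c2 = p2 * b / (b1 * d)" unfolding c2_def S' using nz b p2 by (simp add: field_simps)
  have A': "A = b1 * p1 * a / (p2 * a1 * b)" unfolding AA Am a1_def[symmetric] b1_def[symmetric] by simp
  have "a * b1 - b * a1 = - d" by (simp add: a1_def b1_def d_def algebra_simps)
  moreover have "a / (a1 * d) - b / (b1 * d) = (a * b1 - b * a1) / (a1 * b1 * d)"
    using nz by (simp add: field_simps)
  ultimately have const: "a / (a1 * d) - b / (b1 * d) = - 1 / (a1 * b1)" using nz by simp
  have "1 + c2 * (xi2 x2 - A * xi1 x1) = 1 + b / (b1 * d) * (x2 - 1) - a / (a1 * d) * (x1 - 1)"
    unfolding c A' xi1_def xi2_def using nz b p1 p2 by (simp add: field_simps)
  also have "\<dots> = - (a / (a1 * d)) * x1 + b / (b1 * d) * x2 + 1 + (a / (a1 * d) - b / (b1 * d))"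
    by (simp add: algebra_simps diff_divide_distrib)
  also have "\<dots> = a / ((1 - a) * (a - b)) * x1 + b / ((b - 1) * (a - b)) * x2 + 1 - 1 / ((a - 1) * (b - 1))"
  proof -
    have "- (a / (a1 * d)) = a / ((1 - a) * (a - b))"
      using nz by (simp add: a1_def d_def minus_divide_right algebra_simps del: minus_divide_right[symmetric])
    then show ?thesis unfolding const by (simp add: a1_def b1_def d_def)
  qed
  finally show ?thesis by (simp add: B_II_def Let_def a_def b_def)
qed

text \<open>
  The average of \<open>E (w / v)\<close> for a weight with the averages of \<open>e1\<close> and \<open>e2\<close> equal to \<open>y1\<close> and \<open>y2\<close>.
\<close>

definition en :: "real \<Rightarrow> real \<Rightarrow> real \<Rightarrow> real" where
  "en v y1 y2 = E (1 / v) + v powr (-p1) * y1 - v powr (-p2) * y2"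

lemma en_eq: "0 < v \<Longrightarrow> en v y1 y2 = v powr (-p1) * (y1 - e1 v) - v powr (-p2) * (y2 - e2 v)"
  using E_divide[of 1 v] by (simp add: en_def algebra_simps)

text \<open>
  The defining equation says that the points with parameters \<open>v\<close> and 1 of the upper curve are collinear with \<open>x\<close>, on
  a line of slope \<open>k\<close>. In region III one has \<open>1 < k \<le> Am\<close>, and unimodality gives exactly one second intersection; it lies
  between \<open>vm\<close> and the maximum \<open>u0\<close> of \<open>e2 u - k * e1 u\<close>.
\<close>

lemma v_III_props:
  assumes "(x1, x2) \<in> Omega p1 p2 Q" "Am * xi1 x1 \<le> xi2 x2" "(x1, x2) \<noteq> (1, 1)"
  defines "v \<equiv> v_III p1 p2 (x1, x2)"
  shows "vm \<le> v" "v < 1" "e2 v * xi1 x1 = e1 v * xi2 x2" "xi1 x1 < 0" "e1 v \<le> xi1 x1"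
proof -
  have x: "0 < x1" "0 < x2" "xi2 x2 \<le> e2 (rad x1)" using assms(1) by (auto simp: Omega_iff)
  have neq: "xi1 x1 \<noteq> 0"
  proof
    assume z: "xi1 x1 = 0"
    then have "x1 = 1" using p1 by (simp add: xi1_def)
    then have "xi2 x2 = 0" using x z assms(2) by (simp add: rad_def)
    then show False using assms(3) \<open>x1 = 1\<close> p2 by (simp add: xi2_def)
  qed
  then have "rad x1 \<noteq> 1" using xi1_rad[OF x(1)] by auto
  then have "0 < E (rad x1)" using rad_pos[OF x(1)] by (intro E_pos)
  then have less: "xi2 x2 < xi1 x1" using x xi1_rad[OF x(1)] by (simp add: E_def)
  show neg: "xi1 x1 < 0"
  proof (rule ccontr)
    assume "\<not> xi1 x1 < 0"
    then have "1 * xi1 x1 \<le> Am * xi1 x1" using Am_gt_1 by (intro mult_right_mono) auto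
    then show False using less assms(2) by simp
  qed
  define k where "k = xi2 x2 / xi1 x1"
  have k: "1 < k" "k \<le> Am" "xi2 x2 = k * xi1 x1"
    using neg less assms(2) by (auto simp: k_def divide_simps)
  have eq_iff: "u powr p2 * (1 - x1) - u powr p1 * (1 - x2) = x2 - x1 \<longleftrightarrow> e2 u - k * e1 u = 0" for u
  proof -
    have "u powr p2 * (1 - x1) - u powr p1 * (1 - x2) - (x2 - x1)
        = p1 * p2 * (e1 u * xi2 x2 - e2 u * xi1 x1)"
      using p1 p2 by (simp add: box_cox_def xi1_def xi2_def field_simps)
    also have "\<dots> = - (p1 * p2 * xi1 x1) * (e2 u - k * e1 u)"
      by (simp add: k(3) algebra_simps)
    finally show ?thesis using p1 p2 neq by (metis eq_iff_diff_eq_0 mult_eq_0_iff neg_equal_0_iff_equal)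
  qed
  define u0 where "u0 = k powr (- 1 / (p1 - p2))"
  have ku0: "k * u0 powr (p1 - p2) = 1"
    using k p21 by (simp add: u0_def powr_powr powr_neg_one)
  have u0: "0 < u0" "u0 < 1"
    using k p21 powr_less_mono[of "- 1 / (p1 - p2)" 0 k] by (auto simp: u0_def)
  note inc = box_cox_combination_increasing[OF p1 p2 p21, of _ u0 k]
  note dec = box_cox_combination_decreasing[OF p1 p2 p21, of u0 1 k]
  have top: "0 < e2 u0 - k * e1 u0" using dec u0 k ku0 by simp
  have bot: "e2 vm - k * e1 vm \<le> 0"
  proof -
    have "e2 vm - k * e1 vm = (Am - k) * e1 vm" using vm_on_line by (simp add: algebra_simps)
    then show ?thesis using k box_cox_neg[OF p1 vm] by (simp add: mult_le_0_iff)
  qed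
  have "vm < u0"
  proof (rule ccontr)
    assume "\<not> vm < u0"
    moreover have "u0 \<noteq> vm" using top bot by auto
    ultimately have "u0 < vm" by simp
    then have "k * u0 powr (p1 - p2) < k * vm powr (p1 - p2)"
      using k p21 u0 by (intro mult_strict_left_mono powr_less_mono2) auto
    then have "1 < k * vm powr (p1 - p2)" using ku0 by simp
    then show False using box_cox_combination_decreasing[OF p1 p2 p21, of vm 1 k] vm k bot by simp
  qed
  have "\<exists>u\<ge>vm. u \<le> u0 \<and> e2 u - k * e1 u = 0"
  proof (rule IVT')
    show "continuous_on {vm..u0} (\<lambda>u. e2 u - k * e1 u)"
      using vm p1 p2 by (auto intro!: continuous_at_imp_continuous_on continuous_intros isCont_box_cox)
  qed (use top bot \<open>vm < u0\<close> in auto)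
  then obtain u where u: "vm \<le> u" "u \<le> u0" "e2 u - k * e1 u = 0" by blast
  have u1: "0 < u" "u < 1" using u vm u0 by auto
  have "v = u" unfolding v_def v_III_def prod.case
  proof (rule the_equality)
    show "0 < u \<and> u \<noteq> 1 \<and> u powr p2 * (1 - x1) - u powr p1 * (1 - x2) = x2 - x1"
      using u u1 by (simp add: eq_iff)
    fix z assume "0 < z \<and> z \<noteq> 1 \<and> z powr p2 * (1 - x1) - z powr p1 * (1 - x2) = x2 - x1"
    then have z: "0 < z" "z \<noteq> 1" "e2 z - k * e1 z = 0" by (auto simp: eq_iff)
    show "z = u"
      using box_cox_combination_two_points[OF p1 p2 p21, of k u 1 0 z] u u1 z k by force
  qed
  then show "vm \<le> v" "v < 1" "e2 v * xi1 x1 = e1 v * xi2 x2" using u u1 by (auto simp: k(3))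
  have "0 \<le> e2 (rad x1) - k * e1 (rad x1)" using x k(3) xi1_rad[OF x(1)] by simp
  then have "\<not> rad x1 < u"
    using box_cox_combination_two_points(2)[OF p1 p2 p21, of k u 1 0 "rad x1"] u u1 k rad_pos[OF x(1)] by force
  then show "e1 v \<le> xi1 x1"
    using \<open>v = u\<close> u1 rad_pos[OF x(1)] p1 by (simp add: xi1_rad[OF x(1)] box_cox_le_iff)
qed

lemma B_III_eq:
  assumes "0 < v" "v < 1" "v = v_III p1 p2 (x1, x2)"
  shows "B_III p1 p2 (x1, x2) = 1 - xi1 x1 / e1 v"
proof -
  have "v powr p1 \<noteq> 1" using box_cox_neg[OF p1 assms(1,2)] by (auto simp: box_cox_def)
  then show ?thesis using p1 unfolding B_III_def prod.case assms(3)[symmetric] Let_def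
    by (simp add: xi1_def box_cox_def field_simps)
qed

lemma chord_energy:
  assumes "0 < v" "v < 1" "e2 v * y1 = e1 v * y2"
  shows "en v y1 y2 = (1 - y1 / e1 v) * E (1 / v)"
proof -
  have e: "e1 v < 0" using box_cox_neg[OF p1 assms(1,2)] .
  define s where "s = y1 / e1 v"
  have y2: "y2 = s * e2 v" using assms(3) e by (simp add: s_def field_simps)
  have y1: "y1 = s * e1 v" using e by (simp add: s_def)
  have "v powr (-p1) * y1 - v powr (-p2) * y2 = s * (v powr (-p1) * e1 v - v powr (-p2) * e2 v)"
    by (subst y1, subst y2) (simp add: algebra_simps)
  also have "v powr (-p1) * e1 v - v powr (-p2) * e2 v = - E (1 / v)"
    using E_divide[of 1 v] assms by simp
  finally have "en v y1 y2 = E (1 / v) - s * E (1 / v)" by (simp add: en_def)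
  then show ?thesis by (simp add: s_def algebra_simps)
qed

text \<open>
  As \<open>v\<close> grows from \<open>rad x1 / gp\<close> to \<open>rad x1\<close>, the tangents sweep the vertical segment between the two curves at the abscissa of \<open>x\<close>,
  strictly monotonically by \<open>tangent_strict_mono\<close>. The same \<open>v\<close> is used for the extremal weights of region I.
\<close>

lemma v_IV_props:
  assumes "(x1, x2) \<in> Omega p1 p2 Q"
  defines "v \<equiv> v_IV p1 p2 Q (x1, x2)"
  shows "0 < v" "xi2 x2 = tangent v (xi1 x1)" "v \<le> rad x1" "rad x1 \<le> gp * v"
proof -
  define r where "r = rad x1"
  have x: "0 < x1" "0 < x2" "xi2 x2 \<le> e2 r" "e2 (r / Q) \<le> xi2 x2"
    using assms(1) by (auto simp: Omega_iff r_def)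
  have r: "0 < r" "xi1 x1 = e1 r" using rad_pos xi1_rad x by (auto simp: r_def)
  have eq_iff: "x2 = p2 / p1 * A * u powr (p2 - p1) * (x1 - u powr p1) + u powr p2 \<longleftrightarrow> xi2 x2 = tangent u (e1 r)" for u
  proof -
    have "x2 - (p2 / p1 * A * u powr (p2 - p1) * (x1 - u powr p1) + u powr p2) = p2 * (xi2 x2 - tangent u (xi1 x1))"
      using p1 p2 by (simp add: tangent_def xi1_def xi2_def box_cox_def field_simps)
    then show ?thesis using p2 r by (metis eq_iff_diff_eq_0 mult_eq_0_iff)
  qed
  have "\<exists>u\<ge>r / gp. u \<le> r \<and> tangent u (e1 r) = xi2 x2"
  proof (rule IVT')
    have "tangent (r / gp) (e1 r) = e2 (r / Q)" using tangent_touches[of "r / gp"] r gp_pos by simp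
    then show "tangent (r / gp) (e1 r) \<le> xi2 x2" using x by simp
    show "xi2 x2 \<le> tangent r (e1 r)" using x by (simp add: tangent_def)
    show "r / gp \<le> r" using r gp by (simp add: field_simps)
    have "0 < u" if "u \<in> {r / gp..r}" for u
      using that r gp_pos less_le_trans[of 0 "r / gp" u] by auto
    then show "continuous_on {r / gp..r} (\<lambda>u. tangent u (e1 r))"
      unfolding tangent_def using p1 p2
      by (intro continuous_at_imp_continuous_on ballI continuous_intros isCont_box_cox) force+
  qed
  then obtain u where u: "r / gp \<le> u" "u \<le> r" "tangent u (e1 r) = xi2 x2" by blast
  have u0: "0 < u" using u r gp_pos by (meson divide_pos_pos less_le_trans)
  have ru: "r \<le> gp * u" using u gp_pos by (simp add: field_simps)
  have "v = u" unfolding v_def v_IV_def prod.case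
  proof (rule the_equality)
    show "0 < u \<and> x2 = p2 / p1 * A * u powr (p2 - p1) * (x1 - u powr p1) + u powr p2 \<and>
      p1 * u powr p1 \<le> p1 * x1 \<and> p1 * x1 \<le> p1 * (gp * u) powr p1"
      unfolding eq_iff abscissa_le_iff using u u0 r ru p1 gp_pos by (simp add: box_cox_le_iff)
    fix z assume "0 < z \<and> x2 = p2 / p1 * A * z powr (p2 - p1) * (x1 - z powr p1) + z powr p2 \<and>
      p1 * z powr p1 \<le> p1 * x1 \<and> p1 * x1 \<le> p1 * (gp * z) powr p1"
    then have z: "0 < z" "xi2 x2 = tangent z (e1 r)" "r \<le> gp * z"
      unfolding eq_iff abscissa_le_iff using r p1 gp_pos by (auto simp: box_cox_le_iff)
    show "z = u"
    proof (cases z u rule: linorder_cases)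
      case less
      then show ?thesis using tangent_strict_mono[OF z(1) less r(1) z(3)] z(2) u(3) by linarith
    next
      case greater
      then show ?thesis using tangent_strict_mono[OF u0 greater r(1) ru] z(2) u(3) by linarith
    qed
  qed
  then show "0 < v" "xi2 x2 = tangent v (xi1 x1)" "v \<le> rad x1" "rad x1 \<le> gp * v"
    using u u0 ru r by (auto simp: r_def[symmetric])
qed

lemma v_IV_le_vm:
  assumes "(x1, x2) \<in> Omega p1 p2 Q" "xi2 x2 \<le> Am * xi1 x1" "xi1 x1 \<le> e1 gm"
  shows "v_IV p1 p2 Q (x1, x2) \<le> vm"
proof (rule ccontr)
  note v = v_IV_props[OF assms(1)]
  assume "\<not> v_IV p1 p2 Q (x1, x2) \<le> vm"
  moreover have x: "0 < x1" using assms(1) by (auto simp: Omega_iff)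
  moreover have "rad x1 \<le> gp * vm"
    using assms(3) xi1_rad[OF x] rad_pos[OF x] gm p1 by (simp add: box_cox_le_iff gm_eq[symmetric])
  ultimately have "tangent vm (xi1 x1) < tangent (v_IV p1 p2 Q (x1, x2)) (xi1 x1)"
    unfolding xi1_rad[OF x] using vm rad_pos[OF x] by (intro tangent_strict_mono) auto
  then show False using v(2) assms(2) by (simp add: tangent_vm)
qed

text \<open>
  The bracket in the definition is a positive multiple of \<open>en v\<close> up to the sign of \<open>p1\<close>; the powers of \<open>v\<close> combine by
  \<open>inverse_kap\<close>, and the normalising constant is \<open>E (1 / vm)\<close> by \<open>E_inverse_vm\<close>.
\<close>

lemma B_IV_eq:
  assumes v: "v = v_IV p1 p2 Q (x1, x2)" "0 < v"
  shows "B_IV p1 p2 Q (x1, x2) = (v / vm) powr (1/kap) * en v (xi1 x1) (xi2 x2) / E (1 / vm)"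
proof -
  have br: "(p1 - p2) / p2 * v powr p2 + x1 * v powr (p2 - p1) - p1 / p2 * x2
      = p1 * v powr p2 * en v (xi1 x1) (xi2 x2)"
  proof -
    have 1: "v powr p2 * v powr (-p1) = v powr (p2 - p1)" "v powr p2 * v powr (-p2) = 1"
      "v powr (p2 - p1) * v powr p1 = v powr p2"
      using v by (simp_all add: powr_add[symmetric])
    have "v powr p2 * en v (xi1 x1) (xi2 x2) = v powr (p2 - p1) * (xi1 x1 - e1 v) - (xi2 x2 - e2 v)"
      unfolding en_eq[OF v(2)] right_diff_distrib[of "v powr p2"] mult.assoc[symmetric] 1 by simp
    also have "\<dots> = (v powr (p2 - p1) * x1 - v powr (p2 - p1) * v powr p1) / p1 - (x2 - v powr p2) / p2"
      using p1 p2 by (simp add: xi1_def xi2_def box_cox_def field_simps)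
    finally have "p1 * v powr p2 * en v (xi1 x1) (xi2 x2)
        = p1 * ((v powr (p2 - p1) * x1 - v powr p2) / p1 - (x2 - v powr p2) / p2)"
      by (simp add: 1 mult.assoc)
    also have "\<dots> = (p1 - p2) / p2 * v powr p2 + x1 * v powr (p2 - p1) - p1 / p2 * x2"
      using p1 p2 by (simp add: field_simps)
    finally show ?thesis by simp
  qed
  have vv: "v powr ((p1 - p2) / (1 - A)) * v powr p2 = v powr (1/kap)"
    by (simp add: inverse_kap powr_add[symmetric])
  have ex: "vm powr (- ((p1 - p2) * A / (1 - A))) = vm powr p1 / vm powr (1/kap)"
  proof -
    have "- ((p1 - p2) * A / (1 - A)) = p1 - 1/kap"
      unfolding inverse_kap using A_less_1 by (simp add: field_simps)
    then show ?thesis by (simp add: powr_diff)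
  qed
  have a: "vm powr p1 \<noteq> 1" using box_cox_neg[OF p1 vm] by (auto simp: box_cox_def)
  have E: "E (1 / vm) = (1 - A) * (1 - vm powr p1) / (vm powr p1 * p1)"
    unfolding E_inverse_vm using vm p1 by (simp add: box_cox_def powr_divide field_simps)
  have "B_IV p1 p2 Q (x1, x2) = 1 / (1 - A) * (vm powr p1 / vm powr (1/kap) / (1 - vm powr p1))
      * p1 * (v powr ((p1 - p2) / (1 - A)) * v powr p2) * en v (xi1 x1) (xi2 x2)"
    unfolding B_IV_def prod.case Let_def v(1)[symmetric] br ex by (simp add: mult_ac)
  also have "\<dots> = (v powr (1/kap) / vm powr (1/kap)) * en v (xi1 x1) (xi2 x2) / E (1 / vm)"
    unfolding vv E using a A_less_1 vm p1 by (simp add: field_simps)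
  also have "v powr (1/kap) / vm powr (1/kap) = (v / vm) powr (1/kap)"
    using v vm by (simp add: powr_divide)
  finally show ?thesis .
qed

lemma B_fun_cases [consumes 1, case_names I II III IV]:
  assumes "(x1, x2) \<in> Omega p1 p2 Q"
  obtains "A * xi1 x1 \<le> xi2 x2 \<or> e1 gp \<le> xi1 x1" "B_fun p1 p2 Q (x1, x2) = 1"
  | "xi2 x2 < A * xi1 x1" "xi2 x2 \<le> Am * xi1 x1" "e1 gm \<le> xi1 x1" "xi1 x1 < e1 gp"
    "B_fun p1 p2 Q (x1, x2) = 1 + c2 * (xi2 x2 - A * xi1 x1)"
  | v where "vm \<le> v" "v < 1" "e2 v * xi1 x1 = e1 v * xi2 x2" "xi1 x1 < 0" "e1 v \<le> xi1 x1"
    "B_fun p1 p2 Q (x1, x2) = 1 - xi1 x1 / e1 v"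
  | v where "0 < v" "v \<le> vm" "xi2 x2 = tangent v (xi1 x1)" "v \<le> rad x1" "rad x1 \<le> gp * v"
    "B_fun p1 p2 Q (x1, x2) = (v / vm) powr (1/kap) * en v (xi1 x1) (xi2 x2) / E (1 / vm)"
proof -
  have x: "0 < x1" "0 < x2" using assms by (auto simp: Omega_iff)
  consider "(x1, x2) \<in> Omega_I p1 p2 Q" | "(x1, x2) \<notin> Omega_I p1 p2 Q" "(x1, x2) \<in> Omega_II p1 p2 Q"
    | "(x1, x2) \<notin> Omega_I p1 p2 Q" "(x1, x2) \<notin> Omega_II p1 p2 Q" "(x1, x2) \<in> Omega_III p1 p2 Q"
    | "(x1, x2) \<notin> Omega_I p1 p2 Q" "(x1, x2) \<notin> Omega_II p1 p2 Q" "(x1, x2) \<notin> Omega_III p1 p2 Q"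
    by blast
  then show ?thesis
  proof cases
    case 1
    then show ?thesis by (intro that(1)) (auto simp: B_fun_def Omega_I_iff)
  next
    case 2
    then show ?thesis using assms by (intro that(2)) (auto simp: B_fun_def Omega_I_iff Omega_II_iff B_II_eq)
  next
    case 3
    then have r: "Am * xi1 x1 \<le> xi2 x2" "(x1, x2) \<noteq> (1, 1)" by (auto simp: Omega_III_iff)
    note v = v_III_props[OF assms r]
    let ?v = "v_III p1 p2 (x1, x2)"
    show ?thesis using 3 v vm by (intro that(3)[of ?v]) (auto simp: B_fun_def B_III_eq)
  next
    case 4
    have "(x1, x2) \<noteq> (1, 1)" using 4(1) assms by (auto simp: Omega_I_iff xi1_def xi2_def)
    then have lt: "xi2 x2 < Am * xi1 x1" using 4 assms by (auto simp: Omega_III_iff)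
    then have "xi1 x1 < e1 gm" using 4 assms by (auto simp: Omega_I_iff Omega_II_iff)
    then have IV: "(x1, x2) \<in> Omega_IV p1 p2 Q" using lt assms by (auto simp: Omega_IV_iff)
    note v = v_IV_props[OF assms]
    show ?thesis using 4 IV v v_IV_le_vm[OF assms]
      by (intro that(4)[of "v_IV p1 p2 Q (x1, x2)"]) (auto simp: B_fun_def B_IV_eq Omega_IV_iff)
  qed
qed

end

context bellman_weight
begin

lemma M_eq_measure: "M 0 1 = measure lebesgue {t \<in> {0..1}. 1 \<le> w t}"
proof -
  let ?L = "{t \<in> {0..1}. 1 \<le> w t}"
  have "?L \<in> lmeasurable"
    by (rule fmeasurableI2[of "{0..1}"]) (use level_set in auto)
  then have "measure lebesgue ?L = integral ?L (\<lambda>t. 1)" by (rule lmeasure_integral)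
  also have "\<dots> = integral (?L \<inter> {0..1}) (\<lambda>t. 1)"
    by (rule arg_cong[where f = "\<lambda>S. integral S _"]) auto
  also have "\<dots> = integral {0..1} (\<lambda>t. if t \<in> ?L then 1 else 0)"
    by (rule integral_restrict_Int[symmetric])
  also have "\<dots> = M 0 1" unfolding M_def
    by (rule integral_cong) (auto simp: ind_def)
  finally show ?thesis by simp
qed

lemma energy_0_1: "0 < v \<Longrightarrow> energy v 0 1 = en v (Y1 0 1) (Y2 0 1)"
  by (simp add: energy_def en_eq algebra_simps)

lemma upper_bound:
  assumes "(x1, x2) \<in> Omega p1 p2 Q" "Y1 0 1 = xi1 x1" "Y2 0 1 = xi2 x2"
  shows "M 0 1 \<le> B_fun p1 p2 Q (x1, x2)"
  using assms(1)
proof (cases rule: B_fun_cases)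
  case I
  then show ?thesis using M_le_1 by simp
next
  case II
  then show ?thesis using region_II_bound assms by simp
next
  case (III v)
  have v: "0 < v" "v \<le> 1" using III vm by auto
  have "M 0 1 * E (1 / v) \<le> B_fun p1 p2 Q (x1, x2) * E (1 / v)"
    using energy_bound[of 0 1 v] v III chord_energy[of v "xi1 x1" "xi2 x2"] assms energy_0_1 by simp
  moreover have "0 < E (1 / v)" using III v by (intro E_pos) auto
  ultimately show ?thesis by simp
next
  case (IV v)
  have x: "0 < x1" using assms(1) by (auto simp: Omega_iff)
  have "xi1 x1 \<le> e1 (gp * v)"
    unfolding xi1_rad[OF x] using IV gp_pos rad_pos[OF x] p1 by (simp add: box_cox_le_iff)
  then have "M 0 1 * E (1 / vm) \<le> B_fun p1 p2 Q (x1, x2) * E (1 / vm)"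
    using region_IV_bound[OF IV(1,2)] IV energy_0_1[OF IV(1)] E_inverse_vm_pos assms by simp
  then show ?thesis using E_inverse_vm_pos by simp
qed

end

context bellman_parameters
begin

lemma admissible_upper_bound:
  assumes x: "(x1, x2) \<in> Omega p1 p2 Q" and w: "w \<in> admissible p1 p2 Q (x1, x2)"
  shows "measure lebesgue {t \<in> {0..1}. 1 \<le> w t} \<le> B_fun p1 p2 Q (x1, x2)"
proof -
  have wc: "w \<in> weight_class p1 p2 Q"
    and a: "avg {0..1} (\<lambda>t. w t powr p1) = x1" "avg {0..1} (\<lambda>t. w t powr p2) = x2"
    using w by (auto simp: admissible_def)
  interpret bellman_weight p1 p2 Q w using wc by (rule weight_class_imp_bellman_weight)
  have "Y1 0 1 = xi1 x1" "Y2 0 1 = xi2 x2"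
    using avg_powr[OF p1, of 0 1 w] avg_powr[OF p2, of 0 1 w] a wc p1 p2
    by (auto simp: weight_class_def Y1_def Y2_def xi1_def xi2_def)
  then show ?thesis using upper_bound[OF x] by (simp add: M_eq_measure)
qed

end

section \<open>Extremal weights\<close>

definition bounded_weight :: "(real \<Rightarrow> real) \<Rightarrow> bool" where
  "bounded_weight w \<longleftrightarrow> w \<in> borel_measurable borel \<and> (\<exists>lo hi. 0 < lo \<and> (\<forall>t. lo \<le> w t \<and> w t \<le> hi))"

lemma bounded_weightI:
  assumes "w \<in> borel_measurable borel" "0 < lo" "\<And>t. lo \<le> w t" "\<And>t. w t \<le> hi"
  shows "bounded_weight w"
  using assms unfolding bounded_weight_def by blast

lemma bounded_weight_pos: "bounded_weight w \<Longrightarrow> 0 < w t"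
  unfolding bounded_weight_def by (meson less_le_trans)

lemma powr_between:
  fixes lo hi u p :: real
  assumes "0 < lo" "lo \<le> u" "u \<le> hi"
  shows "u powr p \<le> lo powr p + hi powr p" and "min (lo powr p) (hi powr p) \<le> u powr p"
proof -
  have "u powr p \<le> hi powr p \<and> lo powr p \<le> u powr p \<or> u powr p \<le> lo powr p \<and> hi powr p \<le> u powr p"
    using assms by (cases "0 \<le> p") (auto intro: powr_mono2 powr_mono2')
  then show "u powr p \<le> lo powr p + hi powr p" "min (lo powr p) (hi powr p) \<le> u powr p"
    using powr_ge_zero[of lo p] powr_ge_zero[of hi p] by linarith+
qed

lemma bounded_weight_abs_int:
  assumes "bounded_weight w"
  shows "(\<lambda>t. w t powr p) absolutely_integrable_on {a..b}"
proof -
  from assms obtain lo hi where w: "w \<in> borel_measurable borel" "0 < lo" "\<And>t. lo \<le> w t" "\<And>t. w t \<le> hi"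
    unfolding bounded_weight_def by blast
  show ?thesis
  proof (rule measurable_bounded_by_integrable_imp_absolutely_integrable)
    have "(\<lambda>t. w t powr p) \<in> borel_measurable borel" using w(1) by measurable
    then show "(\<lambda>t. w t powr p) \<in> borel_measurable (lebesgue_on {a..b})"
      by (intro measurable_restrict_space1 measurable_completion) simp
    show "(\<lambda>t. lo powr p + hi powr p) integrable_on {a..b}" by (rule integrable_const_ivl)
    show "norm (w t powr p) \<le> lo powr p + hi powr p" if "t \<in> {a..b}" for t
      using powr_between(1)[of lo "w t" hi p] w by simp
  qed auto
qed

lemma bounded_weight_avg_pos:
  assumes "bounded_weight w" "a < b"
  shows "0 < avg {a..b} (\<lambda>t. w t powr p)"
proof -
  from assms(1) obtain lo hi where w: "0 < lo" "\<And>t. lo \<le> w t" "\<And>t. w t \<le> hi"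
    unfolding bounded_weight_def by blast
  have "0 < lo powr p" "0 < hi powr p" using w less_le_trans[OF w(1) order.trans[OF w(2,3)]] by simp_all
  then have m: "0 < min (lo powr p) (hi powr p)" by simp
  note ai = bounded_weight_abs_int[OF assms(1)]
  have "integral {a..b} (\<lambda>t. min (lo powr p) (hi powr p)) \<le> integral {a..b} (\<lambda>t. w t powr p)"
    using powr_between(2)[OF w(1-3)]
    by (intro integral_le integrable_const_ivl set_lebesgue_integral_eq_integral(1)[OF ai]) auto
  then have "0 < integral {a..b} (\<lambda>t. w t powr p)" using m assms(2)
    by (simp del: min_less_iff_conj) (meson diff_gt_0_iff_gt less_le_trans mult_pos_pos)
  then show ?thesis using assms(2) by (simp add: avg_Icc[OF assms(2) ai])
qed

lemma integral_nonneg_interior: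
  fixes f :: "real \<Rightarrow> real"
  assumes "f integrable_on {a..b}" "\<And>t. a < t \<Longrightarrow> t < b \<Longrightarrow> 0 \<le> f t"
  shows "0 \<le> integral {a..b} f"
proof -
  have "f integrable_on {a<..<b}" using assms(1) integrable_on_Icc_iff_Ioo by blast
  then have "0 \<le> integral {a<..<b} f" using assms(2) by (intro integral_nonneg) auto
  then show ?thesis using integral_open_interval_real[of a b f] by simp
qed

lemma integral_nonpos_interior:
  fixes f :: "real \<Rightarrow> real"
  assumes "f integrable_on {a..b}" "\<And>t. a < t \<Longrightarrow> t < b \<Longrightarrow> f t \<le> 0"
  shows "integral {a..b} f \<le> 0"
  using integral_nonneg_interior[of "\<lambda>t. - f t" a b] assms by (simp add: integrable_neg)

context bellman_parameters
begin

lemma bounded_weight_box_cox_integrable: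
  assumes "bounded_weight w" "p \<noteq> 0"
  shows "(\<lambda>t. box_cox p (w t)) integrable_on {a..b}"
proof (cases "a \<le> b")
  case True
  show ?thesis
    by (rule set_lebesgue_integral_eq_integral(1)[OF
      integral_box_cox(2)[OF assms(2) True bounded_weight_abs_int[OF assms(1)]]])
qed auto

lemma S_integral:
  assumes "bounded_weight w" "0 < v" "a \<le> b"
  shows "(\<lambda>t. S (w t / v)) integrable_on {a..b}"
    and "integral {a..b} (\<lambda>t. S (w t / v)) = v powr (-p2) * (integral {a..b} (\<lambda>t. e2 (w t)) - (b - a) * e2 v
      - A * v powr (p2 - p1) * (integral {a..b} (\<lambda>t. e1 (w t)) - (b - a) * e1 v))"
proof -
  have c: "((\<lambda>t. k) has_integral (b - a) * k) {a..b}" for k :: real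
    using has_integral_const_real[of k a b] assms by simp
  have "((\<lambda>t. v powr (-p2) * ((e2 (w t) - e2 v) - A * v powr (p2 - p1) * (e1 (w t) - e1 v)))
    has_integral v powr (-p2) * (integral {a..b} (\<lambda>t. e2 (w t)) - (b - a) * e2 v
      - A * v powr (p2 - p1) * (integral {a..b} (\<lambda>t. e1 (w t)) - (b - a) * e1 v))) {a..b}"
    by (intro has_integral_mult_right has_integral_diff c integrable_integral
      bounded_weight_box_cox_integrable assms p1 p2)
  moreover have "(\<lambda>t. v powr (-p2) * ((e2 (w t) - e2 v) - A * v powr (p2 - p1) * (e1 (w t) - e1 v)))
      = (\<lambda>t. S (w t / v))"
    using bounded_weight_pos[OF assms(1)] assms(2) by (auto simp: S_divide less_imp_le)
  ultimately show "(\<lambda>t. S (w t / v)) integrable_on {a..b}"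
    "integral {a..b} (\<lambda>t. S (w t / v)) = v powr (-p2) * (integral {a..b} (\<lambda>t. e2 (w t)) - (b - a) * e2 v
      - A * v powr (p2 - p1) * (integral {a..b} (\<lambda>t. e1 (w t)) - (b - a) * e1 v))"
    by (auto dest: integral_unique has_integral_integrable)
qed

lemma S_integral_nonneg:
  assumes "bounded_weight w" "0 < v" "a \<le> b"
    and "\<And>t. a < t \<Longrightarrow> t < b \<Longrightarrow> v \<le> w t \<and> w t \<le> v / vm"
  shows "0 \<le> integral {a..b} (\<lambda>t. S (w t / v))"
proof (rule integral_nonneg_interior[OF S_integral(1)[OF assms(1-3)]])
  fix t assume "a < t" "t < b"
  then have "1 \<le> w t / v" "w t / v \<le> 1 / vm" using assms(2) assms(4)[of t] vm by (auto simp: field_simps)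
  then show "0 \<le> S (w t / v)" by (rule S_nonneg)
qed

text \<open>
  If the integral is nonnegative, the average over \<open>{a..b}\<close> is above the tangent that starts at \<open>v\<close>, hence above the
  lower curve by \<open>extremal_curve_below\<close>. The parameter \<open>v\<close> may depend on the interval, which replaces a nonlinear
  inequality by a linear one that can be tested on the values of \<open>w\<close>.
\<close>

lemma weight_classI:
  assumes w: "bounded_weight w"
    and cond: "\<And>a b. 0 \<le> a \<Longrightarrow> a < b \<Longrightarrow> b \<le> 1 \<Longrightarrow> \<exists>v>0. 0 \<le> integral {a..b} (\<lambda>t. S (w t / v))"
  shows "w \<in> weight_class p1 p2 Q"
  unfolding weight_class_def
proof (intro CollectI conjI allI impI ballI)
  have "w \<in> borel_measurable borel" using w by (simp add: bounded_weight_def)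
  then show "w \<in> borel_measurable (lebesgue_on {0..1})"
    by (intro measurable_restrict_space1 measurable_completion) simp
  show "0 \<le> w t" for t using bounded_weight_pos[OF w, of t] by simp
  show "AE t in lebesgue_on {0..1}. 0 < w t" using bounded_weight_pos[OF w] by simp
  show "set_integrable lebesgue {0..1} (\<lambda>t. w t powr p1)" "set_integrable lebesgue {0..1} (\<lambda>t. w t powr p2)"
    by (rule bounded_weight_abs_int[OF w])+
  fix a b :: real assume ab: "0 \<le> a \<and> a < b \<and> b \<le> 1"
  then obtain v where v: "0 < v" "0 \<le> integral {a..b} (\<lambda>t. S (w t / v))" using cond by blast
  define X1 X2 where "X1 = avg {a..b} (\<lambda>t. w t powr p1)" and "X2 = avg {a..b} (\<lambda>t. w t powr p2)"
  have pos: "0 < X1" "0 < X2" using ab by (simp_all add: X1_def X2_def bounded_weight_avg_pos[OF w])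
  have xi: "integral {a..b} (\<lambda>t. e1 (w t)) = (b - a) * xi1 X1" "integral {a..b} (\<lambda>t. e2 (w t)) = (b - a) * xi2 X2"
    using avg_powr[OF p1 _ bounded_weight_abs_int[OF w], of a b] avg_powr[OF p2 _ bounded_weight_abs_int[OF w], of a b]
      ab p1 p2 by (auto simp: X1_def X2_def xi1_def xi2_def)
  have "0 \<le> v powr (-p2) * ((b - a) * (xi2 X2 - tangent v (xi1 X1)))"
    using v(2) S_integral(2)[OF w v(1), of a b] ab unfolding xi tangent_def by (simp add: algebra_simps)
  then have "tangent v (xi1 X1) \<le> xi2 X2" using v(1) ab by (simp add: zero_le_mult_iff)
  then have "e2 (rad X1 / Q) \<le> xi2 X2"
    using extremal_curve_below[OF v(1) rad_pos[OF pos(1)]] xi1_rad[OF pos(1)] by simp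
  also have "\<dots> = e2 (X2 powr (1 / p2))" using p2 pos by (simp add: xi2_def box_cox_powr_inverse)
  finally have "rad X1 / Q \<le> X2 powr (1 / p2)"
    using rad_pos[OF pos(1)] Q1 pos p2 by (simp add: box_cox_le_iff)
  then show "X1 powr (1 / p1) \<le> Q * X2 powr (1 / p2)" using Q1 by (simp add: rad_def field_simps)
qed

definition attained :: "real \<Rightarrow> real \<Rightarrow> bool" where
  "attained x1 x2 \<longleftrightarrow> (\<exists>w \<in> weight_class p1 p2 Q.
     avg {0..1} (\<lambda>t. w t powr p1) = x1 \<and> avg {0..1} (\<lambda>t. w t powr p2) = x2 \<and>
     measure lebesgue {t \<in> {0..1}. 1 \<le> w t} = B_fun p1 p2 Q (x1, x2))"

lemma attainedI:
  assumes "w \<in> weight_class p1 p2 Q" "bounded_weight w"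
    and "integral {0..1} (\<lambda>t. e1 (w t)) = xi1 x1" "integral {0..1} (\<lambda>t. e2 (w t)) = xi2 x2"
    and "measure lebesgue {t \<in> {0..1}. 1 \<le> w t} = B_fun p1 p2 Q (x1, x2)"
  shows "attained x1 x2"
  unfolding attained_def
  using assms avg_powr[OF p1 _ bounded_weight_abs_int[OF assms(2)], of 0 1]
    avg_powr[OF p2 _ bounded_weight_abs_int[OF assms(2)], of 0 1] x_eq_xi[symmetric]
  by (intro bexI[of _ w]) auto

definition step :: "real \<Rightarrow> real \<Rightarrow> real \<Rightarrow> real \<Rightarrow> real \<Rightarrow> real \<Rightarrow> real" where
  "step d e a b c t = (if t < d then a else if t < e then b else c)"

lemma bounded_weight_step:
  assumes "0 < a" "0 < b" "0 < c"
  shows "bounded_weight (step d e a b c)"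
proof (rule bounded_weightI[where lo = "min a (min b c)" and hi = "max a (max b c)"])
  show "step d e a b c \<in> borel_measurable borel" unfolding step_def by measurable
qed (use assms in \<open>auto simp: step_def\<close>)

lemma has_integral_const_interior:
  fixes f :: "real \<Rightarrow> real"
  assumes "a \<le> b" "\<And>t. a < t \<Longrightarrow> t < b \<Longrightarrow> f t = k"
  shows "(f has_integral (b - a) * k) {a..b}"
proof (rule has_integral_spike_finite[where S = "{a, b}"])
  show "((\<lambda>t. k) has_integral (b - a) * k) {a..b}"
    using has_integral_const_real[of k a b] assms(1) by simp
qed (use assms in auto)

lemma has_integral_step:
  fixes f :: "real \<Rightarrow> real"
  assumes "0 \<le> d" "d \<le> e" "e \<le> 1"
  shows "((\<lambda>t. f (step d e a b c t)) has_integral d * f a + (e - d) * f b + (1 - e) * f c) {0..1}"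
proof -
  have "((\<lambda>t. f (step d e a b c t)) has_integral (d - 0) * f a) {0..d}"
    by (rule has_integral_const_interior) (use assms in \<open>auto simp: step_def\<close>)
  moreover have "((\<lambda>t. f (step d e a b c t)) has_integral (e - d) * f b) {d..e}"
    by (rule has_integral_const_interior) (use assms in \<open>auto simp: step_def\<close>)
  moreover have "((\<lambda>t. f (step d e a b c t)) has_integral (1 - e) * f c) {e..1}"
    by (rule has_integral_const_interior) (use assms in \<open>auto simp: step_def\<close>)
  ultimately have "((\<lambda>t. f (step d e a b c t)) has_integral (d - 0) * f a + (e - d) * f b + (1 - e) * f c) {0..1}"
    using assms by (meson has_integral_combine order_trans)
  then show ?thesis by simp
qed

text \<open>
  All averages lie on the chord between the two values. With \<open>v = lo\<close> the test function is nonnegative at both of them.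
\<close>

lemma two_step_weight_class:
  assumes "0 < lo" "lo \<le> hi" "hi \<le> lo / vm"
  shows "step d d hi lo lo \<in> weight_class p1 p2 Q"
proof (rule weight_classI)
  show bw: "bounded_weight (step d d hi lo lo)" using assms by (intro bounded_weight_step) auto
  fix a b :: real assume ab: "a < b"
  have "lo \<le> lo / vm" using assms by simp
  then have "0 \<le> integral {a..b} (\<lambda>t. S (step d d hi lo lo t / lo))"
    using assms ab by (intro S_integral_nonneg bw) (auto simp: step_def)
  then show "\<exists>v>0. 0 \<le> integral {a..b} (\<lambda>t. S (step d d hi lo lo t / v))" using assms by blast
qed

lemma measure_initial_segment:
  assumes "0 \<le> d" "d \<le> 1" "{t \<in> {0..1::real}. P t} = {0..<d}"
  shows "measure lebesgue {t \<in> {0..1}. P t} = d"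
  using assms by auto

lemma tangent_affine: "tangent v (d * y + (1 - d) * z) = d * tangent v y + (1 - d) * tangent v z"
  by (simp add: tangent_def algebra_simps)

text \<open>
  The point lies on the tangent that starts at some \<open>v \<ge> 1\<close>, and the weight takes the values \<open>v\<close> and \<open>v / vm\<close> where this
  tangent meets the upper curve.
\<close>

lemma attained_I:
  assumes x: "(x1, x2) \<in> Omega p1 p2 Q" and I: "A * xi1 x1 \<le> xi2 x2 \<or> e1 gp \<le> xi1 x1"
    and B: "B_fun p1 p2 Q (x1, x2) = 1"
  shows "attained x1 x2"
proof -
  define v where "v = v_IV p1 p2 Q (x1, x2)"
  note v = v_IV_props[OF x, folded v_def]
  have x0: "0 < x1" using x by (simp add: Omega_iff)
  note xr = xi1_rad[OF x0] rad_pos[OF x0]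
  have v1: "1 \<le> v"
  proof (rule ccontr)
    assume "\<not> 1 \<le> v"
    then have "tangent v (xi1 x1) < tangent 1 (xi1 x1)"
      unfolding xr(1) using v xr(2) by (intro tangent_strict_mono) auto
    then have "e1 gp \<le> e1 (rad x1)" using I v(2) xr(1) by (simp add: tangent_1)
    then have "gp \<le> rad x1" using xr(2) gp_pos p1 by (simp add: box_cox_le_iff)
    then have "gp * 1 \<le> gp * v" using v by simp
    then show False using \<open>\<not> 1 \<le> v\<close> gp_pos by simp
  qed
  have vv: "v < v / vm" using v1 vm by (simp add: field_simps)
  have e1v: "e1 v \<le> xi1 x1" "xi1 x1 \<le> e1 (v / vm)" "e1 v < e1 (v / vm)"
  proof -
    show "e1 v \<le> xi1 x1" using v xr p1 by (simp add: box_cox_le_iff)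
    have "gp \<le> 1 / vm" using gm(2) vm by (simp add: gm_eq field_simps)
    then have "gp * v \<le> 1 / vm * v" using v1 by (intro mult_right_mono) auto
    then have "rad x1 \<le> v / vm" using v(4) by simp
    then show "xi1 x1 \<le> e1 (v / vm)" using v xr p1 vm by (simp add: box_cox_le_iff)
    show "e1 v < e1 (v / vm)" using v p1 vm vv by (simp add: box_cox_less_iff)
  qed
  define d where "d = (xi1 x1 - e1 v) / (e1 (v / vm) - e1 v)"
  have d: "0 \<le> d" "d \<le> 1" using e1v by (auto simp: d_def)
  have "d * (e1 (v / vm) - e1 v) = xi1 x1 - e1 v" using e1v by (simp add: d_def)
  then have xi1d: "xi1 x1 = d * e1 (v / vm) + (1 - d) * e1 v" by (simp add: algebra_simps)
  have "S (v / vm / v) = 0" using v S_inverse_vm by simp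
  then have "e2 (v / vm) = tangent v (e1 (v / vm))" using S_divide_tangent[of "v / vm" v] v vm by simp
  moreover have "e2 v = tangent v (e1 v)" by (simp add: tangent_def)
  ultimately have xi2d: "xi2 x2 = d * e2 (v / vm) + (1 - d) * e2 v"
    unfolding v(2) xi1d tangent_affine by simp
  show ?thesis
  proof (rule attainedI)
    show "step d d (v / vm) v v \<in> weight_class p1 p2 Q"
      using v vv by (intro two_step_weight_class) auto
    show "bounded_weight (step d d (v / vm) v v)" using v vm by (intro bounded_weight_step) auto
    show "integral {0..1} (\<lambda>t. e1 (step d d (v / vm) v v t)) = xi1 x1"
      using has_integral_step[of d d e1 "v / vm" v v] d xi1d by (simp add: integral_unique)
    show "integral {0..1} (\<lambda>t. e2 (step d d (v / vm) v v t)) = xi2 x2"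
      using has_integral_step[of d d e2 "v / vm" v v] d xi2d by (simp add: integral_unique)
    have "{t \<in> {0..1}. 1 \<le> step d d (v / vm) v v t} = {0..1}" using v1 vv by (auto simp: step_def)
    then show "measure lebesgue {t \<in> {0..1}. 1 \<le> step d d (v / vm) v v t} = B_fun p1 p2 Q (x1, x2)"
      by (simp only: B) simp
  qed
qed

text \<open>
  Here the chord through the origin is not steeper than \<open>L_minus\<close>, so \<open>1 \<le> v / vm\<close> and the two values 1 and \<open>v\<close> are admissible.
\<close>

lemma attained_III:
  assumes v: "vm \<le> v" "v < 1" "e2 v * xi1 x1 = e1 v * xi2 x2" "xi1 x1 < 0" "e1 v \<le> xi1 x1"
    and B: "B_fun p1 p2 Q (x1, x2) = 1 - xi1 x1 / e1 v"
  shows "attained x1 x2"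
proof -
  have v0: "0 < v" using v vm by simp
  have e: "e1 v < 0" using box_cox_neg[OF p1 v0 v(2)] .
  define d where "d = 1 - xi1 x1 / e1 v"
  have d: "0 \<le> d" "d \<le> 1" using e v by (auto simp: d_def field_simps)
  have xi: "xi1 x1 = (1 - d) * e1 v" "xi2 x2 = (1 - d) * e2 v"
    using e v(3) by (auto simp: d_def field_simps)
  show ?thesis
  proof (rule attainedI)
    show "step d d 1 v v \<in> weight_class p1 p2 Q"
      using v v0 vm by (intro two_step_weight_class) (auto simp: field_simps)
    show "bounded_weight (step d d 1 v v)" using v0 by (intro bounded_weight_step) auto
    show "integral {0..1} (\<lambda>t. e1 (step d d 1 v v t)) = xi1 x1"
      using has_integral_step[of d d e1 1 v v] d xi by (simp add: integral_unique)
    show "integral {0..1} (\<lambda>t. e2 (step d d 1 v v t)) = xi2 x2"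
      using has_integral_step[of d d e2 1 v v] d xi by (simp add: integral_unique)
    show "measure lebesgue {t \<in> {0..1}. 1 \<le> step d d 1 v v t} = B_fun p1 p2 Q (x1, x2)"
      unfolding B d_def[symmetric] using d v by (intro measure_initial_segment) (auto simp: step_def)
  qed
qed

text \<open>
  The weights \<open>a\<close>, \<open>d\<close> of the values \<open>vm\<close>, \<open>1 / vm\<close> are found by pairing with the equations of \<open>L_plus\<close> and
  \<open>L_minus\<close>, on which these values lie together with 1. An interval that meets at most two of the three steps is treated as before. For an
  interval containing the whole middle step take the tangent at the point of the lower curve below \<open>x\<close>: its test function is
  positive only on the middle step and has a nonnegative integral over \<open>{0..1}\<close>. The same tangent shows \<open>a + d \<le> 1\<close>.
\<close>

lemma attained_II:
  assumes x: "(x1, x2) \<in> Omega p1 p2 Q"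
    and II: "xi2 x2 < A * xi1 x1" "xi2 x2 \<le> Am * xi1 x1" "e1 gm \<le> xi1 x1" "xi1 x1 < e1 gp"
    and B: "B_fun p1 p2 Q (x1, x2) = 1 + c2 * (xi2 x2 - A * xi1 x1)"
  shows "attained x1 x2"
proof -
  define y1 y2 r where "y1 = xi1 x1" and "y2 = xi2 x2" and "r = rad x1"
  have x0: "0 < x1" "e2 (r / Q) \<le> y2" using x by (auto simp: Omega_iff r_def y2_def)
  have yr: "y1 = e1 r" "0 < r" using xi1_rad[OF x0(1)] rad_pos[OF x0(1)] by (auto simp: y1_def r_def)
  define v where "v = r / gp"
  have "gm \<le> r" "r < gp" using II(3,4) yr gm gp_pos p1 unfolding y1_def[symmetric] yr(1)
    by (simp_all add: box_cox_le_iff box_cox_less_iff)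
  then have v: "0 < v" "vm \<le> v" "v < 1" using yr gp_pos by (auto simp: v_def gm_eq field_simps)
  have above: "tangent v y1 \<le> y2"
    using tangent_touches[OF v(1)] x0(2) gp_pos by (simp add: v_def yr(1))
  define h where "h = 1 / vm"
  have h: "1 < h" "S h = 0" using vm S_inverse_vm by (auto simp: h_def)
  have gh: "e2 h - Am * e1 h < 0"
  proof -
    have "1 / vm < h / vm" using h vm by (intro divide_strict_right_mono) auto
    then have "S (h / vm) < 0" using h vm by (intro S_neg disjI2) auto
    then show ?thesis using S_divide_vm[of h] h vm by (simp add: mult_less_0_iff)
  qed
  define a where "a = (y2 - A * y1) / S vm"
  define d where "d = (y2 - Am * y1) / (e2 h - Am * e1 h)"
  have a0: "0 < a" using II(1) S_vm by (simp add: a_def y1_def y2_def zero_less_divide_iff)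
  have d0: "0 \<le> d" using II(2) gh by (simp add: d_def y1_def y2_def zero_le_divide_iff)
  have eq1: "y2 - A * y1 = a * (e2 vm - A * e1 vm)" using S_vm by (simp add: a_def S_def)
  have eq2: "y2 - Am * y1 = d * (e2 h - Am * e1 h)" using gh by (simp add: d_def)
  have Alt: "A < Am" using A_less_1 Am_gt_1 by simp
  have y1eq: "y1 = a * e1 vm + d * e1 h"
  proof -
    have "e2 h = A * e1 h" using h(2) by (simp add: S_def)
    then have "(Am - A) * y1 = (Am - A) * (a * e1 vm + d * e1 h)"
      using eq1 eq2 vm_on_line by (simp add: algebra_simps)
    then show ?thesis using Alt by simp
  qed
  have y2eq: "y2 = a * e2 vm + d * e2 h"
    using eq1 h(2) unfolding y1eq S_def by (simp add: algebra_simps)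
  have Ssum: "v powr (-p2) * (y2 - tangent v y1) = a * S (vm / v) + (1 - a - d) * S (1 / v) + d * S (h / v)"
    unfolding y1eq y2eq using v vm h by (simp add: S_divide_tangent tangent_def algebra_simps)
  have total: "0 \<le> a * S (vm / v) + (1 - a - d) * S (1 / v) + d * S (h / v)"
    unfolding Ssum[symmetric] using above by simp
  have neg: "S (vm / v) \<le> 0" "S (h / v) \<le> 0"
    using v vm h by (auto intro!: S_nonpos simp: proper_def h_def field_simps)
  have ad: "a + d \<le> 1"
  proof (cases "v = vm")
    case True
    then have "y2 = Am * y1" using above II(2) by (simp add: tangent_vm y1_def y2_def)
    then have "d = 0" by (simp add: d_def)
    moreover have "a \<le> 1"
    proof -
      have "e1 vm < e1 gm" using gp vm gm p1 by (simp add: box_cox_less_iff gm_eq)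
      then have "a * e1 vm \<ge> 1 * e1 vm" using y1eq \<open>d = 0\<close> II(3) by (simp add: y1_def)
      then show ?thesis using box_cox_neg[OF p1 vm] by (simp add: mult_le_cancel_right)
    qed
    ultimately show ?thesis by simp
  next
    case False
    then have "0 < S (1 / v)" using v vm by (intro S_pos) (auto simp: field_simps)
    moreover have "0 \<le> (1 - a - d) * S (1 / v)"
      using total neg a0 d0 mult_nonneg_nonpos[of a "S (vm / v)"] mult_nonneg_nonpos[of d "S (h / v)"] by linarith
    ultimately show ?thesis by (simp add: zero_le_mult_iff)
  qed
  let ?w = "step d (1 - a) h 1 vm"
  have bw: "bounded_weight ?w" using vm h by (intro bounded_weight_step) auto
  have de: "0 \<le> d" "d \<le> 1 - a" "1 - a \<le> 1" using a0 d0 ad by auto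
  show ?thesis
  proof (rule attainedI)
    show "bounded_weight ?w" by (rule bw)
    show "integral {0..1} (\<lambda>t. e1 (?w t)) = xi1 x1" "integral {0..1} (\<lambda>t. e2 (?w t)) = xi2 x2"
      using has_integral_step[OF de, of e1 h 1 vm] has_integral_step[OF de, of e2 h 1 vm] y1eq y2eq
      by (simp_all add: integral_unique y1_def y2_def)
    have "measure lebesgue {t \<in> {0..1}. 1 \<le> ?w t} = 1 - a"
      using de h vm by (intro measure_initial_segment) (auto simp: step_def)
    also have "\<dots> = B_fun p1 p2 Q (x1, x2)" unfolding B by (simp add: a_def c2_def y1_def y2_def)
    finally show "measure lebesgue {t \<in> {0..1}. 1 \<le> ?w t} = B_fun p1 p2 Q (x1, x2)" .
    show "?w \<in> weight_class p1 p2 Q"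
    proof (rule weight_classI[OF bw])
      fix s t :: real assume st: "0 \<le> s" "s < t" "t \<le> 1"
      consider "t \<le> 1 - a" | "d \<le> s" | "s < d" "1 - a < t" by linarith
      then show "\<exists>v>0. 0 \<le> integral {s..t} (\<lambda>t. S (?w t / v))"
      proof cases
        case 1
        then have "0 \<le> integral {s..t} (\<lambda>t. S (?w t / 1))"
          using st h by (intro S_integral_nonneg bw) (auto simp: step_def h_def)
        then show ?thesis by (intro exI[of _ 1]) auto
      next
        case 2
        then have "0 \<le> integral {s..t} (\<lambda>t. S (?w t / vm))"
          using st vm by (intro S_integral_nonneg bw) (auto simp: step_def)
        then show ?thesis using vm by blast
      next
        case 3
        let ?f = "\<lambda>t. S (?w t / v)"
        have int: "?f integrable_on {0..1}" "?f integrable_on {0..s}" "?f integrable_on {t..1}" "?f integrable_on {0..t}"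
          using S_integral(1)[OF bw v(1)] st by auto
        have "integral {0..1} ?f = d * S (h / v) + (1 - a - d) * S (1 / v) + (1 - (1 - a)) * S (vm / v)"
          using has_integral_step[OF de, of "\<lambda>u. S (u / v)" h 1 vm] by (simp add: integral_unique)
        then have "0 \<le> integral {0..1} ?f" using total by simp
        moreover have "integral {0..s} ?f \<le> 0"
          using 3 neg by (intro integral_nonpos_interior int) (auto simp: step_def)
        moreover have "integral {t..1} ?f \<le> 0"
          using 3 neg de by (intro integral_nonpos_interior int) (auto simp: step_def)
        moreover have "integral {0..s} ?f + integral {s..t} ?f = integral {0..t} ?f"
          using st int by (intro Henstock_Kurzweil_Integration.integral_combine) auto
        moreover have "integral {0..t} ?f + integral {t..1} ?f = integral {0..1} ?f"
          using st int by (intro Henstock_Kurzweil_Integration.integral_combine) auto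
        ultimately have "0 \<le> integral {s..t} ?f" by linarith
        then show ?thesis using v by blast
      qed
    qed
  qed
qed

definition profile :: "real \<Rightarrow> real \<Rightarrow> real" where
  "profile t0 t = vm * (t / t0) powr (- kap)"

text \<open>
  In region IV averages over initial intervals \<open>{0..b}\<close> with \<open>t0 \<le> b \<le> t1\<close> have to stay on the lower curve, which forces the power
  function \<open>profile\<close>; the two values 1 and \<open>vm\<close> on \<open>{0..t0}\<close> represent the point of \<open>L_minus\<close> where it touches
  the lower curve, and the final constant \<open>v\<close> moves the average along the last tangent to \<open>x\<close>.
\<close>

definition extremal :: "real \<Rightarrow> real \<Rightarrow> real \<Rightarrow> real \<Rightarrow> real \<Rightarrow> real" where
  "extremal s t0 t1 v t = (if t < s then 1 else if t < t0 then vm else if t < t1 then profile t0 t else v)"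

text \<open>
  The primitive is guessed from the requirement that the average over \<open>{0..t}\<close> belongs to the point with parameter \<open>c\<close>
  times \<open>profile t0 t\<close>, where \<open>c\<close> is \<open>gp\<close> for \<open>p1\<close> and \<open>gp / Q\<close> for \<open>p2\<close>.
\<close>

lemma profile_integral:
  assumes p: "p \<noteq> 0" and c: "0 < c" "c powr p * (1 - kap * p) = 1" and t: "0 < t0" "t0 \<le> b"
  shows "((\<lambda>t. box_cox p (profile t0 t)) has_integral
    b * box_cox p (c * profile t0 b) - t0 * box_cox p (c * vm)) {t0..b}"
proof -
  have "((\<lambda>t. t * box_cox p (c * profile t0 t)) has_vector_derivative box_cox p (profile t0 t)) (at t within {t0..b})"
    if "t \<in> {t0..b}" for t
  proof -
    have t0: "0 < t" using that t by simp
    define W where "W = profile t0 t"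
    have W: "0 < W" using vm t0 t by (simp add: W_def profile_def)
    have dW: "(profile t0 has_real_derivative - kap * W / t) (at t)"
    proof -
      have "(profile t0 has_real_derivative vm * (- kap * (t / t0) powr (- kap - 1) * (1 / t0))) (at t)"
        unfolding profile_def using t0 t by (auto intro!: derivative_eq_intros)
      moreover have "(t / t0) powr (- kap - 1) = (t / t0) powr (- kap) / (t / t0)"
        using t0 t powr_diff[of "t / t0" "- kap" 1] by simp
      ultimately show ?thesis using t0 t by (simp add: W_def profile_def mult.left_commute)
    qed
    have "((\<lambda>t. c * profile t0 t) has_real_derivative c * (- kap * W / t)) (at t)"
      using dW by (rule DERIV_cmult)
    from DERIV_chain2[OF _ this, of "box_cox p" "(c * W) powr (p - 1)"]
    have "((\<lambda>t. box_cox p (c * profile t0 t)) has_real_derivative (c * W) powr (p - 1) * (c * (- kap * W / t))) (at t)"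
      using has_derivative_box_cox[OF p, of "c * W"] c W by (simp add: W_def)
    from DERIV_mult[OF DERIV_ident this]
    have "((\<lambda>t. t * box_cox p (c * profile t0 t)) has_real_derivative
        1 * box_cox p (c * W) + (c * W) powr (p - 1) * (c * (- kap * W / t)) * t) (at t)"
      by (simp add: W_def)
    also have "1 * box_cox p (c * W) + (c * W) powr (p - 1) * (c * (- kap * W / t)) * t = box_cox p W"
    proof -
      have "(c * W) powr (p - 1) * (c * W) = (c * W) powr p"
        using c W powr_add[of "c * W" "p - 1" 1] by simp
      then have "1 * box_cox p (c * W) + (c * W) powr (p - 1) * (c * (- kap * W / t)) * t
          = box_cox p (c * W) - kap * (c * W) powr p"
        using t0 by (simp add: field_simps)
      also have "\<dots> = ((c powr p * (1 - kap * p)) * W powr p - 1) / p"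
        using p c W by (simp add: box_cox_def powr_mult field_simps)
      finally show ?thesis unfolding c(2) by (simp add: box_cox_def)
    qed
    finally show ?thesis
      by (auto simp: W_def has_real_derivative_iff_has_vector_derivative[symmetric] intro: DERIV_subset)
  qed
  from fundamental_theorem_of_calculus[OF t(2) this]
  show ?thesis using t vm by (simp add: profile_def)
qed

text \<open>
  The fraction of \<open>{0..t0}\<close> on which the extremal weight of region IV is 1.
\<close>

definition top_share :: real where "top_share = 1 - e1 gm / e1 vm"

lemma top_share: "0 \<le> top_share" "top_share \<le> 1" "(1 - top_share) * e1 vm = e1 gm"
  "(1 - top_share) * e2 vm = e2 (gm / Q)"
proof -
  have "e1 vm < e1 gm" using gp vm gm p1 by (simp add: box_cox_less_iff gm_eq)
  moreover have "e1 gm < 0" "e1 vm < 0" using box_cox_neg[OF p1] gm vm by auto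
  ultimately show 1: "0 \<le> top_share" "top_share \<le> 1" "(1 - top_share) * e1 vm = e1 gm"
    by (auto simp: top_share_def field_simps)
  then show "(1 - top_share) * e2 vm = e2 (gm / Q)"
    using vm_on_line gm_tangent by (simp add: mult.left_commute)
qed

lemma top_share_E: "top_share * E (1 / vm) = (1 - A) * e1 gp"
proof -
  have "e1 gm = vm powr p1 * e1 gp + e1 vm" using box_cox_mult[OF p1, of gp vm] gp_pos vm by (simp add: gm_eq)
  moreover have "e1 (1 / vm) = - (vm powr (-p1) * e1 vm)"
    using box_cox_divide[OF p1, of 1 vm] vm by simp
  moreover have "e1 vm \<noteq> 0" using box_cox_neg[OF p1 vm] by simp
  moreover have "vm powr p1 * vm powr (-p1) = 1" using vm by (simp add: powr_add[symmetric])
  ultimately show ?thesis unfolding E_inverse_vm top_share_def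
    by (simp add: field_simps)
qed

text \<open>
  Let the interval end at \<open>b \<ge> t0\<close> and take the test function for the value \<open>u\<close> of the profile at \<open>min b t1\<close>. Its
  integral over \<open>{0..min b t1}\<close> vanishes, since the average is the point of tangency. As the weight decreases, the
  test function is first nonpositive and then nonnegative, so its integral over \<open>{a..b}\<close> is nonnegative for every \<open>a\<close>.
  If \<open>x\<close> lies on the upper curve, then \<open>t0 = t1 = 0\<close> and the weight is constant.
\<close>

lemma attained_IV:
  assumes x: "(x1, x2) \<in> Omega p1 p2 Q"
    and v: "0 < v" "v \<le> vm" "xi2 x2 = tangent v (xi1 x1)" "v \<le> rad x1" "rad x1 \<le> gp * v"
    and B: "B_fun p1 p2 Q (x1, x2) = (v / vm) powr (1/kap) * en v (xi1 x1) (xi2 x2) / E (1 / vm)"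
  shows "attained x1 x2"
proof -
  have x0: "0 < x1" using x by (simp add: Omega_iff)
  note xr = xi1_rad[OF x0] rad_pos[OF x0]
  have e1v: "e1 v \<le> xi1 x1" "xi1 x1 \<le> e1 (gp * v)" "e1 v < e1 (gp * v)"
    using v xr gp p1 by (auto simp: box_cox_le_iff box_cox_less_iff)
  define t1 where "t1 = (xi1 x1 - e1 v) / (e1 (gp * v) - e1 v)"
  define q where "q = (v / vm) powr (1/kap)"
  define t0 where "t0 = t1 * q"
  define s where "s = t0 * top_share"
  have t1: "0 \<le> t1" "t1 \<le> 1" using e1v by (auto simp: t1_def)
  have q: "0 < q" "q \<le> 1" using v vm kap_pos by (auto simp: q_def intro!: powr_le1)
  have ts: "0 \<le> s" "s \<le> t0" "0 \<le> t0" "t0 \<le> t1"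
    using t1 q top_share by (auto simp: t0_def s_def mult_left_le)
  have "t1 * (e1 (gp * v) - e1 v) = xi1 x1 - e1 v" using e1v by (simp add: t1_def)
  then have y1: "xi1 x1 = t1 * e1 (gp * v) + (1 - t1) * e1 v" by (simp add: algebra_simps)
  have y2: "xi2 x2 = t1 * e2 (gp * v / Q) + (1 - t1) * e2 v"
    unfolding v(3) y1 tangent_affine tangent_touches[OF v(1)] by (simp add: tangent_def)
  let ?w = "extremal s t0 t1 v"
  have prof_t1: "profile t0 t1 = v" if "0 < t1"
  proof -
    have "t1 / t0 = 1 / q" using that by (simp add: t0_def)
    then have "(t1 / t0) powr (- kap) = q powr kap" using q by (simp add: powr_divide powr_minus)
    also have "\<dots> = v / vm" using kap_pos v vm by (simp add: q_def powr_powr)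
    finally show ?thesis using vm by (simp add: profile_def)
  qed
  have prof_mono: "profile t0 t' \<le> profile t0 t" if "0 < t0" "t0 \<le> t" "t \<le> t'" for t t'
    using that vm kap_pos by (auto simp: profile_def intro!: mult_left_mono powr_mono2' divide_right_mono)
  have prof_t0: "profile t0 t0 = vm" if "0 < t0" using that by (simp add: profile_def)
  have t0_pos: "0 < t0 \<longleftrightarrow> 0 < t1" using q t1 by (auto simp: t0_def zero_less_mult_iff)
  have prof_range: "v \<le> profile t0 t" "profile t0 t \<le> vm" if "t0 \<le> t" "t < t1" for t
  proof -
    have "0 < t1" using that ts by linarith
    then have "0 < t0" using t0_pos by simp
    then show "v \<le> profile t0 t" "profile t0 t \<le> vm"
      using prof_mono[of t t1] prof_mono[of t0 t] prof_t1 prof_t0 that \<open>0 < t1\<close> by auto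
  qed
  have w_range: "v \<le> ?w t" "?w t \<le> 1" for t
    using v vm prof_range[of t] by (auto simp: extremal_def)
  have bw: "bounded_weight ?w"
  proof (rule bounded_weightI[where lo = v and hi = 1])
    show "?w \<in> borel_measurable borel" unfolding extremal_def profile_def by measurable
  qed (use v w_range in auto)
  have w_anti: "?w t' \<le> ?w t" if "t \<le> t'" for t t'
  proof -
    have *: "profile t0 t' \<le> profile t0 t" if "t0 \<le> t" "t' < t1"
    proof -
      have "0 < t1" using that \<open>t \<le> t'\<close> ts by linarith
      then show ?thesis using t0_pos that \<open>t \<le> t'\<close> by (intro prof_mono) auto
    qed
    show ?thesis using that v vm ts prof_range[of t] prof_range[of t'] * by (auto simp: extremal_def)
  qed
  have initial: "((\<lambda>t. box_cox p (?w t)) has_integral b * box_cox p (c * profile t0 b)) {0..b}"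
    if p: "p \<noteq> 0" and c: "0 < c" "c powr p * (1 - kap * p) = 1" "(1 - top_share) * box_cox p vm = box_cox p (c * vm)"
      and b: "0 < t0" "t0 \<le> b" "b \<le> t1" for p c b
  proof -
    have 1: "((\<lambda>t. box_cox p (?w t)) has_integral (s - 0) * box_cox p 1) {0..s}"
      using ts by (intro has_integral_const_interior) (auto simp: extremal_def)
    have 2: "((\<lambda>t. box_cox p (?w t)) has_integral (t0 - s) * box_cox p vm) {s..t0}"
      using ts by (intro has_integral_const_interior) (auto simp: extremal_def)
    have 3: "((\<lambda>t. box_cox p (?w t)) has_integral
        b * box_cox p (c * profile t0 b) - t0 * box_cox p (c * vm)) {t0..b}"
      by (rule has_integral_spike_finite[where S = "{b}", OF _ _ profile_integral[OF p c(1,2) b(1,2)]])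
        (use ts b in \<open>auto simp: extremal_def\<close>)
    have "((\<lambda>t. box_cox p (?w t)) has_integral (s - 0) * box_cox p 1 + (t0 - s) * box_cox p vm
        + (b * box_cox p (c * profile t0 b) - t0 * box_cox p (c * vm))) {0..b}"
      using has_integral_combine[OF _ _ has_integral_combine[OF _ _ 1 2] 3] ts b by auto
    moreover have "(t0 - s) * box_cox p vm = t0 * box_cox p (c * vm)"
      unfolding c(3)[symmetric] by (simp add: s_def algebra_simps)
    ultimately show ?thesis by simp
  qed
  have initial1: "((\<lambda>t. e1 (?w t)) has_integral b * e1 (gp * profile t0 b)) {0..b}"
    and initial2: "((\<lambda>t. e2 (?w t)) has_integral b * e2 (gp / Q * profile t0 b)) {0..b}"
    if "0 < t0" "t0 \<le> b" "b \<le> t1" for b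
    using initial[OF p1 gp_pos _ _ that] initial[OF p2 _ _ _ that, of "gp / Q"] kap_p1 kap_p2 gp_pos Q1
      top_share(3,4) by (simp_all add: gm_eq)
  have init_zero: "integral {0..b} (\<lambda>t. S (?w t / profile t0 b)) = 0"
    if b: "0 < t0" "t0 \<le> b" "b \<le> t1" for b
  proof -
    have pos: "0 < profile t0 b" using b vm by (simp add: profile_def)
    have "tangent (profile t0 b) (e1 (gp * profile t0 b)) = e2 (gp / Q * profile t0 b)"
      using tangent_touches[OF pos] by simp
    moreover have "integral {0..b} (\<lambda>t. S (?w t / profile t0 b)) = profile t0 b powr (-p2)
        * (b * (e2 (gp / Q * profile t0 b) - tangent (profile t0 b) (e1 (gp * profile t0 b))))"
      using b by (subst S_integral(2)[OF bw pos])
        (simp_all add: integral_unique[OF initial1[OF b]] integral_unique[OF initial2[OF b]]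
          tangent_def algebra_simps del: times_divide_eq_left)
    ultimately show ?thesis by simp
  qed
  have wc: "?w \<in> weight_class p1 p2 Q"
  proof (rule weight_classI[OF bw])
    fix a b :: real assume ab: "0 \<le> a" "a < b" "b \<le> 1"
    consider "b \<le> t0" | "t1 \<le> a" | "t0 < b" "a < t1" by linarith
    then show "\<exists>v>0. 0 \<le> integral {a..b} (\<lambda>t. S (?w t / v))"
    proof cases
      case 1
      then have "0 \<le> integral {a..b} (\<lambda>t. S (?w t / vm))"
        using ab vm by (intro S_integral_nonneg bw) (auto simp: extremal_def)
      then show ?thesis using vm by blast
    next
      case 2
      have "v \<le> v / vm" using v(1) vm by (simp add: field_simps)
      then have "0 \<le> integral {a..b} (\<lambda>t. S (?w t / v))"
        using 2 ab v ts by (intro S_integral_nonneg bw) (auto simp: extremal_def)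
      then show ?thesis using v by blast
    next
      case 3
      have "0 < t1" using 3 ab by simp
      then have t0: "0 < t0" using t0_pos by simp
      define b' where "b' = min b t1"
      define u where "u = profile t0 b'"
      have b': "t0 \<le> b'" "b' \<le> t1" "a < b'" "b' \<le> b" using 3 ab ts by (auto simp: b'_def)
      have u0: "0 < u" using t0 b' vm by (simp add: u_def profile_def)
      have uv: "u = v" if "b' < b" using that prof_t1[OF \<open>0 < t1\<close>] by (auto simp: b'_def u_def min_def split: if_splits)
      let ?f = "\<lambda>t. S (?w t / u)"
      have int: "?f integrable_on {c..d}" if "c \<le> d" for c d using S_integral(1)[OF bw u0 that] .
      have wu: "u \<le> ?w t" if "t < b'" for t
      proof -
        have "u \<le> vm" unfolding u_def using prof_mono[OF t0 order_refl b'(1)] prof_t0[OF t0] by simp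
        moreover have "t0 \<le> t \<Longrightarrow> u \<le> profile t0 t" unfolding u_def using that t0 by (intro prof_mono) auto
        ultimately show ?thesis using that b' vm by (auto simp: extremal_def)
      qed
      have tail: "0 \<le> integral {b'..b} ?f"
      proof (rule integral_nonneg_interior[OF int[OF b'(4)]])
        fix t assume t: "b' < t" "t < b"
        then have "t1 < t" by (auto simp: b'_def min_def split: if_splits)
        then have "?w t = u" using t uv ts by (auto simp: extremal_def)
        then show "0 \<le> S (?w t / u)" using u0 by simp
      qed
      have head: "0 \<le> integral {a..b'} ?f"
      proof (cases "?w a \<le> u / vm")
        case True
        show ?thesis
          using b' u0 wu w_anti[of a] order_trans[OF w_anti True]
          by (intro S_integral_nonneg bw) auto
      next
        case False
        have "integral {0..a} ?f \<le> 0"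
        proof (rule integral_nonpos_interior[OF int[OF ab(1)]])
          fix t assume "0 < t" "t < a"
          then have "u / vm \<le> ?w t" using False w_anti[of t a] by simp
          then have "1 / vm \<le> ?w t / u" using u0 vm by (simp add: field_simps)
          then show "S (?w t / u) \<le> 0"
            using bounded_weight_pos[OF bw, of t] u0 by (intro S_nonpos) (auto simp: proper_def)
        qed
        moreover have "integral {0..a} ?f + integral {a..b'} ?f = integral {0..b'} ?f"
          using ab b' int by (intro Henstock_Kurzweil_Integration.integral_combine) auto
        moreover have "integral {0..b'} ?f = 0"
          unfolding u_def using t0 b' by (intro init_zero) auto
        ultimately show ?thesis by linarith
      qed
      have "integral {a..b'} ?f + integral {b'..b} ?f = integral {a..b} ?f"
        using b' int ab by (intro Henstock_Kurzweil_Integration.integral_combine) auto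
      then have "0 \<le> integral {a..b} ?f" using head tail by linarith
      then show ?thesis using u0 by blast
    qed
  qed
  have whole: "integral {0..1} (\<lambda>t. box_cox p (?w t)) = t1 * box_cox p (c * v) + (1 - t1) * box_cox p v"
    if "0 < t0 \<Longrightarrow> ((\<lambda>t. box_cox p (?w t)) has_integral t1 * box_cox p (c * profile t0 t1)) {0..t1}" for p c
  proof (rule integral_unique)
    have "((\<lambda>t. box_cox p (?w t)) has_integral t1 * box_cox p (c * v)) {0..t1}"
    proof (cases "0 < t1")
      case True then show ?thesis using that t0_pos prof_t1 by simp
    next
      case False then have "t1 = 0" using t1 by simp
      then show ?thesis using has_integral_refl(2)[of "\<lambda>t. box_cox p (?w t)" "0::real"] by simp
    qed
    moreover have "((\<lambda>t. box_cox p (?w t)) has_integral (1 - t1) * box_cox p v) {t1..1}"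
      using t1 ts by (intro has_integral_const_interior) (auto simp: extremal_def)
    ultimately show "((\<lambda>t. box_cox p (?w t)) has_integral t1 * box_cox p (c * v) + (1 - t1) * box_cox p v) {0..1}"
      using t1 by (meson has_integral_combine)
  qed
  show ?thesis
  proof (rule attainedI[OF wc bw])
    show "integral {0..1} (\<lambda>t. e1 (?w t)) = xi1 x1"
      using whole[of p1 gp] initial1[of t1] ts y1 by simp
    show "integral {0..1} (\<lambda>t. e2 (?w t)) = xi2 x2"
      using whole[of p2 "gp / Q"] initial2[of t1] ts y2 by simp
    have below: "?w t < 1" if "s \<le> t" for t
      using that v vm prof_range[of t] by (auto simp: extremal_def)
    have "{t \<in> {0..1}. 1 \<le> ?w t} = {0..<s}"
    proof (intro equalityI subsetI)
      fix t assume "t \<in> {t \<in> {0..1}. 1 \<le> ?w t}"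
      then have "0 \<le> t" "\<not> s \<le> t" using below[of t] by auto
      then show "t \<in> {0..<s}" by simp
    next
      fix t assume "t \<in> {0..<s}"
      then show "t \<in> {t \<in> {0..1}. 1 \<le> ?w t}" using ts t1 by (auto simp: extremal_def)
    qed
    then have "measure lebesgue {t \<in> {0..1}. 1 \<le> ?w t} = s" using ts by simp
    also have "s = B_fun p1 p2 Q (x1, x2)"
    proof -
      have "en v (xi1 x1) (xi2 x2) = t1 * (v powr (-p1) * (e1 (gp * v) - e1 v) - v powr (-p2) * (e2 (gp * v / Q) - e2 v))"
        unfolding en_eq[OF v(1)] y1 y2 by (simp add: algebra_simps)
      also have "\<dots> = t1 * (e1 gp - e2 (gp / Q))"
        using box_cox_divide[OF p1, of "gp * v" v] box_cox_divide[OF p2, of "gp * v / Q" v] v gp_pos Q1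
        by simp
      also have "\<dots> = t1 * (top_share * E (1 / vm))"
        unfolding top_share_E gp_tangent by (simp add: algebra_simps)
      finally show ?thesis unfolding B using E_inverse_vm_pos by (simp add: s_def t0_def q_def)
    qed
    finally show "measure lebesgue {t \<in> {0..1}. 1 \<le> ?w t} = B_fun p1 p2 Q (x1, x2)" .
  qed
qed

text \<open>
  The four cases of \<open>B_fun_cases\<close> exhaust the domain and carry exactly the inequalities that the constructions need.
\<close>

lemma attained_all:
  assumes "(x1, x2) \<in> Omega p1 p2 Q" shows "attained x1 x2"
  using assms
proof (cases rule: B_fun_cases)
  case I then show ?thesis using attained_I[OF assms] by blast
next
  case II then show ?thesis using attained_II[OF assms] by blast
next
  case (III v) then show ?thesis by (intro attained_III[of v]) auto
next
  case (IV v) then show ?thesis by (intro attained_IV[OF assms, of v]) auto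
qed

section \<open>Scaling and the sharp estimate\<close>

lemma avg_scale:
  assumes "0 < c" "\<And>t. t \<in> J \<Longrightarrow> 0 \<le> w t" "J \<in> sets lebesgue"
  shows "avg J (\<lambda>t. (c * w t) powr p) = c powr p * avg J (\<lambda>t. w t powr p)"
proof -
  have "(LINT t:J|lebesgue. (c * w t) powr p) = (LINT t:J|lebesgue. c powr p * w t powr p)"
    using assms by (intro set_lebesgue_integral_cong) (auto simp: powr_mult)
  then show ?thesis by (simp add: avg_def)
qed

lemma weight_class_scale:
  assumes w: "w \<in> weight_class p1 p2 Q" and c: "0 < c"
  shows "(\<lambda>t. c * w t) \<in> weight_class p1 p2 Q"
proof -
  have nn: "\<And>t. t \<in> {0..1} \<Longrightarrow> 0 \<le> w t" and meas: "w \<in> borel_measurable (lebesgue_on {0..1})"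
    and int: "set_integrable lebesgue {0..1} (\<lambda>t. w t powr p1)" "set_integrable lebesgue {0..1} (\<lambda>t. w t powr p2)"
    and pos: "p1 < 0 \<or> p2 < 0 \<Longrightarrow> AE t in lebesgue_on {0..1}. 0 < w t"
    and rat: "\<And>a b. 0 \<le> a \<Longrightarrow> a < b \<Longrightarrow> b \<le> 1 \<Longrightarrow>
        avg {a..b} (\<lambda>t. w t powr p1) powr (1 / p1) \<le> Q * avg {a..b} (\<lambda>t. w t powr p2) powr (1 / p2)"
    using w unfolding weight_class_def by auto
  have int': "set_integrable lebesgue {0..1} (\<lambda>t. (c * w t) powr p)"
    if "set_integrable lebesgue {0..1} (\<lambda>t. w t powr p)" for p
  proof -
    have "set_integrable lebesgue {0..1} (\<lambda>t. c powr p * w t powr p)" using that by simp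
    then show ?thesis
      by (rule set_integrable_cong[THEN iffD1, rotated -1]) (use c nn in \<open>auto simp: powr_mult\<close>)
  qed
  show ?thesis unfolding weight_class_def
  proof (intro CollectI conjI allI impI ballI)
    show "(\<lambda>t. c * w t) \<in> borel_measurable (lebesgue_on {0..1})" using meas by measurable
    show "0 \<le> c * w t" if "t \<in> {0..1}" for t using nn[OF that] c by simp
    show "AE t in lebesgue_on {0..1}. 0 < c * w t" if "p1 < 0 \<or> p2 < 0"
      using pos[OF that] by eventually_elim (use c in simp)
    show "set_integrable lebesgue {0..1} (\<lambda>t. (c * w t) powr p1)" "set_integrable lebesgue {0..1} (\<lambda>t. (c * w t) powr p2)"
      using int int' by blast+
    fix a b :: real assume ab: "0 \<le> a \<and> a < b \<and> b \<le> 1"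
    have av: "avg {a..b} (\<lambda>t. (c * w t) powr p) = c powr p * avg {a..b} (\<lambda>t. w t powr p)" for p
      using ab nn c by (intro avg_scale) auto
    have avnn: "0 \<le> avg {a..b} (\<lambda>t. w t powr p)" for p
      unfolding avg_def set_lebesgue_integral_def by (intro mult_nonneg_nonneg integral_nonneg_AE) auto
    have "(c powr p * y) powr (1 / p) = c * y powr (1 / p)" if "p \<noteq> 0" "0 \<le> y" for p y
      using that c by (simp add: powr_mult powr_powr)
    then show "avg {a..b} (\<lambda>t. (c * w t) powr p1) powr (1 / p1)
        \<le> Q * avg {a..b} (\<lambda>t. (c * w t) powr p2) powr (1 / p2)"
      unfolding av using rat[of a b] ab avnn p1 p2 c by (simp add: mult.left_commute mult_left_mono)
  qed
qed

lemma admissible_scale: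
  assumes w: "w \<in> admissible p1 p2 Q (x1, x2)" and c: "0 < c"
  shows "(\<lambda>t. c * w t) \<in> admissible p1 p2 Q (c powr p1 * x1, c powr p2 * x2)"
proof -
  have wc: "w \<in> weight_class p1 p2 Q" using w by (simp add: admissible_def)
  then have nn: "\<And>t. t \<in> {0..1} \<Longrightarrow> 0 \<le> w t" by (auto simp: weight_class_def)
  show ?thesis using w weight_class_scale[OF wc c] avg_scale[of c "{0..1}" w, OF c nn]
    by (auto simp: admissible_def)
qed

lemma Omega_scale:
  assumes "(x1, x2) \<in> Omega p1 p2 Q" "0 < c"
  shows "(c powr p1 * x1, c powr p2 * x2) \<in> Omega p1 p2 Q"
  using assms p1 p2 by (auto simp: Omega_def powr_mult powr_powr mult.left_commute)

lemma attained_admissible: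
  assumes "(x1, x2) \<in> Omega p1 p2 Q"
  obtains w where "w \<in> admissible p1 p2 Q (x1, x2)"
    "measure lebesgue {t \<in> {0..1}. 1 \<le> w t} = B_fun p1 p2 Q (x1, x2)"
  using attained_all[OF assms] by (auto simp: attained_def admissible_def)

lemma Sup_level:
  assumes x: "(x1, x2) \<in> Omega p1 p2 Q" and l: "0 < l"
  shows "Sup {measure lebesgue {t \<in> {0..1}. l \<le> w t} | w. w \<in> admissible p1 p2 Q (x1, x2)}
         = B_fun p1 p2 Q (l powr (- p1) * x1, l powr (- p2) * x2)"
proof (rule cSup_eq_maximum)
  define y1 y2 where "y1 = l powr (- p1) * x1" and "y2 = l powr (- p2) * x2"
  have il: "(1 / l) powr p = l powr (- p)" for p using l by (simp add: powr_divide powr_minus_divide)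
  have y: "(y1, y2) \<in> Omega p1 p2 Q" using Omega_scale[OF x, of "1 / l"] l by (simp add: il y1_def y2_def)
  obtain w where w: "w \<in> admissible p1 p2 Q (y1, y2)"
    "measure lebesgue {t \<in> {0..1}. 1 \<le> w t} = B_fun p1 p2 Q (y1, y2)" using attained_admissible[OF y] .
  have "(\<lambda>t. l * w t) \<in> admissible p1 p2 Q (l powr p1 * y1, l powr p2 * y2)"
    by (rule admissible_scale[OF w(1) l])
  moreover have "l powr p1 * y1 = x1" "l powr p2 * y2 = x2"
    using l by (simp_all add: y1_def y2_def mult.assoc[symmetric] powr_add[symmetric])
  moreover have "{t \<in> {0..1}. l \<le> l * w t} = {t \<in> {0..1}. 1 \<le> w t}" using l by auto
  ultimately show "B_fun p1 p2 Q (y1, y2) \<in> {measure lebesgue {t \<in> {0..1}. l \<le> w t} | w. w \<in> admissible p1 p2 Q (x1, x2)}"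
    using w(2) by (intro CollectI exI[of _ "\<lambda>t. l * w t"]) simp
  fix m assume "m \<in> {measure lebesgue {t \<in> {0..1}. l \<le> w t} | w. w \<in> admissible p1 p2 Q (x1, x2)}"
  then obtain w where w: "w \<in> admissible p1 p2 Q (x1, x2)" "m = measure lebesgue {t \<in> {0..1}. l \<le> w t}" by blast
  have "(\<lambda>t. 1 / l * w t) \<in> admissible p1 p2 Q (y1, y2)"
    using admissible_scale[OF w(1), of "1 / l"] l unfolding il y1_def y2_def by simp
  from admissible_upper_bound[OF y this]
  have "measure lebesgue {t \<in> {0..1}. 1 \<le> 1 / l * w t} \<le> B_fun p1 p2 Q (y1, y2)" .
  moreover have "{t \<in> {0..1}. 1 \<le> 1 / l * w t} = {t \<in> {0..1}. l \<le> w t}" using l by (auto simp: field_simps)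
  ultimately show "m \<le> B_fun p1 p2 Q (y1, y2)" using w(2) by simp
qed

end

theorem mainTheorem1:
  fixes p1 p2 Q :: real
  assumes "p1 \<noteq> 0" and "p2 \<noteq> 0" and "p2 < p1" and "1 < Q"
  shows "(\<forall>x \<in> Omega p1 p2 Q. bellman p1 p2 Q x = B_fun p1 p2 Q x) \<and>
    (\<forall>x \<in> Omega p1 p2 Q. \<exists>w \<in> weight_class p1 p2 Q.
       avg {0..1} (\<lambda>t. w t powr p1) = fst x \<and> avg {0..1} (\<lambda>t. w t powr p2) = snd x \<and>
       measure lebesgue {t \<in> {0..1}. 1 \<le> w t} = B_fun p1 p2 Q x) \<and>
    (\<forall>l > 0. \<forall>x1 x2. (x1, x2) \<in> Omega p1 p2 Q \<longrightarrow>
       Sup {measure lebesgue {t \<in> {0..1}. l \<le> w t} | w. w \<in> admissible p1 p2 Q (x1, x2)}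
         = B_fun p1 p2 Q (l powr (- p1) * x1, l powr (- p2) * x2))"
proof -
  interpret bellman_parameters p1 p2 Q by unfold_locales (use assms in auto)
  show ?thesis
  proof (intro conjI ballI allI impI)
    show "bellman p1 p2 Q x = B_fun p1 p2 Q x" if "x \<in> Omega p1 p2 Q" for x
      using Sup_level[of "fst x" "snd x" 1] that by (simp add: bellman_def)
    show "\<exists>w \<in> weight_class p1 p2 Q.
       avg {0..1} (\<lambda>t. w t powr p1) = fst x \<and> avg {0..1} (\<lambda>t. w t powr p2) = snd x \<and>
       measure lebesgue {t \<in> {0..1}. 1 \<le> w t} = B_fun p1 p2 Q x" if "x \<in> Omega p1 p2 Q" for x
      using attained_all[of "fst x" "snd x"] that unfolding attained_def prod.collapse .
  qed (rule Sup_level)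
qed

end
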